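(* Let $\Gamma$ be a discrete group satisfying the AP. Let $X,Y$ be locally compact spaces. Let $\alpha\colon\Gamma\curvearrowright X$ and $\beta\colon\Gamma\curvearrowright Y$ be free actions. Let $\pi\colon Y\to X$ be a proper factor map. Regard $C_0(X)$ as a $\Gamma$-C$^\ast$-subalgebra of $C_0(Y)$ via $\pi$. Then the map $$C_0(Z)\mapsto C_0(Z)\rtimes_{\mathrm r}\Gamma$$ gives a lattice isomorphism between the lattice of intermediate extensions $Z$ of $\pi$ and the lattice of intermediate C$^\ast$-algebras of $C_0(X)\rtimes_{\mathrm r}\Gamma\subset C_0(Y)\rtimes_{\mathrm r}\Gamma$.
   Context: Locally compact spaces are Hausdorff. An action $\Gamma\curvearrowright X$ induces an action on $C_0(X)$ by $\alpha_s(f)=f\circ\alpha_s^{-1}$. An action is free if $\alpha_s(x)\ne x$ for all $x\in X$, $s\neq e$. A factor map is a $\Gamma$-equivariant quotient map $\pi\colon Y\to X$; it is proper if preimages of compact sets are compact. An intermediate extension of $\pi$ is a triple $(\gamma,p,q)$ where $\gamma\colon \Gamma\curvearrowright Z$ is an action on a locally compact space and $p\colon Y\to Z$, $q\colon Z\to X$ are factor maps with $q\circ p=\pi$; triples $(\gamma,p,q)$, $(\gamma',p',q')$ are identified if there is a $\Gamma$-homeomorphism $h\colon Z\to Z'$ with $h\circ p=p'$ and $q=q'\circ h$. After this identification, intermediate extensions of a proper $\pi$ correspond bijectively (Gelfand duality) to $\Gamma$-invariant intermediate C$^\ast$-algebras $C_0(X)\subset C_0(Z)\subset C_0(Y)$,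 and the lattice structure on intermediate extensions is the one transported through this bijection. The lattice operations on intermediate C$^\ast$-algebras are $C\vee D=\mathrm{C}^\ast(C,D)$ (generated C$^\ast$-algebra) and $C\wedge D=C\cap D$. $\rtimes_{\mathrm r}$ denotes the reduced crossed product. AP (approximation property of Haagerup–Kraus). Let $M_0A(\Gamma)$ be the Banach space of completely bounded (Herz–Schur) multipliers of $\Gamma$. It is the dual of the Banach space $Q(\Gamma)$ obtained by completing $\ell^1(\Gamma)$ in the norm $\|f\|_Q=\sup\{|\sum_{s} f(s)\varphi(s)| : \varphi\in M_0A(\Gamma), \|\varphi\|_{M_0A}\le 1\}$. The discrete group $\Gamma$ has the AP if the constant function $1$ lies in the $\sigma(M_0A(\Gamma),Q(\Gamma))$-closure of the finitely supported functions on $\Gamma$. *)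

theory Defs
  imports "HOL-Analysis.Analysis" "HOL-Algebra.Group_Action" "HOL-Library.Equipollence"
begin

section \<open>The Hilbert space of square-summable families\<close>

lemma square_summable_add:
  fixes x y :: "'i \<Rightarrow> complex"
  assumes "(\<lambda>i. (cmod (x i))\<^sup>2) summable_on UNIV" "(\<lambda>i. (cmod (y i))\<^sup>2) summable_on UNIV"
  shows "(\<lambda>i. (cmod (x i + y i))\<^sup>2) summable_on UNIV"
proof -
  have "(\<lambda>i. 2 * (cmod (x i))\<^sup>2 + 2 * (cmod (y i))\<^sup>2) summable_on UNIV"
    using assms by (intro summable_on_add summable_on_cmult_right)
  moreover have "(cmod (x i + y i))\<^sup>2 \<le> 2 * (cmod (x i))\<^sup>2 + 2 * (cmod (y i))\<^sup>2" for i
  proof -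
    have "(cmod (x i + y i))\<^sup>2 \<le> (cmod (x i) + cmod (y i))\<^sup>2"
      by (intro power_mono norm_triangle_ineq) auto
    also have "\<dots> \<le> 2 * (cmod (x i))\<^sup>2 + 2 * (cmod (y i))\<^sup>2"
      using zero_le_power2[of "cmod (x i) - cmod (y i)"]
      by (simp add: power2_sum power2_diff)
    finally show ?thesis .
  qed
  ultimately show ?thesis
    by (rule summable_on_comparison_test) auto
qed

lemma square_summable_cmult:
  fixes x :: "'i \<Rightarrow> complex"
  assumes "(\<lambda>i. (cmod (x i))\<^sup>2) summable_on UNIV"
  shows "(\<lambda>i. (cmod (c * x i))\<^sup>2) summable_on UNIV"
  using summable_on_cmult_right[OF assms, of "(cmod c)\<^sup>2"]
  by (simp add: norm_mult power_mult_distrib)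

lemma square_summable_product:
  fixes x y :: "'i \<Rightarrow> complex"
  assumes "(\<lambda>i. (cmod (x i))\<^sup>2) summable_on UNIV" "(\<lambda>i. (cmod (y i))\<^sup>2) summable_on UNIV"
  shows "(\<lambda>i. cnj (x i) * y i) summable_on UNIV"
proof -
  have "(\<lambda>i. (cmod (x i))\<^sup>2 + (cmod (y i))\<^sup>2) summable_on UNIV"
    using assms by (rule summable_on_add)
  then have "(\<lambda>i. cmod (cnj (x i) * y i)) summable_on UNIV"
  proof (rule summable_on_comparison_test)
    show "cmod (cnj (x i) * y i) \<le> (cmod (x i))\<^sup>2 + (cmod (y i))\<^sup>2" for i
    proof -
      have "2 * (cmod (x i) * cmod (y i)) \<le> (cmod (x i))\<^sup>2 + (cmod (y i))\<^sup>2"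
        using zero_le_power2[of "cmod (x i) - cmod (y i)"] by (simp add: power2_diff)
      moreover have "0 \<le> cmod (x i) * cmod (y i)" by simp
      ultimately show ?thesis by (simp only: norm_mult complex_mod_cnj)
    qed
  qed auto
  then show ?thesis by (rule abs_summable_summable)
qed

typedef 'i ell2 = "{x :: 'i \<Rightarrow> complex. (\<lambda>i. (cmod (x i))\<^sup>2) summable_on UNIV}"
  morphisms ell2_apply Abs_ell2
  by (rule exI[of _ "\<lambda>_. 0"]) simp

setup_lifting type_definition_ell2

instantiation ell2 :: (type) real_vector
begin
lift_definition zero_ell2 :: "'a ell2" is "\<lambda>_. 0" by simp
lift_definition plus_ell2 :: "'a ell2 \<Rightarrow> 'a ell2 \<Rightarrow> 'a ell2" is "\<lambda>x y i. x i + y i"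
  by (rule square_summable_add)
lift_definition uminus_ell2 :: "'a ell2 \<Rightarrow> 'a ell2" is "\<lambda>x i. - x i" by simp
lift_definition minus_ell2 :: "'a ell2 \<Rightarrow> 'a ell2 \<Rightarrow> 'a ell2" is "\<lambda>x y i. x i - y i"
  using square_summable_add[of _ "\<lambda>i. - _ i"] by simp
lift_definition scaleR_ell2 :: "real \<Rightarrow> 'a ell2 \<Rightarrow> 'a ell2" is "\<lambda>r x i. complex_of_real r * x i"
  by (rule square_summable_cmult)
instance
  by standard (transfer, simp add: algebra_simps)+
end

definition cinner :: "'i ell2 \<Rightarrow> 'i ell2 \<Rightarrow> complex" where
  "cinner x y = (\<Sum>\<^sub>\<infinity>i. cnj (ell2_apply x i) * ell2_apply y i)"

lemma cinner_summable: "(\<lambda>i. cnj (ell2_apply x i) * ell2_apply y i) summable_on UNIV"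
  using ell2_apply[of x] ell2_apply[of y] by (auto intro: square_summable_product)

lemma cinner_self:
  "cinner x x = complex_of_real (\<Sum>\<^sub>\<infinity>i. (cmod (ell2_apply x i))\<^sup>2)"
proof -
  let ?f = "\<lambda>i. (cmod (ell2_apply x i))\<^sup>2"
  have "?f summable_on UNIV" using ell2_apply[of x] by simp
  then have "(\<Sum>\<^sub>\<infinity>i. complex_of_real (?f i)) = complex_of_real (infsum ?f UNIV)"
    by (intro infsumI has_sum_of_real has_sum_infsum)
  moreover have "complex_of_real (?f i) = cnj (ell2_apply x i) * ell2_apply x i" for i
    by (metis complex_norm_square mult.commute)
  ultimately show ?thesis by (simp add: cinner_def)
qed

instantiation ell2 :: (type) real_inner
begin
definition inner_ell2 :: "'a ell2 \<Rightarrow> 'a ell2 \<Rightarrow> real" where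
  "inner_ell2 x y = Re (cinner x y)"
definition norm_ell2 :: "'a ell2 \<Rightarrow> real" where
  "norm_ell2 x = sqrt (inner x x)"
definition sgn_ell2 :: "'a ell2 \<Rightarrow> 'a ell2" where
  "sgn_ell2 x = x /\<^sub>R norm x"
definition dist_ell2 :: "'a ell2 \<Rightarrow> 'a ell2 \<Rightarrow> real" where
  "dist_ell2 x y = norm (x - y)"
definition uniformity_ell2 :: "('a ell2 \<times> 'a ell2) filter" where
  "uniformity_ell2 = (INF e\<in>{0<..}. principal {(x, y). dist x y < e})"
definition open_ell2 :: "'a ell2 set \<Rightarrow> bool" where
  "open_ell2 U \<longleftrightarrow> (\<forall>x\<in>U. eventually (\<lambda>(x', y). x' = x \<longrightarrow> y \<in> U) uniformity)"
instance
proof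
  fix x y z :: "'a ell2" and r :: real
  have *: "inner u v = (\<Sum>\<^sub>\<infinity>i. Re (cnj (ell2_apply u i) * ell2_apply v i))" for u v :: "'a ell2"
    unfolding inner_ell2_def cinner_def by (rule infsum_Re[symmetric]) (rule cinner_summable)
  have **: "(\<lambda>i. Re (cnj (ell2_apply u i) * ell2_apply v i)) summable_on UNIV" for u v :: "'a ell2"
    by (rule summable_on_Re) (rule cinner_summable)
  have self: "inner x x = (\<Sum>\<^sub>\<infinity>i. (cmod (ell2_apply x i))\<^sup>2)" for x :: "'a ell2"
    by (simp add: inner_ell2_def cinner_self)
  show "inner x y = inner y x"
    unfolding * by (rule infsum_cong) (simp add: mult.commute)
  show "inner (x + y) z = inner x z + inner y z"
    unfolding * infsum_add[OF ** **, symmetric] plus_ell2.rep_eq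
    by (rule infsum_cong) (simp add: algebra_simps)
  show "inner (r *\<^sub>R x) y = r * inner x y"
    unfolding * infsum_cmult_right'[symmetric] scaleR_ell2.rep_eq
    by (rule infsum_cong) (simp add: algebra_simps)
  show "0 \<le> inner x x"
    unfolding self by (rule infsum_nonneg) simp
  show "(inner x x = 0) = (x = 0)"
  proof
    assume "inner x x = 0"
    then have "(cmod (ell2_apply x i))\<^sup>2 = 0" for i
      unfolding self
      using nonneg_infsum_le_0D[of "\<lambda>i. (cmod (ell2_apply x i))\<^sup>2" UNIV i] ell2_apply[of x] by auto
    then show "x = 0" by transfer auto
  next
    assume "x = 0"
    then show "inner x x = 0" by (simp add: self zero_ell2.rep_eq)
  qed
  show "norm x = sqrt (inner x x)" by (rule norm_ell2_def)
qed (simp_all add: sgn_ell2_def dist_ell2_def uniformity_ell2_def open_ell2_def)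
end

lemma norm_ell2_square: "(norm x)\<^sup>2 = (\<Sum>\<^sub>\<infinity>i. (cmod (ell2_apply x i))\<^sup>2)" for x :: "'i ell2"
  by (metis Re_complex_of_real cinner_self inner_ell2_def power2_norm_eq_inner)

lemma ell2_finite_sum_le:
  fixes x :: "'i ell2"
  assumes "finite F"
  shows "(\<Sum>i\<in>F. (cmod (ell2_apply x i))\<^sup>2) \<le> (norm x)\<^sup>2"
  unfolding norm_ell2_square
  using ell2_apply[of x] assms by (intro finite_sum_le_infsum) auto

lemma ell2_apply_le_norm: "cmod (ell2_apply x i) \<le> norm x"
  using ell2_finite_sum_le[of "{i}" x] by (auto intro!: power2_le_imp_le[of "cmod (ell2_apply x i)" "norm x"])

instance ell2 :: (type) banach
proof
  fix X :: "nat \<Rightarrow> 'a ell2"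
  assume "Cauchy X"
  have "Cauchy (\<lambda>n. ell2_apply (X n) i)" for i
  proof (rule metric_CauchyI)
    fix e :: real
    assume "0 < e"
    then obtain M where M: "\<forall>m\<ge>M. \<forall>n\<ge>M. norm (X m - X n) < e"
      using \<open>Cauchy X\<close> unfolding Cauchy_iff by blast
    have "dist (ell2_apply (X m) i) (ell2_apply (X n) i) < e" if "M \<le> m" "M \<le> n" for m n
    proof -
      have "norm (X m - X n) < e" using M that by blast
      then show ?thesis
        using ell2_apply_le_norm[of "X m - X n" i] by (simp add: dist_norm minus_ell2.rep_eq)
    qed
    then show "\<exists>M. \<forall>m\<ge>M. \<forall>n\<ge>M. dist (ell2_apply (X m) i) (ell2_apply (X n) i) < e" by blast
  qed
  then have "\<exists>l. (\<lambda>n. ell2_apply (X n) i) \<longlonglongrightarrow> l" for i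
    by (simp add: Cauchy_convergent_iff convergent_def)
  then obtain x where x: "\<And>i. (\<lambda>n. ell2_apply (X n) i) \<longlonglongrightarrow> x i" by metis
  have key: "(\<Sum>i\<in>F. (cmod (ell2_apply (X m) i - x i))\<^sup>2) \<le> e\<^sup>2"
    if "finite F" and M: "\<And>n. M \<le> n \<Longrightarrow> norm (X m - X n) \<le> e" for F m M e
  proof (rule LIMSEQ_le_const2)
    show "(\<lambda>n. \<Sum>i\<in>F. (cmod (ell2_apply (X m) i - ell2_apply (X n) i))\<^sup>2)
            \<longlonglongrightarrow> (\<Sum>i\<in>F. (cmod (ell2_apply (X m) i - x i))\<^sup>2)"
      by (intro tendsto_intros x)
    have "(\<Sum>i\<in>F. (cmod (ell2_apply (X m) i - ell2_apply (X n) i))\<^sup>2) \<le> e\<^sup>2" if "M \<le> n" for n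
    proof -
      have "(\<Sum>i\<in>F. (cmod (ell2_apply (X m) i - ell2_apply (X n) i))\<^sup>2) \<le> (norm (X m - X n))\<^sup>2"
        using ell2_finite_sum_le[OF \<open>finite F\<close>, of "X m - X n"] by (simp add: minus_ell2.rep_eq)
      also have "\<dots> \<le> e\<^sup>2" using M[OF that] by (intro power_mono) auto
      finally show ?thesis .
    qed
    then show "\<exists>N. \<forall>n\<ge>N. (\<Sum>i\<in>F. (cmod (ell2_apply (X m) i - ell2_apply (X n) i))\<^sup>2) \<le> e\<^sup>2"
      by blast
  qed
  have ev: "\<exists>M. \<forall>m\<ge>M. \<forall>n\<ge>M. norm (X m - X n) \<le> e" if "0 < e" for e
  proof -
    obtain M where "\<forall>m\<ge>M. \<forall>n\<ge>M. norm (X m - X n) < e"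
      using \<open>Cauchy X\<close> \<open>0 < e\<close> unfolding Cauchy_iff by blast
    then show ?thesis by (intro exI[of _ M]) (simp add: less_imp_le)
  qed
  have summ: "(\<lambda>i. (cmod (ell2_apply (X m) i - x i))\<^sup>2) summable_on UNIV"
    if "\<And>n. M \<le> n \<Longrightarrow> norm (X m - X n) \<le> e" for m M e
  proof (rule nonneg_bdd_above_summable_on)
    show "bdd_above (sum (\<lambda>i. (cmod (ell2_apply (X m) i - x i))\<^sup>2) ` {F. F \<subseteq> UNIV \<and> finite F})"
    proof (rule bdd_aboveI2)
      show "(\<Sum>i\<in>F. (cmod (ell2_apply (X m) i - x i))\<^sup>2) \<le> e\<^sup>2"
        if "F \<in> {F. F \<subseteq> UNIV \<and> finite F}" for F
        by (rule key) (use that in simp, fact)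
    qed
  qed simp
  obtain M where "\<forall>m\<ge>M. \<forall>n\<ge>M. norm (X m - X n) \<le> 1" using ev[OF zero_less_one] by blast
  then have "\<And>n. M \<le> n \<Longrightarrow> norm (X M - X n) \<le> 1" by blast
  from summ[OF this] have "(\<lambda>i. (cmod (- 1 * (ell2_apply (X M) i - x i)))\<^sup>2) summable_on UNIV"
    by (rule square_summable_cmult)
  moreover have "(\<lambda>i. (cmod (ell2_apply (X M) i))\<^sup>2) summable_on UNIV"
    using ell2_apply[of "X M"] by simp
  ultimately have "(\<lambda>i. (cmod (- 1 * (ell2_apply (X M) i - x i) + ell2_apply (X M) i))\<^sup>2) summable_on UNIV"
    by (rule square_summable_add)
  then have L: "ell2_apply (Abs_ell2 x) = x" by (simp add: Abs_ell2_inverse)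
  have "X \<longlonglongrightarrow> Abs_ell2 x"
  proof (rule LIMSEQ_I)
    fix r :: real
    assume "0 < r"
    then obtain M where "\<forall>m\<ge>M. \<forall>n\<ge>M. norm (X m - X n) \<le> r / 2"
      using ev[OF half_gt_zero] by blast
    then have M: "\<And>m n. M \<le> m \<Longrightarrow> M \<le> n \<Longrightarrow> norm (X m - X n) \<le> r / 2" by blast
    have "norm (X m - Abs_ell2 x) < r" if "M \<le> m" for m
    proof -
      have "(norm (X m - Abs_ell2 x))\<^sup>2 \<le> (r / 2)\<^sup>2"
        unfolding norm_ell2_square minus_ell2.rep_eq L
        by (rule infsum_le_finite_sums[OF summ[OF M[OF that]] key[OF _ M[OF that]]])
      then have "norm (X m - Abs_ell2 x) \<le> r / 2"
        by (rule power2_le_imp_le) (use \<open>0 < r\<close> in simp)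
      then show ?thesis using \<open>0 < r\<close> by simp
    qed
    then show "\<exists>no. \<forall>n\<ge>no. norm (X n - Abs_ell2 x) < r" by blast
  qed
  then show "convergent X" by (rule convergentI)
qed


section \<open>Operators and operator algebras\<close>

text \<open>
  Weighted composition operators: \<^term>\<open>wcomp a \<sigma>\<close> maps \<open>x\<close> to the family \<open>a i * x (\<sigma> i)\<close>.
  All operators generating the algebras below have this form.  The lemma \<open>wcomp_apply\<close> gives a
  condition under which the operator is bounded, so that \<^const>\<open>Blinfun\<close> is meaningful.
\<close>

definition wcomp :: "('i \<Rightarrow> complex) \<Rightarrow> ('i \<Rightarrow> 'i) \<Rightarrow> 'i ell2 \<Rightarrow>\<^sub>L 'i ell2" where
  "wcomp a \<sigma> = Blinfun (\<lambda>x. Abs_ell2 (\<lambda>i. a i * ell2_apply x (\<sigma> i)))"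

lemma wcomp_square_summable:
  fixes a :: "'i \<Rightarrow> complex"
  assumes bdd: "\<And>i. cmod (a i) \<le> B" and inj: "inj_on \<sigma> {i. a i \<noteq> 0}"
  shows "(\<lambda>i. (cmod (a i * ell2_apply x (\<sigma> i)))\<^sup>2) summable_on UNIV"
    and "(\<Sum>\<^sub>\<infinity>i. (cmod (a i * ell2_apply x (\<sigma> i)))\<^sup>2) \<le> (B * norm x)\<^sup>2"
proof -
  let ?S = "{i. a i \<noteq> 0}" and ?f = "\<lambda>i. (cmod (ell2_apply x i))\<^sup>2"
  let ?g = "\<lambda>i. (cmod (a i * ell2_apply x (\<sigma> i)))\<^sup>2"
  have sm: "?f summable_on UNIV" using ell2_apply[of x] by simp
  have smi: "?f summable_on (\<sigma> ` ?S)" by (rule summable_on_subset_banach[OF sm]) auto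
  then have sS: "(\<lambda>i. ?f (\<sigma> i)) summable_on ?S"
    using summable_on_reindex[OF inj, of ?f] by (simp add: o_def)
  then have sB: "(\<lambda>i. B\<^sup>2 * ?f (\<sigma> i)) summable_on ?S" by (rule summable_on_cmult_right)
  have le: "?g i \<le> B\<^sup>2 * ?f (\<sigma> i)" for i
    by (simp add: norm_mult power_mult_distrib mult_right_mono power_mono bdd)
  have gS: "?g summable_on ?S" by (rule summable_on_comparison_test[OF sB]) (use le in auto)
  show gU: "?g summable_on UNIV"
    using gS by (subst summable_on_cong_neutral[where T = ?S and g = ?g]) auto
  have "infsum ?g UNIV = infsum ?g ?S" by (rule infsum_cong_neutral) auto
  also have "\<dots> \<le> (\<Sum>\<^sub>\<infinity>i\<in>?S. B\<^sup>2 * ?f (\<sigma> i))" by (rule infsum_mono[OF gS sB]) (rule le)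
  also have "\<dots> = B\<^sup>2 * infsum ?f (\<sigma> ` ?S)"
    by (simp add: infsum_cmult_right' infsum_reindex[OF inj] o_def)
  also have "\<dots> \<le> B\<^sup>2 * infsum ?f UNIV"
    by (intro mult_left_mono infsum_mono2 smi sm) auto
  finally show "infsum ?g UNIV \<le> (B * norm x)\<^sup>2"
    by (simp add: power_mult_distrib norm_ell2_square)
qed

lemma wcomp_apply:
  fixes a :: "'i \<Rightarrow> complex"
  assumes bdd: "\<And>i. cmod (a i) \<le> B" and inj: "inj_on \<sigma> {i. a i \<noteq> 0}"
  shows "ell2_apply (blinfun_apply (wcomp a \<sigma>) x) i = a i * ell2_apply x (\<sigma> i)"
proof -
  let ?T = "\<lambda>x. Abs_ell2 (\<lambda>i. a i * ell2_apply x (\<sigma> i))"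
  have T: "ell2_apply (?T x) = (\<lambda>i. a i * ell2_apply x (\<sigma> i))" for x
    using wcomp_square_summable(1)[OF assms, of x] by (simp add: Abs_ell2_inverse)
  have "0 \<le> B" using bdd[of undefined] norm_ge_zero order_trans by blast
  then have "norm (?T x) \<le> norm x * B" for x
    using wcomp_square_summable(2)[OF assms, of x]
    by (intro power2_le_imp_le[of "norm (?T x)"])
       (auto simp: norm_ell2_square T mult.commute)
  moreover have "?T (x + y) = ?T x + ?T y" "?T (r *\<^sub>R x) = r *\<^sub>R ?T x" for x y r
    unfolding ell2_apply_inject[symmetric] T
    unfolding plus_ell2.rep_eq scaleR_ell2.rep_eq
    unfolding T
    by (auto simp: algebra_simps)
  ultimately have "bounded_linear ?T" by (intro bounded_linear_intro)
  then show ?thesis by (simp add: wcomp_def bounded_linear_Blinfun_apply T)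
qed

definition cscale :: "complex \<Rightarrow> ('i ell2 \<Rightarrow>\<^sub>L 'i ell2) \<Rightarrow> ('i ell2 \<Rightarrow>\<^sub>L 'i ell2)" where
  "cscale c T = wcomp (\<lambda>_. c) id o\<^sub>L T"

definition is_adjoint :: "('i ell2 \<Rightarrow>\<^sub>L 'i ell2) \<Rightarrow> ('i ell2 \<Rightarrow>\<^sub>L 'i ell2) \<Rightarrow> bool" where
  "is_adjoint S T \<longleftrightarrow>
     (\<forall>x y. cinner (blinfun_apply S x) y = cinner x (blinfun_apply T y))"

text \<open>
  Elements of \<^typ>\<open>'i ell2 \<Rightarrow>\<^sub>L 'i ell2\<close> are only real-linear a priori; an operator possessing an
  adjoint for \<^const>\<open>cinner\<close> is complex-linear, so the following are the C*-subalgebras of the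
  bounded complex-linear operators.
\<close>

definition op_cstar_algebra :: "('i ell2 \<Rightarrow>\<^sub>L 'i ell2) set \<Rightarrow> bool" where
  "op_cstar_algebra A \<longleftrightarrow>
     0 \<in> A \<and>
     (\<forall>S\<in>A. \<forall>T\<in>A. S + T \<in> A) \<and>
     (\<forall>c. \<forall>T\<in>A. cscale c T \<in> A) \<and>
     (\<forall>S\<in>A. \<forall>T\<in>A. S o\<^sub>L T \<in> A) \<and>
     (\<forall>T\<in>A. \<exists>S\<in>A. is_adjoint S T) \<and>
     closed A"

definition op_cstar_gen :: "('i ell2 \<Rightarrow>\<^sub>L 'i ell2) set \<Rightarrow> ('i ell2 \<Rightarrow>\<^sub>L 'i ell2) set" where
  "op_cstar_gen M = \<Inter> {A. op_cstar_algebra A \<and> M \<subseteq> A}"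


section \<open>The approximation property\<close>

text \<open>The operator \<open>E\<^sub>i\<^sub>j \<otimes> \<lambda>\<^sub>s\<close> on \<open>\<complex>\<^sup>n \<otimes> \<ell>\<^sup>2(\<Gamma>)\<close>, where \<open>E\<^sub>i\<^sub>j\<close> is a matrix unit.\<close>

definition unit_shift ::
  "('g, 'm) monoid_scheme \<Rightarrow> nat \<Rightarrow> nat \<Rightarrow> 'g \<Rightarrow> ('g \<times> nat) ell2 \<Rightarrow>\<^sub>L ('g \<times> nat) ell2" where
  "unit_shift G i j s =
     wcomp (\<lambda>(t, k). if t \<in> carrier G \<and> k = i then 1 else 0) (\<lambda>(t, k). (inv\<^bsub>G\<^esub> s \<otimes>\<^bsub>G\<^esub> t, j))"

text \<open>
  \<open>\<Sum>\<^sub>s a(s) \<otimes> \<lambda>\<^sub>s\<close> for a function \<open>a\<close> from \<open>S\<close> to the complex \<open>n \<times> n\<close> matrices.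
\<close>

definition matrix_group_op ::
  "('g, 'm) monoid_scheme \<Rightarrow> nat \<Rightarrow> 'g set \<Rightarrow> ('g \<Rightarrow> nat \<Rightarrow> nat \<Rightarrow> complex)
     \<Rightarrow> ('g \<times> nat) ell2 \<Rightarrow>\<^sub>L ('g \<times> nat) ell2" where
  "matrix_group_op G n S a = (\<Sum>s\<in>S. \<Sum>i<n. \<Sum>j<n. cscale (a s i j) (unit_shift G i j s))"

text \<open>
  \<open>K\<close> bounds the completely bounded norm of the multiplier \<open>\<lambda>\<^sub>s \<mapsto> \<phi>(s) \<lambda>\<^sub>s\<close> on the linear span of
  the \<open>\<lambda>\<^sub>s\<close>, which is dense in the reduced group C*-algebra.
\<close>

definition cb_bound ::
  "('g, 'm) monoid_scheme \<Rightarrow> ('g \<Rightarrow> complex) \<Rightarrow> real \<Rightarrow> bool" where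
  "cb_bound G \<phi> K \<longleftrightarrow> 0 \<le> K \<and>
     (\<forall>n S a. finite S \<and> S \<subseteq> carrier G \<longrightarrow>
        norm (matrix_group_op G n S (\<lambda>s i j. \<phi> s * a s i j)) \<le> K * norm (matrix_group_op G n S a))"

text \<open>Functions on \<open>\<Gamma>\<close> are normalised to vanish outside \<^term>\<open>carrier G\<close>.\<close>

definition M0A :: "('g, 'm) monoid_scheme \<Rightarrow> ('g \<Rightarrow> complex) set" where
  "M0A G = {\<phi>. (\<forall>s. s \<notin> carrier G \<longrightarrow> \<phi> s = 0) \<and> (\<exists>K. cb_bound G \<phi> K)}"

definition M0A_norm :: "('g, 'm) monoid_scheme \<Rightarrow> ('g \<Rightarrow> complex) \<Rightarrow> real" where
  "M0A_norm G \<phi> = Inf {K. cb_bound G \<phi> K}"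

text \<open>
  The norm on \<open>\<ell>\<^sup>1(\<Gamma>)\<close> defining \<open>Q(\<Gamma>)\<close> is the dual norm for the pairing with \<open>M\<^sub>0A(\<Gamma>)\<close>.
  Its completion is therefore the norm closure of \<open>\<ell>\<^sup>1(\<Gamma>)\<close> in the dual of \<open>M\<^sub>0A(\<Gamma>)\<close>; its elements
  are represented here as functionals, of which only the values on \<^term>\<open>M0A G\<close> matter.
\<close>

definition Q_space :: "('g, 'm) monoid_scheme \<Rightarrow> (('g \<Rightarrow> complex) \<Rightarrow> complex) set" where
  "Q_space G = {\<omega>. \<forall>e>0. \<exists>f. (\<lambda>s. cmod (f s)) summable_on carrier G \<and>
     (\<forall>\<phi>\<in>M0A G. cmod (\<omega> \<phi> - (\<Sum>\<^sub>\<infinity>s\<in>carrier G. f s * \<phi> s)) \<le> e * M0A_norm G \<phi>)}"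

definition M0A_weak_topology :: "('g, 'm) monoid_scheme \<Rightarrow> ('g \<Rightarrow> complex) topology" where
  "M0A_weak_topology G =
     topology_generated_by {{\<phi>\<in>M0A G. \<omega> \<phi> \<in> U} | \<omega> U. \<omega> \<in> Q_space G \<and> open U}"

definition approximation_property :: "('g, 'm) monoid_scheme \<Rightarrow> bool" where
  "approximation_property G \<longleftrightarrow>
     indicator (carrier G) \<in> M0A_weak_topology G closure_of {\<phi>\<in>M0A G. finite {s. \<phi> s \<noteq> 0}}"


section \<open>Actions and extensions\<close>

definition top_action ::
  "('g, 'm) monoid_scheme \<Rightarrow> 'x topology \<Rightarrow> ('g \<Rightarrow> 'x \<Rightarrow> 'x) \<Rightarrow> bool" where
  "top_action G X \<alpha> \<longleftrightarrow>
     group_action G (topspace X) \<alpha> \<and> (\<forall>s\<in>carrier G. homeomorphic_map X X (\<alpha> s))"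

definition free_action ::
  "('g, 'm) monoid_scheme \<Rightarrow> 'x topology \<Rightarrow> ('g \<Rightarrow> 'x \<Rightarrow> 'x) \<Rightarrow> bool" where
  "free_action G X \<alpha> \<longleftrightarrow>
     (\<forall>s\<in>carrier G. s \<noteq> \<one>\<^bsub>G\<^esub> \<longrightarrow> (\<forall>x\<in>topspace X. \<alpha> s x \<noteq> x))"

definition factor_map ::
  "('g, 'm) monoid_scheme \<Rightarrow> 'y topology \<Rightarrow> ('g \<Rightarrow> 'y \<Rightarrow> 'y) \<Rightarrow> 'x topology \<Rightarrow> ('g \<Rightarrow> 'x \<Rightarrow> 'x)
     \<Rightarrow> ('y \<Rightarrow> 'x) \<Rightarrow> bool" where
  "factor_map G Y \<beta> X \<alpha> \<pi> \<longleftrightarrow>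
     quotient_map Y X \<pi> \<and> (\<forall>s\<in>carrier G. \<forall>y\<in>topspace Y. \<pi> (\<beta> s y) = \<alpha> s (\<pi> y))"

definition preimages_compact :: "'y topology \<Rightarrow> 'x topology \<Rightarrow> ('y \<Rightarrow> 'x) \<Rightarrow> bool" where
  "preimages_compact Y X \<pi> \<longleftrightarrow>
     (\<forall>K. compactin X K \<longrightarrow> compactin Y {y\<in>topspace Y. \<pi> y \<in> K})"

record ('g, 'x, 'y, 'z) extension =
  ext_space :: "'z topology"
  ext_act :: "'g \<Rightarrow> 'z \<Rightarrow> 'z"
  ext_from :: "'y \<Rightarrow> 'z"
  ext_to :: "'z \<Rightarrow> 'x"

definition intermediate_extensions ::
  "('g, 'm) monoid_scheme \<Rightarrow> 'x topology \<Rightarrow> ('g \<Rightarrow> 'x \<Rightarrow> 'x) \<Rightarrow> 'y topology \<Rightarrow> ('g \<Rightarrow> 'y \<Rightarrow> 'y)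
     \<Rightarrow> ('y \<Rightarrow> 'x) \<Rightarrow> ('g, 'x, 'y, 'z) extension set" where
  "intermediate_extensions G X \<alpha> Y \<beta> \<pi> =
     {E. locally_compact_space (ext_space E) \<and> Hausdorff_space (ext_space E) \<and>
         top_action G (ext_space E) (ext_act E) \<and>
         factor_map G Y \<beta> (ext_space E) (ext_act E) (ext_from E) \<and>
         factor_map G (ext_space E) (ext_act E) X \<alpha> (ext_to E) \<and>
         (\<forall>y\<in>topspace Y. ext_to E (ext_from E y) = \<pi> y)}"

definition extension_iso ::
  "('g, 'm) monoid_scheme \<Rightarrow> 'y topology \<Rightarrow> ('g, 'x, 'y, 'z) extension
     \<Rightarrow> ('g, 'x, 'y, 'z) extension \<Rightarrow> bool" where
  "extension_iso G Y E E' \<longleftrightarrow>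
     (\<exists>h. homeomorphic_map (ext_space E) (ext_space E') h \<and>
          (\<forall>s\<in>carrier G. \<forall>z\<in>topspace (ext_space E). h (ext_act E s z) = ext_act E' s (h z)) \<and>
          (\<forall>y\<in>topspace Y. h (ext_from E y) = ext_from E' y) \<and>
          (\<forall>z\<in>topspace (ext_space E). ext_to E z = ext_to E' (h z)))"

definition extension_classes ::
  "('g, 'm) monoid_scheme \<Rightarrow> 'x topology \<Rightarrow> ('g \<Rightarrow> 'x \<Rightarrow> 'x) \<Rightarrow> 'y topology \<Rightarrow> ('g \<Rightarrow> 'y \<Rightarrow> 'y)
     \<Rightarrow> ('y \<Rightarrow> 'x) \<Rightarrow> ('g, 'x, 'y, 'z) extension set set" where
  "extension_classes G X \<alpha> Y \<beta> \<pi> =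
     intermediate_extensions G X \<alpha> Y \<beta> \<pi> //
       {(E, E'). E \<in> intermediate_extensions G X \<alpha> Y \<beta> \<pi> \<and>
                 E' \<in> intermediate_extensions G X \<alpha> Y \<beta> \<pi> \<and> extension_iso G Y E E'}"


section \<open>Function algebras\<close>

text \<open>Functions are normalised to vanish outside the space.\<close>

definition C0 :: "'x topology \<Rightarrow> ('x \<Rightarrow> complex) set" where
  "C0 X = {f. continuous_map X euclidean f \<and>
              (\<forall>e>0. compactin X {x\<in>topspace X. e \<le> cmod (f x)}) \<and>
              (\<forall>x. x \<notin> topspace X \<longrightarrow> f x = 0)}"

text \<open>\<open>C\<^sub>0(X)\<close> as a subalgebra of \<open>C\<^sub>0(Y)\<close>, embedded by composition with \<open>p : Y \<rightarrow> X\<close>.\<close>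

definition C0_via :: "'y topology \<Rightarrow> ('y \<Rightarrow> 'x) \<Rightarrow> 'x topology \<Rightarrow> ('y \<Rightarrow> complex) set" where
  "C0_via Y p X = {(\<lambda>y. if y \<in> topspace Y then f (p y) else 0) | f. f \<in> C0 X}"

definition fun_cstar_algebra :: "'y topology \<Rightarrow> ('y \<Rightarrow> complex) set \<Rightarrow> bool" where
  "fun_cstar_algebra Y A \<longleftrightarrow>
     A \<subseteq> C0 Y \<and>
     (\<lambda>_. 0) \<in> A \<and>
     (\<forall>f\<in>A. \<forall>g\<in>A. (\<lambda>y. f y + g y) \<in> A) \<and>
     (\<forall>c. \<forall>f\<in>A. (\<lambda>y. c * f y) \<in> A) \<and>
     (\<forall>f\<in>A. \<forall>g\<in>A. (\<lambda>y. f y * g y) \<in> A) \<and>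
     (\<forall>f\<in>A. (\<lambda>y. cnj (f y)) \<in> A) \<and>
     (\<forall>f\<in>C0 Y. (\<forall>e>0. \<exists>g\<in>A. \<forall>y\<in>topspace Y. cmod (f y - g y) \<le> e) \<longrightarrow> f \<in> A)"

definition fun_cstar_gen :: "'y topology \<Rightarrow> ('y \<Rightarrow> complex) set \<Rightarrow> ('y \<Rightarrow> complex) set" where
  "fun_cstar_gen Y M = \<Inter> {A. fun_cstar_algebra Y A \<and> M \<subseteq> A}"

text \<open>
  The subalgebra \<open>C\<^sub>0(Z)\<close> of \<open>C\<^sub>0(Y)\<close> attached to a class of extensions; it is the same for all
  representatives.
\<close>

definition class_C0 ::
  "'y topology \<Rightarrow> ('g, 'x, 'y, 'z) extension set \<Rightarrow> ('y \<Rightarrow> complex) set" where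
  "class_C0 Y c = the_elem ((\<lambda>E. C0_via Y (ext_from E) (ext_space E)) ` c)"

text \<open>Transport of the lattice operations along the injection \<^const>\<open>class_C0\<close>.\<close>

definition extension_join ::
  "'y topology \<Rightarrow> ('g, 'x, 'y, 'z) extension set set \<Rightarrow> ('g, 'x, 'y, 'z) extension set
     \<Rightarrow> ('g, 'x, 'y, 'z) extension set \<Rightarrow> ('g, 'x, 'y, 'z) extension set" where
  "extension_join Y L c d =
     the_inv_into L (class_C0 Y) (fun_cstar_gen Y (class_C0 Y c \<union> class_C0 Y d))"

definition extension_meet ::
  "'y topology \<Rightarrow> ('g, 'x, 'y, 'z) extension set set \<Rightarrow> ('g, 'x, 'y, 'z) extension set
     \<Rightarrow> ('g, 'x, 'y, 'z) extension set \<Rightarrow> ('g, 'x, 'y, 'z) extension set" where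
  "extension_meet Y L c d = the_inv_into L (class_C0 Y) (class_C0 Y c \<inter> class_C0 Y d)"


section \<open>Reduced crossed products\<close>

text \<open>
  \<open>C\<^sub>0(Y)\<close> is represented faithfully by multiplication operators on \<open>\<ell>\<^sup>2(Y)\<close>.  The induced regular
  covariant representation acts on \<open>\<ell>\<^sup>2(\<Gamma>, \<ell>\<^sup>2(Y)) = \<ell>\<^sup>2(\<Gamma> \<times> Y)\<close> by
  \<open>(f \<xi>)(t) = \<alpha>\<^sub>t\<^sup>-\<^sup>1(f) \<xi>(t)\<close> and \<open>(\<lambda>\<^sub>s \<xi>)(t) = \<xi>(s\<^sup>-\<^sup>1 t)\<close>, where \<open>\<alpha>\<^sub>t\<^sup>-\<^sup>1(f) = f \<circ> \<beta>\<^sub>t\<close>.  The operator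
  below is \<open>f \<lambda>\<^sub>s\<close>, extended by zero from \<open>\<ell>\<^sup>2(\<Gamma> \<times> Y)\<close> to all families indexed by the type.
\<close>

definition crossed_op ::
  "('g, 'm) monoid_scheme \<Rightarrow> 'y topology \<Rightarrow> ('g \<Rightarrow> 'y \<Rightarrow> 'y) \<Rightarrow> ('y \<Rightarrow> complex) \<Rightarrow> 'g
     \<Rightarrow> ('g \<times> 'y) ell2 \<Rightarrow>\<^sub>L ('g \<times> 'y) ell2" where
  "crossed_op G Y \<beta> f s =
     wcomp (\<lambda>(t, y). if t \<in> carrier G \<and> y \<in> topspace Y then f (\<beta> t y) else 0)
           (\<lambda>(t, y). (inv\<^bsub>G\<^esub> s \<otimes>\<^bsub>G\<^esub> t, y))"

text \<open>
  The reduced crossed product of a \<open>\<Gamma>\<close>-invariant C*-subalgebra \<open>A\<close> of \<open>C\<^sub>0(Y)\<close>: the closure of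
  the sums of the operators \<open>f \<lambda>\<^sub>s\<close>.  Up to isomorphism it does not depend on the faithful
  representation of \<open>A\<close>, so using that of \<open>C\<^sub>0(Y)\<close> realises the canonical inclusions.  As \<open>A\<close> is a
  complex vector space, the real linear \<^const>\<open>span\<close> is a complex subspace.
\<close>

definition crossed_product ::
  "('g, 'm) monoid_scheme \<Rightarrow> 'y topology \<Rightarrow> ('g \<Rightarrow> 'y \<Rightarrow> 'y) \<Rightarrow> ('y \<Rightarrow> complex) set
     \<Rightarrow> (('g \<times> 'y) ell2 \<Rightarrow>\<^sub>L ('g \<times> 'y) ell2) set" where
  "crossed_product G Y \<beta> A = closure (span {crossed_op G Y \<beta> f s | f s. f \<in> A \<and> s \<in> carrier G})"

definition intermediate_algebras ::
  "('i ell2 \<Rightarrow>\<^sub>L 'i ell2) set \<Rightarrow> ('i ell2 \<Rightarrow>\<^sub>L 'i ell2) set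
     \<Rightarrow> ('i ell2 \<Rightarrow>\<^sub>L 'i ell2) set set" where
  "intermediate_algebras A B = {D. op_cstar_algebra D \<and> A \<subseteq> D \<and> D \<subseteq> B}"


section \<open>Lattices given by their operations on a carrier set\<close>

definition lattice_ops :: "'a set \<Rightarrow> ('a \<Rightarrow> 'a \<Rightarrow> 'a) \<Rightarrow> ('a \<Rightarrow> 'a \<Rightarrow> 'a) \<Rightarrow> bool" where
  "lattice_ops L jn mt \<longleftrightarrow>
     (\<forall>a\<in>L. \<forall>b\<in>L. jn a b \<in> L \<and> mt a b \<in> L \<and> jn a b = jn b a \<and> mt a b = mt b a \<and>
        jn a (mt a b) = a \<and> mt a (jn a b) = a) \<and>
     (\<forall>a\<in>L. \<forall>b\<in>L. \<forall>c\<in>L. jn (jn a b) c = jn a (jn b c) \<and> mt (mt a b) c = mt a (mt b c))"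

definition lattice_isomorphism ::
  "'a set \<Rightarrow> ('a \<Rightarrow> 'a \<Rightarrow> 'a) \<Rightarrow> ('a \<Rightarrow> 'a \<Rightarrow> 'a) \<Rightarrow>
   'b set \<Rightarrow> ('b \<Rightarrow> 'b \<Rightarrow> 'b) \<Rightarrow> ('b \<Rightarrow> 'b \<Rightarrow> 'b) \<Rightarrow> ('a \<Rightarrow> 'b) \<Rightarrow> bool" where
  "lattice_isomorphism L jn mt L' jn' mt' \<Phi> \<longleftrightarrow>
     lattice_ops L jn mt \<and> lattice_ops L' jn' mt' \<and> bij_betw \<Phi> L L' \<and>
     (\<forall>a\<in>L. \<forall>b\<in>L. \<Phi> (jn a b) = jn' (\<Phi> a) (\<Phi> b) \<and> \<Phi> (mt a b) = mt' (\<Phi> a) (\<Phi> b))"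

end

theory Submission
  imports Defs
begin

text \<open>
  Let \<open>D\<close> be an intermediate algebra.  By freeness, every finite set of group elements other than the
  unit moves small open subsets of \<open>X\<close> off themselves, so compressing \<open>T \<in> D\<close> by the functions of a
  suitable partition of unity in \<open>C\<^sub>0(X)\<close> shows that every Fourier coefficient term \<open>E(T \<lambda>\<^sub>s\<^sup>*) \<lambda>\<^sub>s\<close> of \<open>T\<close>
  lies in \<open>D\<close>.  Herz--Schur multipliers act boundedly on the crossed product, since they act as
  Schur multipliers on its matrix entries; hence a functional separating \<open>T\<close> from the closed span of its
  terms would define an element of \<open>Q(\<Gamma>)\<close> that vanishes on finitely supported multipliers but not at the
  constant function, against the approximation property.  So \<open>D\<close> is the crossed product of
  \<open>D \<inter> C\<^sub>0(Y)\<close>.  Invariant intermediate algebras of \<open>C\<^sub>0(Y)\<close> in turn correspond to extensions by the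
  Stone--Weierstrass theorem, and order isomorphisms preserve lattice operations.
\<close>

section \<open>Functions vanishing at infinity\<close>

text \<open>\<open>C0 X\<close> need not have a unit, so the unitaries \<lambda>(s) need not lie in
  the crossed products, and f\<lambda>(e) cannot be turned into f\<lambda>(s) by multiplying with
  them. Their place is taken by u\<lambda>(s) with u from \<open>C0 X\<close>; properness puts these
  u into \<open>C0 Y\<close>, and they contain an approximate unit of it. The compressing functions
  h_i are normalised by their squares: a sandwich multiplies the coefficient at r by the sum of the
  products of h_i with its translate under s r^(-1). For r = s this is the sum of squares, equal to
  1 on a prescribed compact set; for the other r in a finite set it is 0. The compression is a
  contraction however many functions are used. The approximation property gives no norm bound on the
  finitely supported multipliers that tend to 1, so their images of T cannot be used as a norm
  approximation of T. This forces the detour through a separating functional. Operators form only a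
  real vector space here, so that functional is found over the reals and then complexified.\<close>

lemma C0_continuous: "f \<in> C0 X \<Longrightarrow> continuous_map X euclidean f"
  and C0_compact: "f \<in> C0 X \<Longrightarrow> 0 < e \<Longrightarrow> compactin X {x \<in> topspace X. e \<le> cmod (f x)}"
  and C0_outside: "f \<in> C0 X \<Longrightarrow> x \<notin> topspace X \<Longrightarrow> f x = 0"
  by (auto simp: C0_def)

lemma closedin_norm_ge:
  fixes f :: "'x \<Rightarrow> complex"
  assumes "continuous_map X euclidean f"
  shows "closedin X {x \<in> topspace X. e \<le> cmod (f x)}"
proof -
  have "closedin X {x \<in> topspace X. f x \<in> {z. e \<le> cmod z}}"
    by (rule closedin_continuous_map_preimage[OF assms])
       (auto intro!: closed_Collect_le continuous_intros)
  then show ?thesis by simp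
qed

text \<open>Superlevel sets of a continuous function are closed, so lying inside some compact set
  already makes them compact.\<close>

lemma C0I:
  assumes "continuous_map X euclidean f"
    and "\<And>e. 0 < e \<Longrightarrow> \<exists>K. compactin X K \<and> {x \<in> topspace X. e \<le> cmod (f x)} \<subseteq> K"
    and "\<And>x. x \<notin> topspace X \<Longrightarrow> f x = 0"
  shows "f \<in> C0 X"
  unfolding C0_def using assms closed_compactin closedin_norm_ge by blast

text \<open>Only values of modulus at least 1 need control, and those form the continuous image of a
  compact set.\<close>

lemma C0_bounded:
  assumes "f \<in> C0 X"
  obtains B where "\<And>x. cmod (f x) \<le> B"
proof -
  have "compactin euclidean (f ` {x \<in> topspace X. 1 \<le> cmod (f x)})"
    by (rule image_compactin[OF C0_compact[OF assms]]) (use assms C0_continuous in auto)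
  then have "bounded (f ` {x \<in> topspace X. 1 \<le> cmod (f x)})"
    by (simp add: compact_imp_bounded)
  then obtain B where B: "\<And>x. x \<in> topspace X \<Longrightarrow> 1 \<le> cmod (f x) \<Longrightarrow> cmod (f x) \<le> B"
    unfolding bounded_iff by blast
  have "cmod (f x) \<le> max B 1" for x
    using B[of x] C0_outside[OF assms, of x] by (cases "x \<in> topspace X") (auto simp: le_max_iff_disj)
  then show thesis by (rule that)
qed

lemma continuous_map_of_uniform_approx:
  fixes f :: "'x \<Rightarrow> complex"
  assumes "\<And>e. 0 < e \<Longrightarrow> \<exists>g. continuous_map X euclidean g \<and> (\<forall>x\<in>topspace X. cmod (f x - g x) \<le> e)"
  shows "continuous_map X euclidean f"
proof -
  have "continuous_map X Met_TC.mtopology f"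
    unfolding Met_TC.continuous_map_to_metric
  proof (intro ballI allI impI)
    fix x and e :: real assume x: "x \<in> topspace X" and e: "0 < e"
    obtain g where g: "continuous_map X euclidean g" "\<forall>x\<in>topspace X. cmod (f x - g x) \<le> e/4"
      using assms[of "e/4"] e by auto
    have "continuous_map X Met_TC.mtopology g" using g(1) by simp
    then obtain U where U: "openin X U" "x \<in> U" "\<forall>y\<in>U. g y \<in> Met_TC.mball (g x) (e/4)"
      unfolding Met_TC.continuous_map_to_metric using x e by (meson divide_pos_pos zero_less_numeral)
    have "f y \<in> Met_TC.mball (f x) e" if "y \<in> U" for y
    proof -
      have y: "y \<in> topspace X" using U(1) that openin_subset by blast
      have "dist (g x) (g y) < e/4" using U(3) that by auto
      moreover have "dist (f x) (g x) \<le> e/4" "dist (f y) (g y) \<le> e/4"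
        using g(2) x y by (auto simp: dist_norm)
      ultimately have "dist (f x) (f y) < e"
        using dist_triangle[of "f x" "f y" "g x"] dist_triangle[of "g x" "f y" "g y"] e
        by (simp add: dist_commute)
      then show ?thesis by auto
    qed
    then show "\<exists>U. openin X U \<and> x \<in> U \<and> (\<forall>y\<in>U. f y \<in> Met_TC.mball (f x) e)"
      using U by blast
  qed
  then show ?thesis by simp
qed

lemma C0_uniform_limit:
  assumes "\<And>e. 0 < e \<Longrightarrow> \<exists>g\<in>C0 X. \<forall>x\<in>topspace X. cmod (f x - g x) \<le> e"
    and "\<And>x. x \<notin> topspace X \<Longrightarrow> f x = 0"
  shows "f \<in> C0 X"
proof (rule C0I)
  show "continuous_map X euclidean f"
    by (rule continuous_map_of_uniform_approx) (use assms(1) C0_continuous in blast)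
  fix e :: real assume e: "0 < e"
  then obtain g where g: "g \<in> C0 X" "\<forall>x\<in>topspace X. cmod (f x - g x) \<le> e/2"
    using assms(1)[of "e/2"] by auto
  have "e/2 \<le> cmod (g x)" if "x \<in> topspace X" "e \<le> cmod (f x)" for x
    using g(2) that norm_triangle_ineq[of "f x - g x" "g x"] by fastforce
  then show "\<exists>K. compactin X K \<and> {x \<in> topspace X. e \<le> cmod (f x)} \<subseteq> K"
    by (intro exI[of _ "{x \<in> topspace X. e/2 \<le> cmod (g x)}"] conjI C0_compact g)
       (use e in auto)
qed fact

text \<open>\<open>C0 X\<close> is an ideal in the bounded continuous functions: where the product
  is large, \<open>g\<close> is large as well.\<close>

lemma C0_mult_bounded:
  assumes g: "g \<in> C0 X" and f: "continuous_map X euclidean f" "\<And>x. x \<in> topspace X \<Longrightarrow> cmod (f x) \<le> B"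
  shows "(\<lambda>x. f x * g x) \<in> C0 X"
proof (rule C0I)
  show "continuous_map X euclidean (\<lambda>x. f x * g x)"
  proof -
    have "continuous_map X (prod_topology euclidean euclidean) (\<lambda>x. (f x, g x))"
      using f(1) C0_continuous[OF g] by (intro continuous_map_pairedI)
    then have "continuous_map X euclidean ((\<lambda>z. fst z * snd z) \<circ> (\<lambda>x. (f x, g x)))"
      by (rule continuous_map_compose)
         (auto intro!: continuous_intros)
    then show ?thesis by (simp add: o_def)
  qed
  fix e :: real assume e: "0 < e"
  \<comment> \<open>The maximum keeps the divisor in \<open>e/?B\<close> positive even if
    \<open>B\<close> is not.\<close>
  let ?B = "max B 1"
  have "e/?B \<le> cmod (g x)" if "x \<in> topspace X" "e \<le> cmod (f x * g x)" for x
  proof -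
    have "cmod (f x) \<le> ?B" using f(2)[OF that(1)] by simp
    then have "e \<le> ?B * cmod (g x)"
      using that(2) mult_right_mono[of "cmod (f x)" ?B "cmod (g x)"]
      unfolding norm_mult by force
    then show ?thesis by (simp add: divide_le_eq mult.commute)
  qed
  then show "\<exists>K. compactin X K \<and> {x \<in> topspace X. e \<le> cmod (f x * g x)} \<subseteq> K"
    by (intro exI[of _ "{x \<in> topspace X. e/?B \<le> cmod (g x)}"] conjI C0_compact g)
       (use e in auto)
qed (simp add: C0_outside[OF g])

lemma C0_algebra: "fun_cstar_algebra X (C0 X)"
proof -
  have add: "(\<lambda>x. f x + g x) \<in> C0 X" if f: "f \<in> C0 X" and g: "g \<in> C0 X" for f g
  proof (rule C0I)
    have "continuous_map X (prod_topology euclidean euclidean) (\<lambda>x. (f x, g x))"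
      using C0_continuous[OF f] C0_continuous[OF g] by (intro continuous_map_pairedI)
    then have "continuous_map X euclidean ((\<lambda>z. fst z + snd z) \<circ> (\<lambda>x. (f x, g x)))"
      by (rule continuous_map_compose)
         (auto intro!: continuous_intros)
    then show "continuous_map X euclidean (\<lambda>x. f x + g x)" by (simp add: o_def)
    fix e :: real assume e: "0 < e"
    have "e/2 \<le> cmod (f x) \<or> e/2 \<le> cmod (g x)" if "e \<le> cmod (f x + g x)" for x
      using that norm_triangle_ineq[of "f x" "g x"] by linarith
    then have "{x \<in> topspace X. e \<le> cmod (f x + g x)} \<subseteq>
        {x \<in> topspace X. e/2 \<le> cmod (f x)} \<union> {x \<in> topspace X. e/2 \<le> cmod (g x)}" by auto
    moreover have "compactin X ({x \<in> topspace X. e/2 \<le> cmod (f x)} \<union> {x \<in> topspace X. e/2 \<le> cmod (g x)})"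
      using C0_compact[OF f, of "e/2"] C0_compact[OF g, of "e/2"] e by (intro compactin_Un) auto
    ultimately show "\<exists>K. compactin X K \<and> {x \<in> topspace X. e \<le> cmod (f x + g x)} \<subseteq> K" by blast
  qed (simp add: C0_outside[OF f] C0_outside[OF g])
  have mult: "(\<lambda>x. f x * g x) \<in> C0 X" if f: "f \<in> C0 X" and g: "g \<in> C0 X" for f g
  proof -
    obtain B where "\<And>x. cmod (f x) \<le> B" using C0_bounded[OF f] by blast
    then show ?thesis using C0_mult_bounded[OF g C0_continuous[OF f]] by blast
  qed
  have scale: "(\<lambda>x. c * g x) \<in> C0 X" if g: "g \<in> C0 X" for c g
    by (rule C0_mult_bounded[OF g, of "\<lambda>_. c" "cmod c"]) auto
  have cnj: "(\<lambda>x. cnj (f x)) \<in> C0 X" if f: "f \<in> C0 X" for f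
  proof -
    have "continuous_map X euclidean (cnj \<circ> f)"
      by (rule continuous_map_compose[OF C0_continuous[OF f]]) (auto intro!: continuous_intros)
    then show ?thesis using f by (simp add: C0_def o_def)
  qed
  have "(\<lambda>_. 0) \<in> C0 X" by (simp add: C0_def)
  then show ?thesis unfolding fun_cstar_algebra_def using add mult scale cnj by auto
qed

lemma
  assumes "fun_cstar_algebra Y A"
  shows fca_C0: "f \<in> A \<Longrightarrow> f \<in> C0 Y"
    and fca_zero: "(\<lambda>_. 0) \<in> A"
    and fca_add: "f \<in> A \<Longrightarrow> g \<in> A \<Longrightarrow> (\<lambda>y. f y + g y) \<in> A"
    and fca_scale: "f \<in> A \<Longrightarrow> (\<lambda>y. c * f y) \<in> A"
    and fca_mult: "f \<in> A \<Longrightarrow> g \<in> A \<Longrightarrow> (\<lambda>y. f y * g y) \<in> A"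
    and fca_cnj: "f \<in> A \<Longrightarrow> (\<lambda>y. cnj (f y)) \<in> A"
    and fca_limit: "f \<in> C0 Y \<Longrightarrow> (\<And>e. 0 < e \<Longrightarrow> \<exists>g\<in>A. \<forall>y\<in>topspace Y. cmod (f y - g y) \<le> e) \<Longrightarrow> f \<in> A"
  using assms unfolding fun_cstar_algebra_def by blast+

lemma fca_Re: "fun_cstar_algebra Y A \<Longrightarrow> f \<in> A \<Longrightarrow> (\<lambda>y. complex_of_real (Re (f y))) \<in> A"
  and fca_Im: "fun_cstar_algebra Y A \<Longrightarrow> f \<in> A \<Longrightarrow> (\<lambda>y. complex_of_real (Im (f y))) \<in> A"
proof -
  assume A: "fun_cstar_algebra Y A" and f: "f \<in> A"
  have "(\<lambda>y. (1/2) * (f y + cnj (f y))) \<in> A" "(\<lambda>y. (1/(2*\<i>)) * (f y + (-1) * cnj (f y))) \<in> A"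
    using f by (intro fca_scale[OF A] fca_add[OF A] fca_cnj[OF A]; simp)+
  moreover have "(\<lambda>y. (1/2) * (f y + cnj (f y))) = (\<lambda>y. complex_of_real (Re (f y)))"
      "(\<lambda>y. (1/(2*\<i>)) * (f y + (-1) * cnj (f y))) = (\<lambda>y. complex_of_real (Im (f y)))"
    by (auto simp: fun_eq_iff complex_eq_iff)
  ultimately show "(\<lambda>y. complex_of_real (Re (f y))) \<in> A" "(\<lambda>y. complex_of_real (Im (f y))) \<in> A"
    by simp_all
qed

text \<open>Locally compact Hausdorff spaces are completely regular. The neighbourhood is first cut
  down by an open \<open>V\<close> inside a compact \<open>K\<close>; the bump then vanishes off
  \<open>K\<close>, which gives the decay at infinity.\<close>

lemma C0_bump:
  assumes "locally_compact_space X" "Hausdorff_space X" "openin X U" "x \<in> U"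
  obtains u :: "'x \<Rightarrow> real" where "(\<lambda>x. complex_of_real (u x)) \<in> C0 X"
    "continuous_map X euclideanreal u"
    "\<And>x. 0 \<le> u x" "\<And>x. u x \<le> 1" "u x = 1" "\<And>y. y \<notin> U \<Longrightarrow> u y = 0"
proof -
  have x: "x \<in> topspace X" using assms openin_subset by blast
  obtain V K where VK: "openin X V" "compactin X K" "x \<in> V" "V \<subseteq> K"
    using assms(1) x unfolding locally_compact_space_def by blast
  have "completely_regular_space X"
    using assms(1,2) locally_compact_Hausdorff_or_regular locally_compact_regular_imp_completely_regular_space
    by blast
  moreover have "closedin X (topspace X - U \<inter> V)" using assms(3) VK(1) by blast
  moreover have "x \<in> topspace X - (topspace X - U \<inter> V)" using x VK assms by blast
  ultimately obtain g :: "'x \<Rightarrow> real" where g: "continuous_map X (top_of_set {0..1}) g" "g x = 0"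
      "g ` (topspace X - U \<inter> V) \<subseteq> {1}"
    unfolding completely_regular_space_def by blast
  have gc: "continuous_map X euclideanreal g" and g01: "\<And>y. y \<in> topspace X \<Longrightarrow> g y \<in> {0..1}"
    using g(1) by (auto simp: continuous_map_in_subtopology)
  define u where "u y = (if y \<in> topspace X then 1 - g y else 0)" for y
  have uc: "continuous_map X euclideanreal u"
    by (rule continuous_map_eq[of _ _ "\<lambda>y. 1 - g y"])
       (auto simp: u_def intro!: continuous_map_diff gc)
  have "continuous_map X euclidean (complex_of_real \<circ> u)"
    by (rule continuous_map_compose[OF uc]) (auto intro!: continuous_intros)
  then have uc': "continuous_map X euclidean (\<lambda>x. complex_of_real (u x))" by (simp add: o_def)
  have u0: "u y = 0" if "y \<notin> U \<inter> V" for y using g(3) that by (auto simp: u_def)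
  show thesis
  proof
    show "(\<lambda>x. complex_of_real (u x)) \<in> C0 X"
    proof (rule C0I[OF uc'])
      fix e :: real assume "0 < e"
      then have "{x \<in> topspace X. e \<le> cmod (complex_of_real (u x))} \<subseteq> K"
        using u0 VK by fastforce
      then show "\<exists>K. compactin X K \<and> {x \<in> topspace X. e \<le> cmod (complex_of_real (u x))} \<subseteq> K"
        using VK by blast
    qed (simp add: u_def)
    show "u x = 1" using g x by (simp add: u_def)
    show "continuous_map X euclideanreal u" by (rule uc)
  qed (use g01 u0 in \<open>auto simp: u_def\<close>)
qed

lemma C0_separates:
  assumes "locally_compact_space X" "Hausdorff_space X" "x \<in> topspace X" "y \<in> topspace X" "x \<noteq> y"
  obtains f where "f \<in> C0 X" "f x = 1" "f y = 0"
proof -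
  have "openin X (topspace X - {y})" using assms Hausdorff_imp_t1_space t1_space_openin_delete_alt
    by (metis openin_topspace)
  then obtain u :: "'a \<Rightarrow> real" where "(\<lambda>x. complex_of_real (u x)) \<in> C0 X" "u x = 1" "\<And>z. z \<notin> topspace X - {y} \<Longrightarrow> u z = 0"
    using C0_bump[OF assms(1,2), of "topspace X - {y}" x] assms by (metis DiffI singletonD)
  then show thesis using that[of "\<lambda>x. complex_of_real (u x)"] by auto
qed

section \<open>Function algebras of quotients\<close>

text \<open>An intrinsic description of the copy of C_0(Z) inside C_0(Y): it depends only on the
  fibres of \<open>p\<close>, not on the topology of the quotient.\<close>

definition C0_fibres :: "'y topology \<Rightarrow> ('y \<Rightarrow> 'z) \<Rightarrow> ('y \<Rightarrow> complex) set" where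
  "C0_fibres Y p =
     {f \<in> C0 Y. \<forall>y\<in>topspace Y. \<forall>y'\<in>topspace Y. p y = p y' \<longrightarrow> f y = f y'}"

lemma C0_fibresI:
  "f \<in> C0 Y \<Longrightarrow> (\<And>y y'. y \<in> topspace Y \<Longrightarrow> y' \<in> topspace Y \<Longrightarrow> p y = p y' \<Longrightarrow> f y = f y')
    \<Longrightarrow> f \<in> C0_fibres Y p"
  and C0_fibresD1: "f \<in> C0_fibres Y p \<Longrightarrow> f \<in> C0 Y"
  and C0_fibresD2: "f \<in> C0_fibres Y p \<Longrightarrow> y \<in> topspace Y \<Longrightarrow> y' \<in> topspace Y \<Longrightarrow> p y = p y' \<Longrightarrow> f y = f y'"
  unfolding C0_fibres_def by blast+

text \<open>Properness makes pullbacks vanish at infinity. Conversely, a function constant on fibres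
  descends along the quotient map, and its superlevel sets downstairs are images of the compact ones
  upstairs.\<close>

lemma C0_via_fibres:
  assumes p: "quotient_map Y Z p" and pc: "preimages_compact Y Z p"
  shows "C0_via Y p Z = C0_fibres Y p"
proof (intro equalityI subsetI)
  have pcont: "continuous_map Y Z p" by (rule quotient_imp_continuous_map[OF p])
  have pimg: "p ` topspace Y = topspace Z" by (rule quotient_imp_surjective_map[OF p])
  fix F assume "F \<in> C0_via Y p Z"
  then obtain f where f: "f \<in> C0 Z" and F: "F = (\<lambda>y. if y \<in> topspace Y then f (p y) else 0)"
    unfolding C0_via_def by blast
  have "F \<in> C0 Y" unfolding C0_def
  proof (intro CollectI conjI allI impI)
    show "continuous_map Y euclidean F"
      by (rule continuous_map_eq[OF continuous_map_compose[OF pcont C0_continuous[OF f]]]) (simp add: F)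
    fix e :: real assume e: "0 < e"
    have "{y \<in> topspace Y. e \<le> cmod (F y)} = {y \<in> topspace Y. p y \<in> {z \<in> topspace Z. e \<le> cmod (f z)}}"
      unfolding F using pimg by (auto split: if_splits)
    moreover have "compactin Y {y \<in> topspace Y. p y \<in> {z \<in> topspace Z. e \<le> cmod (f z)}}"
      using pc C0_compact[OF f e] unfolding preimages_compact_def by blast
    ultimately show "compactin Y {y \<in> topspace Y. e \<le> cmod (F y)}" by (simp only:)
  next
    fix y assume "y \<notin> topspace Y"
    then show "F y = 0" unfolding F by simp
  qed
  moreover have "F y = F y'" if "y \<in> topspace Y" "y' \<in> topspace Y" "p y = p y'" for y y'
    unfolding F using that by presburger
  ultimately show "F \<in> C0_fibres Y p" by (rule C0_fibresI)
next
  have pcont: "continuous_map Y Z p" by (rule quotient_imp_continuous_map[OF p])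
  have pimg: "p ` topspace Y = topspace Z" by (rule quotient_imp_surjective_map[OF p])
  fix F assume "F \<in> C0_fibres Y p"
  note F = C0_fibresD1[OF this] and const = C0_fibresD2[OF this]
  obtain g where g: "continuous_map Z euclidean g" "\<And>y. y \<in> topspace Y \<Longrightarrow> g (p y) = F y"
    by (rule quotient_map_lift_exists[OF p C0_continuous[OF F] const]) blast+
  define f where "f z = (if z \<in> topspace Z then g z else 0)" for z
  have fp: "f (p y) = F y" if "y \<in> topspace Y" for y
  proof -
    have "p y \<in> topspace Z" using pimg that by blast
    then show ?thesis using g(2)[OF that] by (simp add: f_def)
  qed
  have "f \<in> C0 Z" unfolding C0_def
  proof (intro CollectI conjI allI impI)
    show "continuous_map Z euclidean f"
      by (rule continuous_map_eq[OF g(1)]) (simp add: f_def)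
    fix e :: real assume e: "0 < e"
    have "{z \<in> topspace Z. e \<le> cmod (f z)} = p ` {y \<in> topspace Y. e \<le> cmod (F y)}"
      unfolding pimg[symmetric] using fp by auto
    then show "compactin Z {z \<in> topspace Z. e \<le> cmod (f z)}"
      using image_compactin[OF C0_compact[OF F e] pcont] by simp
  qed (simp add: f_def)
  moreover have "F = (\<lambda>y. if y \<in> topspace Y then f (p y) else 0)"
    using fp C0_outside[OF F] by auto
  ultimately show "F \<in> C0_via Y p Z" unfolding C0_via_def by blast
qed

lemma fun_cstar_algebra_fibres: "fun_cstar_algebra Y (C0_fibres Y p)" (is "fun_cstar_algebra Y ?A")
proof -
  note C = C0_algebra[of Y] and I = C0_fibresI and D = C0_fibresD1 and eq = C0_fibresD2
  have "(\<lambda>_. 0) \<in> ?A" by (rule I[OF fca_zero[OF C]]) simp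
  moreover have "(\<lambda>y. f y + g y) \<in> ?A" if "f \<in> ?A" "g \<in> ?A" for f g
    by (rule I[OF fca_add[OF C D D, OF that]], rule arg_cong2[of _ _ _ _ "(+)"]) (rule eq[OF that(1)] eq[OF that(2)]; assumption)+
  moreover have "(\<lambda>y. f y * g y) \<in> ?A" if "f \<in> ?A" "g \<in> ?A" for f g
    by (rule I[OF fca_mult[OF C D D, OF that]], rule arg_cong2[of _ _ _ _ "(*)"]) (rule eq[OF that(1)] eq[OF that(2)]; assumption)+
  moreover have "(\<lambda>y. c * f y) \<in> ?A" if "f \<in> ?A" for c f
    by (rule I[OF fca_scale[OF C D, OF that]], rule arg_cong[of _ _ "(*) c"]) (rule eq[OF that])
  moreover have "(\<lambda>y. cnj (f y)) \<in> ?A" if "f \<in> ?A" for f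
    by (rule I[OF fca_cnj[OF C D, OF that]], rule arg_cong[of _ _ cnj]) (rule eq[OF that])
  moreover have "f \<in> ?A" if f: "f \<in> C0 Y" and lim: "\<forall>e>0. \<exists>g\<in>?A. \<forall>y\<in>topspace Y. cmod (f y - g y) \<le> e" for f
  proof (rule I[OF f], rule ccontr)
    fix y y' assume y: "y \<in> topspace Y" "y' \<in> topspace Y" "p y = p y'" and "f y \<noteq> f y'"
    \<comment> \<open>With a quarter of the gap, the two approximation errors add up to only half of
      it.\<close>
    then have e: "0 < cmod (f y - f y') / 4" by simp
    obtain g where g: "g \<in> ?A" "\<forall>x\<in>topspace Y. cmod (f x - g x) \<le> cmod (f y - f y') / 4"
      using lim[THEN spec, THEN mp, OF e] by (rule bexE)
    have "cmod (f y - f y') \<le> cmod (f y - g y) + cmod (f y' - g y')"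
      using norm_triangle_ineq4[of "f y - g y" "f y' - g y'"] eq[OF g(1) y] by simp
    then show False using e g(2)[rule_format, OF y(1)] g(2)[rule_format, OF y(2)] by linarith
  qed
  moreover have "?A \<subseteq> C0 Y" using D by blast
  ultimately show ?thesis unfolding fun_cstar_algebra_def by (intro conjI allI impI ballI)
qed

lemma preimages_compact_intermediate:
  assumes "continuous_map Y Z p" "continuous_map Z X q" "Hausdorff_space Z"
    and "preimages_compact Y X \<pi>" and "\<And>y. y \<in> topspace Y \<Longrightarrow> q (p y) = \<pi> y"
  shows "preimages_compact Y Z p"
  unfolding preimages_compact_def
proof (intro allI impI)
  fix K assume K: "compactin Z K"
  have "compactin X (q ` K)" by (rule image_compactin[OF K assms(2)])
  then have "compactin Y {y \<in> topspace Y. \<pi> y \<in> q ` K}"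
    using assms(4) unfolding preimages_compact_def by blast
  moreover have "{y \<in> topspace Y. p y \<in> K} \<subseteq> {y \<in> topspace Y. \<pi> y \<in> q ` K}"
    using assms(5) by force
  moreover have "closedin Y {y \<in> topspace Y. p y \<in> K}"
    by (rule closedin_continuous_map_preimage[OF assms(1)])
       (rule compactin_imp_closedin[OF assms(3) K])
  ultimately show "compactin Y {y \<in> topspace Y. p y \<in> K}"
    using closed_compactin by blast
qed

section \<open>Hausdorff function spaces and the Stone--Weierstrass theorem for
  \<open>C0 Y\<close>\<close>

text \<open>With these instances the Stone--Weierstrass theorem for compact subsets of Hausdorff types applies
  to the image of the one-point compactification of \<open>Y\<close> under the evaluations at the elements of an
  algebra.\<close>

instance "fun" :: (type, t0_space) t0_space
proof
  fix x y :: "'a \<Rightarrow> 'b" assume "x \<noteq> y"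
  then obtain i where i: "x i \<noteq> y i" by blast
  obtain U where U: "open U" "\<not> (x i \<in> U \<longleftrightarrow> y i \<in> U)"
    using separation_t0[THEN iffD1, OF i] by blast
  have "open ((\<lambda>z. z i) -` U)"
    by (rule open_vimage[OF U(1) continuous_on_product_coordinates])
  then show "\<exists>U. open U \<and> \<not> (x \<in> U \<longleftrightarrow> y \<in> U)"
    using U by (intro exI[of _ "(\<lambda>z. z i) -` U"]) simp
qed

instance "fun" :: (type, t1_space) t1_space
proof
  fix x y :: "'a \<Rightarrow> 'b" assume "x \<noteq> y"
  then obtain i where i: "x i \<noteq> y i" by blast
  obtain U where U: "open U" "x i \<in> U" "y i \<notin> U"
    using separation_t1[THEN iffD1, OF i] by blast
  have "open ((\<lambda>z. z i) -` U)"
    by (rule open_vimage[OF U(1) continuous_on_product_coordinates])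
  then show "\<exists>U. open U \<and> x \<in> U \<and> y \<notin> U"
    using U by (intro exI[of _ "(\<lambda>z. z i) -` U"]) simp
qed

instance "fun" :: (type, t2_space) t2_space
proof
  fix x y :: "'a \<Rightarrow> 'b" assume "x \<noteq> y"
  then obtain i where i: "x i \<noteq> y i" by blast
  obtain U V where UV: "open U" "open V" "x i \<in> U" "y i \<in> V" "U \<inter> V = {}"
    using hausdorff[OF i] by blast
  have "open ((\<lambda>z. z i) -` U)" "open ((\<lambda>z. z i) -` V)"
    by (rule open_vimage[OF _ continuous_on_product_coordinates], rule UV)+
  then show "\<exists>U V. open U \<and> open V \<and> x \<in> U \<and> y \<in> V \<and> U \<inter> V = {}"
    using UV by (intro exI[of _ "(\<lambda>z. z i) -` U"] exI[of _ "(\<lambda>z. z i) -` V"]) (auto simp: disjoint_iff)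
qed

text \<open>For a closed \<open>C\<close> containing 0 the complement of the preimage is an open
  subset of \<open>Y\<close>. A closed \<open>C\<close> missing 0 misses a ball around 0, so its
  preimage lies in a superlevel set and is compact in \<open>Y\<close>.\<close>

lemma continuous_map_option_C0:
  assumes f: "f \<in> C0 Y"
  shows "continuous_map (Alexandroff_compactification Y) euclidean (\<lambda>z. case z of None \<Rightarrow> 0 | Some y \<Rightarrow> f y)"
    (is "continuous_map ?Y _ ?f")
  unfolding continuous_map_closedin
proof (intro conjI allI impI)
  fix C :: "complex set" assume C: "closedin euclidean C"
  let ?D = "{y \<in> topspace Y. f y \<in> C}"
  have D: "closedin Y ?D" by (rule closedin_continuous_map_preimage[OF C0_continuous[OF f] C])
  show "closedin ?Y {z \<in> topspace ?Y. ?f z \<in> C}"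
  proof (cases "0 \<in> C")
    case True
    then have "{z \<in> topspace ?Y. ?f z \<in> C} = topspace ?Y - Some ` (topspace Y - ?D)"
      by auto
    moreover have "openin ?Y (Some ` (topspace Y - ?D))"
      using D by (simp add: closedin_def)
    ultimately show ?thesis by (simp only: closedin_diff[OF closedin_topspace])
  next
    case False
    have "open (- C)" "0 \<in> - C" using C False by (auto simp: open_Compl)
    then obtain e where e: "0 < e" "ball 0 e \<subseteq> - C" by (meson open_contains_ball)
    have "?D \<subseteq> {y \<in> topspace Y. e \<le> cmod (f y)}" using e by force
    then have "compactin Y ?D" using closed_compactin[OF C0_compact[OF f e(1)] _ D] by blast
    moreover have "{z \<in> topspace ?Y. ?f z \<in> C} = Some ` ?D" using False by (auto split: option.splits)
    ultimately show ?thesis using D by simp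
  qed
qed auto

text \<open>Points of \<open>Y\<close> not separated by \<open>A\<close> are glued by evaluating at
  all elements of \<open>A\<close>. The image \<open>S\<close> of the one-point compactification is
  compact and Hausdorff, \<open>f\<close> descends to it, and constants plus real elements of
  \<open>A\<close> form a separating unital function ring on it.\<close>

lemma Stone_Weierstrass_C0_real:
  fixes f :: "'y \<Rightarrow> real"
  assumes A: "fun_cstar_algebra Y A" and nv: "\<And>y. y \<in> topspace Y \<Longrightarrow> \<exists>g\<in>A. g y \<noteq> 0"
    and f: "(\<lambda>y. complex_of_real (f y)) \<in> C0 Y"
    and sep: "\<And>y y'. y \<in> topspace Y \<Longrightarrow> y' \<in> topspace Y \<Longrightarrow> (\<And>g. g \<in> A \<Longrightarrow> g y = g y') \<Longrightarrow> f y = f y'"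
    and e: "0 < e"
  shows "\<exists>g\<in>A. \<forall>y\<in>topspace Y. cmod (complex_of_real (f y) - g y) \<le> e"
proof -
  let ?Y = "Alexandroff_compactification Y"
  \<comment> \<open>Coordinates outside \<open>A\<close> are frozen at 0, so distinct points of
    \<open>S\<close> differ at an element of \<open>A\<close>. The point at infinity goes to the
    zero evaluation.\<close>
  define ev where "ev = (\<lambda>z g. if g \<in> A then (case z of None \<Rightarrow> 0 | Some y \<Rightarrow> g y) else (0::complex))"
  define S where "S = ev ` topspace ?Y"
  have evc: "continuous_map ?Y euclidean ev"
  proof -
    have "continuous_map ?Y (product_topology (\<lambda>i. euclidean) UNIV) ev"
      unfolding continuous_map_componentwise_UNIV
    proof
      fix g
      show "continuous_map ?Y euclidean (\<lambda>x. ev x g)"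
        using continuous_map_option_C0[of g Y] fca_C0[OF A, of g] by (cases "g \<in> A") (auto simp: ev_def)
    qed
    then show ?thesis by (simp add: euclidean_product_topology)
  qed
  have S: "compact S"
  proof -
    have "compactin ?Y (topspace ?Y)"
      using compact_space_Alexandroff_compactification compact_space_def by blast
    from image_compactin[OF this evc] show ?thesis by (simp add: S_def)
  qed
  have ev_sep: "g y = 0" if "ev (Some y) = ev None" "g \<in> A" for y g
    using fun_cong[OF that(1), of g] that(2) by (simp add: ev_def)
  \<comment> \<open>A continuous map from a compact space to a Hausdorff space is closed, hence a
    quotient map onto its image.\<close>
  have qS: "quotient_map ?Y (top_of_set S) ev"
  proof (rule continuous_closed_imp_quotient_map)
    show c: "continuous_map ?Y (top_of_set S) ev"
      using evc by (auto simp: continuous_map_in_subtopology S_def)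
    have "Hausdorff_space (euclidean :: (('y \<Rightarrow> complex) \<Rightarrow> complex) topology)"
      unfolding Hausdorff_space_def disjnt_def using hausdorff by (metis open_openin)
    then have "Hausdorff_space (top_of_set S)" by (rule Hausdorff_space_subtopology)
    then show "closed_map ?Y (top_of_set S) ev"
      by (rule continuous_imp_closed_map[OF c compact_space_Alexandroff_compactification])
    show "ev ` topspace ?Y = topspace (top_of_set S)" by (simp add: S_def)
  qed
  define fo where "fo = (\<lambda>z. case z of None \<Rightarrow> 0 | Some y \<Rightarrow> f y)"
  have fo_const: "fo z = fo z'" if "z \<in> topspace ?Y" "z' \<in> topspace ?Y" "ev z = ev z'" for z z'
  proof -
    \<comment> \<open>As \<open>A\<close> vanishes at no point of \<open>Y\<close>, no point of
      \<open>Y\<close> is glued to the point at infinity.\<close>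
    have 1: False if "y \<in> topspace Y" "ev (Some y) = ev None" for y
      using nv[OF that(1)] ev_sep[OF that(2)] by blast
    have 2: "f y = f y'" if "y \<in> topspace Y" "y' \<in> topspace Y" "ev (Some y) = ev (Some y')" for y y'
    proof (rule sep[OF that(1,2)])
      fix g assume "g \<in> A"
      then show "g y = g y'" using fun_cong[OF that(3), of g] by (simp add: ev_def)
    qed
    show ?thesis
    proof (cases z; cases z')
      fix y y' assume "z = Some y" "z' = Some y'"
      then show ?thesis using 2[of y y'] that by (auto simp: fo_def)
    next
      fix y assume "z = Some y" "z' = None"
      then show ?thesis using 1[of y] that by auto
    next
      fix y assume "z = None" "z' = Some y"
      then show ?thesis using 1[of y] that by auto
    qed (auto simp: fo_def)
  qed
  have foc: "continuous_map ?Y euclideanreal fo"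
  proof -
    have "continuous_map ?Y euclidean (Re \<circ> (\<lambda>z. case z of None \<Rightarrow> 0 | Some y \<Rightarrow> complex_of_real (f y)))"
      by (rule continuous_map_compose[OF continuous_map_option_C0[OF f]])
         (auto intro!: continuous_intros)
    moreover have "Re \<circ> (\<lambda>z. case z of None \<Rightarrow> 0 | Some y \<Rightarrow> complex_of_real (f y)) = fo"
      by (auto simp: fo_def fun_eq_iff split: option.splits)
    ultimately show ?thesis by simp
  qed
  obtain F where F: "continuous_map (top_of_set S) euclideanreal F" "\<And>z. z \<in> topspace ?Y \<Longrightarrow> F (ev z) = fo z"
    by (rule quotient_map_lift_exists[OF qS foc fo_const]) blast+
  \<comment> \<open>Elements of \<open>R\<close> are a real constant plus an element of
    \<open>A\<close>; the constant is recovered as the value at infinity.\<close>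
  define R where "R = {h. continuous_on S h \<and> (\<exists>c. \<exists>g\<in>A. h (ev None) = c \<and>
                        (\<forall>y\<in>topspace Y. complex_of_real (h (ev (Some y))) = complex_of_real c + g y))}"
  have Rev: "(\<lambda>x. Re (x g)) \<in> R" "(\<lambda>x. Im (x g)) \<in> R" if g: "g \<in> A" for g
  proof -
    have ev: "ev None g = 0" "\<And>y. ev (Some y) g = g y" by (auto simp: ev_def g)
    have c: "continuous_on S (\<lambda>x. x g)"
      by (rule continuous_on_subset[OF continuous_on_product_coordinates]) auto
    show "(\<lambda>x. Re (x g)) \<in> R" "(\<lambda>x. Im (x g)) \<in> R"
      unfolding R_def using c fca_Re[OF A g] fca_Im[OF A g] by (auto simp: ev intro!: continuous_intros)
  qed
  interpret function_ring_on R S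
  proof
    fix h k assume hk: "h \<in> R" "k \<in> R"
    then obtain c d g l where h: "continuous_on S h" "h (ev None) = c" "g \<in> A"
        "\<And>y. y \<in> topspace Y \<Longrightarrow> complex_of_real (h (ev (Some y))) = complex_of_real c + g y"
      and k: "continuous_on S k" "k (ev None) = d" "l \<in> A"
        "\<And>y. y \<in> topspace Y \<Longrightarrow> complex_of_real (k (ev (Some y))) = complex_of_real d + l y"
      unfolding R_def by blast
    have "(\<lambda>y. g y + l y) \<in> A" using h k fca_add[OF A] by blast
    then show "(\<lambda>x. h x + k x) \<in> R"
      unfolding R_def using h k
      by (auto intro!: continuous_intros exI[of _ "c + d"] bexI[of _ "\<lambda>y. g y + l y"])
    have "(\<lambda>y. (g y * l y + complex_of_real c * l y) + complex_of_real d * g y) \<in> A"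
      using h k by (intro fca_add[OF A] fca_mult[OF A] fca_scale[OF A])
    then show "(\<lambda>x. h x * k x) \<in> R"
      unfolding R_def using h k
      by (auto simp: algebra_simps intro!: continuous_intros exI[of _ "c * d"]
          bexI[of _ "\<lambda>y. (g y * l y + complex_of_real c * l y) + complex_of_real d * g y"])
  next
    fix c :: real show "(\<lambda>_. c) \<in> R"
      unfolding R_def using fca_zero[OF A] by (auto intro!: exI[of _ c])
  next
    fix x y assume "x \<in> S" "y \<in> S" "x \<noteq> y"
    then obtain g where g: "x g \<noteq> y g" by blast
    then have "g \<in> A" using \<open>x \<in> S\<close> \<open>y \<in> S\<close> by (auto simp: S_def ev_def split: if_splits)
    then show "\<exists>h\<in>R. h x \<noteq> h y" using Rev[of g] g by (metis complex_eqI)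
  qed (use S in \<open>auto simp: R_def\<close>)
  have "continuous_on S F" using F(1) by simp
  then obtain h where h: "h \<in> R" "\<forall>x\<in>S. \<bar>F x - h x\<bar> < e/2"
    using Stone_Weierstrass_basic[of F "e/2"] e by auto
  then obtain c g where g: "h (ev None) = c" "g \<in> A"
    "\<And>y. y \<in> topspace Y \<Longrightarrow> complex_of_real (h (ev (Some y))) = complex_of_real c + g y"
    unfolding R_def by blast
  have c: "\<bar>c\<bar> < e/2"
    using h(2) F(2)[of None] g(1) by (force simp: S_def fo_def)
  have "cmod (complex_of_real (f y) - g y) \<le> e" if y: "y \<in> topspace Y" for y
  proof -
    have "ev (Some y) \<in> S" using y by (auto simp: S_def)
    then have "\<bar>f y - h (ev (Some y))\<bar> < e/2"
      using h(2) F(2)[of "Some y"] y by (force simp: fo_def)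
    moreover have "complex_of_real (f y) - g y = complex_of_real (f y - h (ev (Some y)) + c)"
      using g(3)[OF y] by (simp add: algebra_simps)
    ultimately show ?thesis using c by (simp only: norm_of_real)
  qed
  then show ?thesis using g(2) by blast
qed

text \<open>Real and imaginary parts inherit the separation condition and are approximated
  separately; \<open>A\<close> is closed under uniform limits in \<open>C0 Y\<close>.\<close>

lemma Stone_Weierstrass_C0:
  assumes A: "fun_cstar_algebra Y A" and nv: "\<And>y. y \<in> topspace Y \<Longrightarrow> \<exists>g\<in>A. g y \<noteq> 0"
    and f: "f \<in> C0 Y"
    and sep: "\<And>y y'. y \<in> topspace Y \<Longrightarrow> y' \<in> topspace Y \<Longrightarrow> (\<And>g. g \<in> A \<Longrightarrow> g y = g y') \<Longrightarrow> f y = f y'"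
  shows "f \<in> A"
proof (rule fca_limit[OF A f])
  fix e :: real assume e: "0 < e"
  have "\<exists>g\<in>A. \<forall>y\<in>topspace Y. cmod (complex_of_real (Re (f y)) - g y) \<le> e/2"
  proof (rule Stone_Weierstrass_C0_real[OF A nv fca_Re[OF C0_algebra f]])
    fix y y' assume "y \<in> topspace Y" "y' \<in> topspace Y" "\<And>g. g \<in> A \<Longrightarrow> g y = g y'"
    then show "Re (f y) = Re (f y')" using sep[of y y'] by simp
  qed (use e in auto)
  then obtain g where g: "g \<in> A" "\<forall>y\<in>topspace Y. cmod (complex_of_real (Re (f y)) - g y) \<le> e/2"
    by (rule bexE)
  have "\<exists>g\<in>A. \<forall>y\<in>topspace Y. cmod (complex_of_real (Im (f y)) - g y) \<le> e/2"
  proof (rule Stone_Weierstrass_C0_real[OF A nv fca_Im[OF C0_algebra f]])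
    fix y y' assume "y \<in> topspace Y" "y' \<in> topspace Y" "\<And>g. g \<in> A \<Longrightarrow> g y = g y'"
    then show "Im (f y) = Im (f y')" using sep[of y y'] by simp
  qed (use e in auto)
  then obtain h where h: "h \<in> A" "\<forall>y\<in>topspace Y. cmod (complex_of_real (Im (f y)) - h y) \<le> e/2"
    by (rule bexE)
  have "cmod (f y - (g y + \<i> * h y)) \<le> e" if "y \<in> topspace Y" for y
  proof -
    have "f y - (g y + \<i> * h y) = (complex_of_real (Re (f y)) - g y) + \<i> * (complex_of_real (Im (f y)) - h y)"
      by (subst (1) complex_eq[of "f y"]) (simp add: algebra_simps)
    then have "cmod (f y - (g y + \<i> * h y)) \<le> cmod (complex_of_real (Re (f y)) - g y) + cmod (\<i> * (complex_of_real (Im (f y)) - h y))"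
      using norm_triangle_ineq by metis
    moreover have "cmod (\<i> * (complex_of_real (Im (f y)) - h y)) \<le> e/2"
      using bspec[OF h(2) that] by (simp add: norm_mult)
    ultimately show ?thesis using bspec[OF g(2) that] by linarith
  qed
  moreover have "(\<lambda>y. g y + \<i> * h y) \<in> A" using g h by (intro fca_add[OF A] fca_scale[OF A])
  ultimately show "\<exists>g\<in>A. \<forall>y\<in>topspace Y. cmod (f y - g y) \<le> e" by (intro bexI) auto
qed

lemma C0_nonvanishing:
  assumes "locally_compact_space X" "Hausdorff_space X" "x \<in> topspace X"
  obtains f where "f \<in> C0 X" "f x = 1"
proof (rule C0_bump[OF assms(1,2) openin_topspace assms(3)])
  fix u :: "'a \<Rightarrow> real" assume "(\<lambda>x. complex_of_real (u x)) \<in> C0 X" "u x = 1"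
  then show thesis using that[of "\<lambda>x. complex_of_real (u x)"] by simp
qed

section \<open>Extensions and invariant function algebras\<close>

locale G_space =
  fixes G :: "('g, 'm) monoid_scheme" (structure) and Y :: "'y topology" and \<beta> :: "'g \<Rightarrow> 'y \<Rightarrow> 'y"
  assumes grp: "group G" and act: "top_action G Y \<beta>"
begin

sublocale group G by (rule grp)

lemma group_action: "group_action G (topspace Y) \<beta>"
  and homeo: "s \<in> carrier G \<Longrightarrow> homeomorphic_map Y Y (\<beta> s)"
  using act unfolding top_action_def by auto

lemma act_closed [simp]: "s \<in> carrier G \<Longrightarrow> y \<in> topspace Y \<Longrightarrow> \<beta> s y \<in> topspace Y"
  using group_action.element_image[OF group_action] by blast

lemma act_mult: "s \<in> carrier G \<Longrightarrow> t \<in> carrier G \<Longrightarrow> y \<in> topspace Y \<Longrightarrow> \<beta> (s \<otimes> t) y = \<beta> s (\<beta> t y)"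
  using group_action.composition_rule[OF group_action] by blast

lemma act_one [simp]: "y \<in> topspace Y \<Longrightarrow> \<beta> \<one> y = y"
  using group_action.id_eq_one[OF group_action] by (metis restrict_apply')

lemma act_inv_left [simp]: "s \<in> carrier G \<Longrightarrow> y \<in> topspace Y \<Longrightarrow> \<beta> (inv s) (\<beta> s y) = y"
  and act_inv_right [simp]: "s \<in> carrier G \<Longrightarrow> y \<in> topspace Y \<Longrightarrow> \<beta> s (\<beta> (inv s) y) = y"
  using act_mult[of "inv s" s y] act_mult[of s "inv s" y] by auto

lemma act_continuous: "s \<in> carrier G \<Longrightarrow> continuous_map Y Y (\<beta> s)"
  using homeo homeomorphic_imp_continuous_map by blast

end

text \<open>Composition with \<beta>(s), which is the induced action of the inverse of
  \<open>s\<close> on \<open>C0 Y\<close>.\<close>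

definition translate :: "'y topology \<Rightarrow> ('g \<Rightarrow> 'y \<Rightarrow> 'y) \<Rightarrow> 'g \<Rightarrow> ('y \<Rightarrow> complex) \<Rightarrow> 'y \<Rightarrow> complex" where
  "translate Y \<beta> s f = (\<lambda>y. if y \<in> topspace Y then f (\<beta> s y) else 0)"

lemma (in G_space) translate_C0:
  assumes s: "s \<in> carrier G" and f: "f \<in> C0 Y"
  shows "translate Y \<beta> s f \<in> C0 Y"
  unfolding C0_def
proof (intro CollectI conjI allI impI)
  show "continuous_map Y euclidean (translate Y \<beta> s f)"
    by (rule continuous_map_eq[OF continuous_map_compose[OF act_continuous[OF s] C0_continuous[OF f]]])
       (simp add: translate_def)
  fix e :: real assume e: "0 < e"
  have "{y \<in> topspace Y. e \<le> cmod (translate Y \<beta> s f y)} = \<beta> (inv s) ` {y \<in> topspace Y. e \<le> cmod (f y)}"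
  proof (intro equalityI subsetI)
    fix y assume "y \<in> {y \<in> topspace Y. e \<le> cmod (translate Y \<beta> s f y)}"
    then show "y \<in> \<beta> (inv s) ` {y \<in> topspace Y. e \<le> cmod (f y)}"
      using s by (intro image_eqI[of _ _ "\<beta> s y"]) (auto simp: translate_def)
  qed (use s in \<open>auto simp: translate_def\<close>)
  then show "compactin Y {y \<in> topspace Y. e \<le> cmod (translate Y \<beta> s f y)}"
    using image_compactin[OF C0_compact[OF f e] act_continuous[OF inv_closed[OF s]]] by simp
qed (simp add: translate_def)

lemma (in G_space) translate_C0_fibres:
  assumes s: "s \<in> carrier G" and f: "f \<in> C0_fibres Y p"
    and p: "\<And>y y'. y \<in> topspace Y \<Longrightarrow> y' \<in> topspace Y \<Longrightarrow> p y = p y' \<Longrightarrow> p (\<beta> s y) = p (\<beta> s y')"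
  shows "translate Y \<beta> s f \<in> C0_fibres Y p"
proof (rule C0_fibresI[OF translate_C0[OF s C0_fibresD1[OF f]]])
  fix y y' assume y: "y \<in> topspace Y" "y' \<in> topspace Y" "p y = p y'"
  from C0_fibresD2[OF f _ _ p[OF y]] show "translate Y \<beta> s f y = translate Y \<beta> s f y'"
    using y s by (simp add: translate_def)
qed

definition invariant_algebras ::
  "('g, 'm) monoid_scheme \<Rightarrow> 'x topology \<Rightarrow> 'y topology \<Rightarrow> ('g \<Rightarrow> 'y \<Rightarrow> 'y) \<Rightarrow> ('y \<Rightarrow> 'x)
     \<Rightarrow> ('y \<Rightarrow> complex) set set" where
  "invariant_algebras G X Y \<beta> \<pi> =
     {A. fun_cstar_algebra Y A \<and> C0_via Y \<pi> X \<subseteq> A \<and> (\<forall>s\<in>carrier G. \<forall>f\<in>A. translate Y \<beta> s f \<in> A)}"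

locale proper_factor = X: G_space G X \<alpha> + Y: G_space G Y \<beta>
  for G :: "('g, 'm) monoid_scheme" (structure)
    and X :: "'x topology" and \<alpha> :: "'g \<Rightarrow> 'x \<Rightarrow> 'x"
    and Y :: "'y topology" and \<beta> :: "'g \<Rightarrow> 'y \<Rightarrow> 'y" +
  fixes \<pi> :: "'y \<Rightarrow> 'x"
  assumes lcX: "locally_compact_space X" and hX: "Hausdorff_space X"
    and fac: "factor_map G Y \<beta> X \<alpha> \<pi>" and proper: "preimages_compact Y X \<pi>"
begin

abbreviation exts :: "('g, 'x, 'y, 'z) extension set" where
  "exts \<equiv> intermediate_extensions G X \<alpha> Y \<beta> \<pi>"

abbreviation ext_alg :: "('g, 'x, 'y, 'z) extension \<Rightarrow> ('y \<Rightarrow> complex) set" where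
  "ext_alg E \<equiv> C0_via Y (ext_from E) (ext_space E)"

abbreviation inv_algs :: "('y \<Rightarrow> complex) set set" where
  "inv_algs \<equiv> invariant_algebras G X Y \<beta> \<pi>"

lemma quot: "quotient_map Y X \<pi>"
  and equivariant: "s \<in> carrier G \<Longrightarrow> y \<in> topspace Y \<Longrightarrow> \<pi> (\<beta> s y) = \<alpha> s (\<pi> y)"
  using fac unfolding factor_map_def by auto

lemma \<pi>_in [simp]: "y \<in> topspace Y \<Longrightarrow> \<pi> y \<in> topspace X"
  using quotient_imp_surjective_map[OF quot] by blast

lemma C0_via_\<pi>: "C0_via Y \<pi> X = C0_fibres Y \<pi>"
  by (rule C0_via_fibres[OF quot proper])

lemma extensionD:
  assumes "E \<in> exts"
  shows "locally_compact_space (ext_space E)" "Hausdorff_space (ext_space E)"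
    "G_space G (ext_space E) (ext_act E)"
    "quotient_map Y (ext_space E) (ext_from E)"
    "\<And>s y. s \<in> carrier G \<Longrightarrow> y \<in> topspace Y \<Longrightarrow> ext_from E (\<beta> s y) = ext_act E s (ext_from E y)"
    "continuous_map (ext_space E) X (ext_to E)"
    "\<And>y. y \<in> topspace Y \<Longrightarrow> ext_to E (ext_from E y) = \<pi> y"
proof -
  have "locally_compact_space (ext_space E) \<and> Hausdorff_space (ext_space E) \<and>
      top_action G (ext_space E) (ext_act E) \<and>
      factor_map G Y \<beta> (ext_space E) (ext_act E) (ext_from E) \<and>
      factor_map G (ext_space E) (ext_act E) X \<alpha> (ext_to E) \<and>
      (\<forall>y\<in>topspace Y. ext_to E (ext_from E y) = \<pi> y)"
    using assms unfolding intermediate_extensions_def by (rule CollectD)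
  then show "locally_compact_space (ext_space E)" "Hausdorff_space (ext_space E)"
    "G_space G (ext_space E) (ext_act E)"
    "quotient_map Y (ext_space E) (ext_from E)"
    "\<And>s y. s \<in> carrier G \<Longrightarrow> y \<in> topspace Y \<Longrightarrow> ext_from E (\<beta> s y) = ext_act E s (ext_from E y)"
    "continuous_map (ext_space E) X (ext_to E)"
    "\<And>y. y \<in> topspace Y \<Longrightarrow> ext_to E (ext_from E y) = \<pi> y"
    using Y.grp quotient_imp_continuous_map[of "ext_space E" X "ext_to E"]
    unfolding factor_map_def G_space_def by simp_all
qed

lemma extension_algebra_eq:
  assumes "E \<in> exts"
  shows "ext_alg E = C0_fibres Y (ext_from E)"
proof (rule C0_via_fibres)
  note D = extensionD[OF assms]
  show "quotient_map Y (ext_space E) (ext_from E)" by (rule D)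
  show "preimages_compact Y (ext_space E) (ext_from E)"
    by (rule preimages_compact_intermediate[OF quotient_imp_continuous_map[OF D(4)] D(6) D(2) proper D(7)])
qed

lemma extension_algebra_invariant:
  assumes E: "E \<in> exts"
  shows "ext_alg E \<in> inv_algs"
proof -
  note D = extensionD[OF E]
  have "C0_fibres Y \<pi> \<subseteq> C0_fibres Y (ext_from E)"
  proof
    fix f assume f: "f \<in> C0_fibres Y \<pi>"
    show "f \<in> C0_fibres Y (ext_from E)"
    proof (rule C0_fibresI[OF C0_fibresD1[OF f]])
      fix y y' assume y: "y \<in> topspace Y" "y' \<in> topspace Y" "ext_from E y = ext_from E y'"
      then have "\<pi> y = \<pi> y'" using D(7) by metis
      then show "f y = f y'" by (rule C0_fibresD2[OF f y(1,2)])
    qed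
  qed
  moreover have "translate Y \<beta> s f \<in> C0_fibres Y (ext_from E)"
    if s: "s \<in> carrier G" and f: "f \<in> C0_fibres Y (ext_from E)" for s f
    by (rule Y.translate_C0_fibres[OF s f]) (simp add: D(5) s)
  ultimately show ?thesis
    unfolding extension_algebra_eq[OF E] invariant_algebras_def C0_via_\<pi>
    using fun_cstar_algebra_fibres by blast
qed

lemma extension_algebra_separates:
  assumes E: "E \<in> exts"
    and y: "y \<in> topspace Y" "y' \<in> topspace Y" "ext_from E y \<noteq> ext_from E y'"
  shows "\<exists>f \<in> ext_alg E. f y \<noteq> f y'"
proof -
  note D = extensionD[OF E]
  have "ext_from E y \<in> topspace (ext_space E)" "ext_from E y' \<in> topspace (ext_space E)"
    using y quotient_imp_surjective_map[OF D(4)] by blast+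
  then obtain f where "f \<in> C0 (ext_space E)" "f (ext_from E y) = 1" "f (ext_from E y') = 0"
    by (rule C0_separates[OF D(1,2) _ _ y(3)])
  then show ?thesis
    unfolding C0_via_def using y
    by (intro bexI[of _ "\<lambda>y. if y \<in> topspace Y then f (ext_from E y) else 0"]) auto
qed

text \<open>The algebra remembers exactly the fibres of \<open>ext_from\<close>, since C_0 of a
  locally compact Hausdorff space separates its points. Two quotient maps of \<open>Y\<close> with
  the same fibres factor through each other, and every further identity can be tested on points of
  the form \<open>ext_from E y\<close>.\<close>

lemma extension_iso_iff:
  assumes E: "E \<in> exts" and F: "F \<in> exts"
  shows "extension_iso G Y E F \<longleftrightarrow>
    ext_alg E = ext_alg F" (is "_ \<longleftrightarrow> ?A E = ?A F")
proof
  have surj: "ext_from E ` topspace Y = topspace (ext_space E)"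
    by (rule quotient_imp_surjective_map[OF extensionD(4)[OF E]])
  assume "extension_iso G Y E F"
  then obtain h where h: "homeomorphic_map (ext_space E) (ext_space F) h"
    and hy: "\<And>y. y \<in> topspace Y \<Longrightarrow> h (ext_from E y) = ext_from F y"
    unfolding extension_iso_def by blast
  have inj: "inj_on h (topspace (ext_space E))" using h homeomorphic_imp_injective_map by blast
  have "ext_from F y = ext_from F y' \<longleftrightarrow> ext_from E y = ext_from E y'"
    if "y \<in> topspace Y" "y' \<in> topspace Y" for y y'
    unfolding hy[OF that(1), symmetric] hy[OF that(2), symmetric]
    using inj that surj by (intro inj_on_eq_iff) auto
  then show "?A E = ?A F"
    unfolding extension_algebra_eq[OF E] extension_algebra_eq[OF F] C0_fibres_def by auto
next
  note D = extensionD[OF E] and D' = extensionD[OF F]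
  assume eq: "?A E = ?A F"
  have fib: "ext_from E y = ext_from E y' \<longleftrightarrow> ext_from F y = ext_from F y'"
    if y: "y \<in> topspace Y" "y' \<in> topspace Y" for y y'
  proof
    assume "ext_from E y = ext_from E y'"
    then have "f y = f y'" if "f \<in> ?A E" for f
      using that C0_fibresD2[OF _ y] unfolding extension_algebra_eq[OF E] by blast
    then show "ext_from F y = ext_from F y'"
      using extension_algebra_separates[OF F y] eq by metis
  next
    assume "ext_from F y = ext_from F y'"
    then have "f y = f y'" if "f \<in> ?A F" for f
      using that C0_fibresD2[OF _ y] unfolding extension_algebra_eq[OF F] by blast
    then show "ext_from E y = ext_from E y'"
      using extension_algebra_separates[OF E y] eq by metis
  qed
  have surj: "ext_from E ` topspace Y = topspace (ext_space E)" "ext_from F ` topspace Y = topspace (ext_space F)"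
    by (rule quotient_imp_surjective_map, rule D D')+
  obtain h where h: "continuous_map (ext_space E) (ext_space F) h"
      and hy: "\<And>y. y \<in> topspace Y \<Longrightarrow> h (ext_from E y) = ext_from F y"
    by (rule quotient_map_lift_exists[OF D(4) quotient_imp_continuous_map[OF D'(4)]])
       (use fib in blast)+
  obtain k where k: "continuous_map (ext_space F) (ext_space E) k"
      and ky: "\<And>y. y \<in> topspace Y \<Longrightarrow> k (ext_from F y) = ext_from E y"
    by (rule quotient_map_lift_exists[OF D'(4) quotient_imp_continuous_map[OF D(4)]])
       (use fib in blast)+
  have all: "\<forall>z\<in>topspace (ext_space E). P z" if "\<And>y. y \<in> topspace Y \<Longrightarrow> P (ext_from E y)" for P
    using that unfolding surj(1)[symmetric] by blast
  have all': "\<forall>z\<in>topspace (ext_space F). P z" if "\<And>y. y \<in> topspace Y \<Longrightarrow> P (ext_from F y)" for P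
    using that unfolding surj(2)[symmetric] by blast
  have "homeomorphic_maps (ext_space E) (ext_space F) h k"
    unfolding homeomorphic_maps_def using h k by (auto intro!: all all' simp: hy ky)
  then have "homeomorphic_map (ext_space E) (ext_space F) h" by (rule homeomorphic_maps_imp_map)
  moreover have "\<forall>s\<in>carrier G. \<forall>z\<in>topspace (ext_space E). h (ext_act E s z) = ext_act F s (h z)"
  proof
    fix s assume s: "s \<in> carrier G"
    show "\<forall>z\<in>topspace (ext_space E). h (ext_act E s z) = ext_act F s (h z)"
    proof (rule all)
      fix y assume y: "y \<in> topspace Y"
      have "h (ext_act E s (ext_from E y)) = h (ext_from E (\<beta> s y))" using D(5)[OF s y] by simp
      also have "\<dots> = ext_from F (\<beta> s y)" using s y by (intro hy) simp
      also have "\<dots> = ext_act F s (h (ext_from E y))" using D'(5)[OF s y] hy[OF y] by simp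
      finally show "h (ext_act E s (ext_from E y)) = ext_act F s (h (ext_from E y))" .
    qed
  qed
  moreover have "\<forall>z\<in>topspace (ext_space E). ext_to E z = ext_to F (h z)"
    by (rule all) (simp add: hy D(7) D'(7))
  ultimately show "extension_iso G Y E F" unfolding extension_iso_def using hy by blast
qed

end

section \<open>Quotient topologies and the spectrum of an invariant algebra\<close>

lemma quotient_topology_exists:
  obtains Z where "quotient_map Y Z p"
proof -
  define P where "P U \<longleftrightarrow> U \<subseteq> p ` topspace Y \<and> openin Y {y \<in> topspace Y. p y \<in> U}" for U
  have "istopology P"
    unfolding istopology_def
  proof (intro conjI allI impI)
    fix S T assume "P S" "P T"
    moreover have "{y \<in> topspace Y. p y \<in> S \<inter> T} = {y \<in> topspace Y. p y \<in> S} \<inter> {y \<in> topspace Y. p y \<in> T}"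
      by blast
    ultimately show "P (S \<inter> T)" unfolding P_def by auto
  next
    fix \<U> assume U: "\<forall>U\<in>\<U>. P U"
    have "{y \<in> topspace Y. p y \<in> \<Union>\<U>} = \<Union> ((\<lambda>U. {y \<in> topspace Y. p y \<in> U}) ` \<U>)" by blast
    moreover have "openin Y (\<Union> ((\<lambda>U. {y \<in> topspace Y. p y \<in> U}) ` \<U>))"
      using U unfolding P_def by (intro openin_Union) blast
    ultimately show "P (\<Union>\<U>)" using U unfolding P_def by auto
  qed
  then have o: "openin (topology P) U \<longleftrightarrow> P U" for U by simp
  have "{y \<in> topspace Y. p y \<in> p ` topspace Y} = topspace Y" by blast
  then have "P (p ` topspace Y)" unfolding P_def by simp
  then have "topspace (topology P) = p ` topspace Y"
  proof (intro equalityI)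
    show "topspace (topology P) \<subseteq> p ` topspace Y" using o[of "topspace (topology P)"] by (simp add: P_def)
    show "p ` topspace Y \<subseteq> topspace (topology P)" if "P (p ` topspace Y)"
      using that by (intro openin_subset) (simp only: o)
  qed  then have "quotient_map Y (topology P) p"
    unfolding quotient_map_def o by (auto simp: P_def)
  then show thesis by (rule that)
qed

context proper_factor
begin

text \<open>Gelfand duality: the points of the quotient are the classes of points of \<open>Y\<close> which the algebra
  does not separate, each named by the image under \<open>j\<close> of a representative.\<close>

lemma extension_of_invariant_algebra:
  fixes j :: "'y \<Rightarrow> 'z"
  assumes A: "A \<in> inv_algs" and j: "inj_on j (topspace Y)"
  obtains E :: "('g, 'x, 'y, 'z) extension"
  where "E \<in> exts" "ext_alg E = A"
proof -
  have alg: "fun_cstar_algebra Y A" and sub: "C0_via Y \<pi> X \<subseteq> A"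
    and inv: "\<And>s f. s \<in> carrier G \<Longrightarrow> f \<in> A \<Longrightarrow> translate Y \<beta> s f \<in> A"
    using A unfolding invariant_algebras_def by auto
  note AC = fca_C0[OF alg]
  define rep where "rep y = (SOME y'. y' \<in> topspace Y \<and> (\<forall>f\<in>A. f y' = f y))" for y
  have rep: "rep y \<in> topspace Y \<and> (\<forall>f\<in>A. f (rep y) = f y)" if "y \<in> topspace Y" for y
    unfolding rep_def by (rule someI[of _ y]) (use that in blast)
  define p where "p y = j (rep y)" for y
  have p_iff: "p y = p y' \<longleftrightarrow> (\<forall>f\<in>A. f y = f y')" if y: "y \<in> topspace Y" "y' \<in> topspace Y" for y y'
  proof
    assume "p y = p y'"
    then have "rep y = rep y'" using rep[OF y(1)] rep[OF y(2)] j unfolding p_def by (auto dest: inj_onD)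
    then show "\<forall>f\<in>A. f y = f y'" using rep[OF y(1)] rep[OF y(2)] by metis
  next
    assume "\<forall>f\<in>A. f y = f y'"
    \<comment> \<open>Both representatives are chosen from the same predicate and therefore
      coincide.\<close>
    then have "(\<lambda>x. x \<in> topspace Y \<and> (\<forall>f\<in>A. f x = f y)) = (\<lambda>x. x \<in> topspace Y \<and> (\<forall>f\<in>A. f x = f y'))"
      by (intro ext) auto
    then show "p y = p y'" by (simp add: p_def rep_def)
  qed
  have p_eqD: "f y = f y'" if "y \<in> topspace Y" "y' \<in> topspace Y" "p y = p y'" "f \<in> A" for f y y'
    using p_iff[OF that(1,2), THEN iffD1, OF that(3)] that(4) by (rule bspec)
  obtain Z where Z: "quotient_map Y Z p" by (rule quotient_topology_exists)
  have pc: "continuous_map Y Z p" by (rule quotient_imp_continuous_map[OF Z])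
  have surj: "p ` topspace Y = topspace Z" by (rule quotient_imp_surjective_map[OF Z])
  then have pin [simp]: "p y \<in> topspace Z" if "y \<in> topspace Y" for y using that by blast
  have all: "P z" if "z \<in> topspace Z" "\<And>y. y \<in> topspace Y \<Longrightarrow> P (p y)" for P z
    using that unfolding surj[symmetric] by blast
  have lift: "\<exists>g. continuous_map Z euclidean g \<and> (\<forall>y\<in>topspace Y. g (p y) = f y)" if f: "f \<in> A" for f
  proof -
    have "f y = f y'" if "y \<in> topspace Y" "y' \<in> topspace Y" "p y = p y'" for y y'
      by (rule p_eqD[OF that f])
    then show ?thesis
      using quotient_map_lift_exists[OF Z C0_continuous[OF AC[OF f]]] by metis
  qed
  \<comment> \<open>Distinct points of \<open>Z\<close> are separated by an element of
    \<open>A\<close>; its lift to \<open>Z\<close> pulls back disjoint open sets of complex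
    numbers.\<close>
  have "Hausdorff_space Z"
    unfolding Hausdorff_space_def
  proof (intro allI impI, elim conjE)
    fix z z' assume "z \<in> topspace Z" "z' \<in> topspace Z" "z \<noteq> z'"
    then obtain y y' where y: "y \<in> topspace Y" "y' \<in> topspace Y" "z = p y" "z' = p y'" "p y \<noteq> p y'"
      unfolding surj[symmetric] by blast
    then obtain f where f: "f \<in> A" "f y \<noteq> f y'" using p_iff[OF y(1,2)] by blast
    obtain g where g: "continuous_map Z euclidean g" "\<And>y. y \<in> topspace Y \<Longrightarrow> g (p y) = f y"
      using lift[OF f(1)] by blast
    obtain U V where UV: "open U" "open V" "f y \<in> U" "f y' \<in> V" "U \<inter> V = {}"
      using hausdorff[OF f(2)] by blast
    have "openin Z {z \<in> topspace Z. g z \<in> U}" "openin Z {z \<in> topspace Z. g z \<in> V}"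
      using openin_continuous_map_preimage[OF g(1)] UV by auto
    moreover have "z \<in> {z \<in> topspace Z. g z \<in> U}" "z' \<in> {z \<in> topspace Z. g z \<in> V}"
      using y UV g(2) by auto
    moreover have "disjnt {z \<in> topspace Z. g z \<in> U} {z \<in> topspace Z. g z \<in> V}"
      using UV(5) by (auto simp: disjnt_def)
    ultimately show "\<exists>U V. openin Z U \<and> openin Z V \<and> z \<in> U \<and> z' \<in> V \<and> disjnt U V" by blast
  qed
  \<comment> \<open>Functions pulled back from \<open>X\<close> do this; it serves both local
    compactness and the Stone--Weierstrass theorem.\<close>
  have nonvanishing: "\<exists>f\<in>A. f y = 1" if y: "y \<in> topspace Y" for y
  proof -
    obtain u where u: "u \<in> C0 X" "u (\<pi> y) = 1"
      by (rule C0_nonvanishing[OF lcX hX \<pi>_in[OF y]])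
    then have "(\<lambda>y. if y \<in> topspace Y then u (\<pi> y) else 0) \<in> A"
      using sub unfolding C0_via_def by blast
    then show ?thesis using u(2) y by (intro bexI) auto
  qed
  have "locally_compact_space Z"
    unfolding locally_compact_space_def
  proof
    fix z assume "z \<in> topspace Z"
    then obtain y where y: "y \<in> topspace Y" "z = p y" unfolding surj[symmetric] by blast
    obtain f where f: "f \<in> A" "f y = 1" using nonvanishing[OF y(1)] by blast
    obtain g where g: "continuous_map Z euclidean g" "\<And>y. y \<in> topspace Y \<Longrightarrow> g (p y) = f y"
      using lift[OF f(1)] by blast
    \<comment> \<open>The lift takes the value 1 at \<open>z\<close>, so the level 1/2 leaves an
      open neighbourhood covered by the image of a compact superlevel set.\<close>
    let ?U = "{z \<in> topspace Z. g z \<in> {w. 1/2 < cmod w}}" and ?K = "p ` {y \<in> topspace Y. 1/2 \<le> cmod (f y)}"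
    have "openin Z ?U"
      by (rule openin_continuous_map_preimage[OF g(1)])
         (auto intro!: open_Collect_less continuous_intros)
    moreover have "compactin Z ?K"
      by (rule image_compactin[OF C0_compact[OF AC[OF f(1)]] pc]) simp
    moreover have "z \<in> ?U" using y f(2) g(2) by simp
    moreover have "?U \<subseteq> ?K"
    proof
      fix w assume w: "w \<in> ?U"
      then obtain x where x: "x \<in> topspace Y" "w = p x" unfolding surj[symmetric] by blast
      then show "w \<in> ?K" using w g(2)[OF x(1)] by (auto intro!: imageI)
    qed
    ultimately show "\<exists>U K. openin Z U \<and> compactin Z K \<and> z \<in> U \<and> U \<subseteq> K" by blast
  qed
  have \<pi>_const: "\<pi> y = \<pi> y'" if y: "y \<in> topspace Y" "y' \<in> topspace Y" "p y = p y'" for y y'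
  proof (rule ccontr)
    assume "\<pi> y \<noteq> \<pi> y'"
    then obtain f where f: "f \<in> C0 X" "f (\<pi> y) = 1" "f (\<pi> y') = 0"
      by (rule C0_separates[OF lcX hX \<pi>_in[OF y(1)] \<pi>_in[OF y(2)]])
    have "(\<lambda>y. if y \<in> topspace Y then f (\<pi> y) else 0) \<in> A"
      using f(1) sub unfolding C0_via_def by blast
    from p_eqD[OF y this] show False using f y by simp
  qed
  obtain q where q: "continuous_map Z X q" and qp: "\<And>y. y \<in> topspace Y \<Longrightarrow> q (p y) = \<pi> y"
    by (rule quotient_map_lift_exists[OF Z quotient_imp_continuous_map[OF quot]])
       (use \<pi>_const in blast)+
  have q_quot: "quotient_map Z X q"
    by (rule quotient_map_from_composition[OF pc q quotient_map_eq[OF quot]]) (simp add: qp)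
  \<comment> \<open>By invariance of \<open>A\<close>, points not separated by \<open>A\<close> stay
    unseparated after \<beta>(s), so \<beta>(s) descends to \<open>Z\<close>.\<close>
  have "\<exists>g. continuous_map Z Z g \<and> (\<forall>y\<in>topspace Y. g (p y) = p (\<beta> s y))" if s: "s \<in> carrier G" for s
  proof -
    have "p (\<beta> s y) = p (\<beta> s y')" if y: "y \<in> topspace Y" "y' \<in> topspace Y" "p y = p y'" for y y'
    proof -
      have "f (\<beta> s y) = f (\<beta> s y')" if f: "f \<in> A" for f
      proof -
        from p_eqD[OF y inv[OF s f]] show ?thesis using y by (simp add: translate_def)
      qed
      then show ?thesis using p_iff s y by simp
    qed
    then show ?thesis
      using quotient_map_lift_exists[OF Z continuous_map_compose[OF Y.act_continuous[OF s] pc]]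
      unfolding o_def by metis
  qed
  then obtain g where gc: "\<And>s. s \<in> carrier G \<Longrightarrow> continuous_map Z Z (g s)"
    and gp: "\<And>s y. s \<in> carrier G \<Longrightarrow> y \<in> topspace Y \<Longrightarrow> g s (p y) = p (\<beta> s y)"
    by metis
  \<comment> \<open>Members of \<open>Bij (topspace Z)\<close> are extensional functions; the
    restriction provides this.\<close>
  define \<gamma> where "\<gamma> s = restrict (g s) (topspace Z)" for s
  have \<gamma>p: "\<gamma> s (p y) = p (\<beta> s y)" if "s \<in> carrier G" "y \<in> topspace Y" for s y
    using that gp by (simp add: \<gamma>_def)
  have \<gamma>c: "continuous_map Z Z (\<gamma> s)" if "s \<in> carrier G" for s
    by (rule continuous_map_eq[OF gc[OF that]]) (simp add: \<gamma>_def)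
  have \<gamma>in: "\<gamma> s z \<in> topspace Z" if "s \<in> carrier G" "z \<in> topspace Z" for s z
    by (rule all[OF that(2)]) (use that(1) in \<open>simp add: \<gamma>p\<close>)
  have \<gamma>mult: "\<gamma> (s \<otimes> t) z = \<gamma> s (\<gamma> t z)" if "s \<in> carrier G" "t \<in> carrier G" "z \<in> topspace Z" for s t z
    by (rule all[OF that(3)]) (use that(1,2) in \<open>simp add: \<gamma>p Y.act_mult\<close>)
  have \<gamma>inv: "\<gamma> (inv s) (\<gamma> s z) = z" "\<gamma> s (\<gamma> (inv s) z) = z" if "s \<in> carrier G" "z \<in> topspace Z" for s z
    by (rule all[OF that(2)], use that(1) in \<open>simp add: \<gamma>p\<close>)+
  have \<gamma>homeo: "homeomorphic_map Z Z (\<gamma> s)" if s: "s \<in> carrier G" for s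
    using s by (intro homeomorphic_maps_imp_map[of _ _ _ "\<gamma> (inv s)"])
               (auto simp: homeomorphic_maps_def \<gamma>c \<gamma>inv)
  have \<gamma>bij: "\<gamma> s \<in> Bij (topspace Z)" if s: "s \<in> carrier G" for s
  proof -
    have "bij_betw (\<gamma> s) (topspace Z) (topspace Z)"
      using s by (intro bij_betwI[of _ _ _ "\<gamma> (inv s)"]) (auto simp: \<gamma>in \<gamma>inv)
    then show ?thesis by (simp add: Bij_def \<gamma>_def)
  qed
  have "group_hom G (BijGroup (topspace Z)) \<gamma>"
  proof (rule group_hom.intro[OF Y.grp group_BijGroup], unfold_locales, rule homI)
    show "\<gamma> s \<in> carrier (BijGroup (topspace Z))" if "s \<in> carrier G" for s
      using \<gamma>bij[OF that] by (simp add: BijGroup_def)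
    show "\<gamma> (s \<otimes> t) = \<gamma> s \<otimes>\<^bsub>BijGroup (topspace Z)\<^esub> \<gamma> t" if "s \<in> carrier G" "t \<in> carrier G" for s t
    proof
      fix z show "\<gamma> (s \<otimes> t) z = (\<gamma> s \<otimes>\<^bsub>BijGroup (topspace Z)\<^esub> \<gamma> t) z"
        using \<gamma>mult[OF that, of z] \<gamma>bij[OF that(1)] \<gamma>bij[OF that(2)]
        by (cases "z \<in> topspace Z") (auto simp: BijGroup_def compose_def \<gamma>_def)
    qed
  qed
  then have "top_action G Z \<gamma>"
    unfolding top_action_def using \<gamma>homeo group_action.intro by blast
  moreover have "factor_map G Y \<beta> Z \<gamma> p"
    unfolding factor_map_def using Z \<gamma>p by simp
  moreover have "q (\<gamma> s z) = \<alpha> s (q z)" if "s \<in> carrier G" "z \<in> topspace Z" for s z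
    by (rule all[OF that(2)]) (use that(1) in \<open>simp add: \<gamma>p qp equivariant\<close>)
  then have "factor_map G Z \<gamma> X \<alpha> q"
    unfolding factor_map_def using q_quot by simp
  ultimately have E: "\<lparr>ext_space = Z, ext_act = \<gamma>, ext_from = p, ext_to = q\<rparr> \<in> exts"
    (is "?E \<in> _")
    unfolding intermediate_extensions_def
    using \<open>locally_compact_space Z\<close> \<open>Hausdorff_space Z\<close> qp by simp
  have "C0_fibres Y p = A"
  proof (intro equalityI subsetI)
    fix f assume f: "f \<in> C0_fibres Y p"
    show "f \<in> A"
    proof (rule Stone_Weierstrass_C0[OF alg _ C0_fibresD1[OF f]])
      fix y assume "y \<in> topspace Y"
      then show "\<exists>g\<in>A. g y \<noteq> 0" using nonvanishing zero_neq_one by metis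
    next
      fix y y' assume y: "y \<in> topspace Y" "y' \<in> topspace Y" and "\<And>g. g \<in> A \<Longrightarrow> g y = g y'"
      then have "p y = p y'" using p_iff[OF y] by (intro iffD2[OF p_iff[OF y]] ballI)
      then show "f y = f y'" by (rule C0_fibresD2[OF f y])
    qed
  next
    fix f assume f: "f \<in> A"
    show "f \<in> C0_fibres Y p"
    proof (rule C0_fibresI[OF AC[OF f]])
      fix y y' assume y: "y \<in> topspace Y" "y' \<in> topspace Y" "p y = p y'"
      then show "f y = f y'" using f by (rule p_eqD)
    qed
  qed
  then have "ext_alg ?E = A"
    using extension_algebra_eq[OF E] by simp
  then show thesis using that[OF E] by blast
qed

section \<open>Isomorphism classes of extensions as invariant algebras\<close>

abbreviation ext_class :: "('g, 'x, 'y, 'z) extension \<Rightarrow> ('g, 'x, 'y, 'z) extension set" where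
  "ext_class E \<equiv> {F \<in> exts. ext_alg F = ext_alg E}"

lemma extension_classes_eq: "extension_classes G X \<alpha> Y \<beta> \<pi> = ext_class ` exts"
proof -
  have "{(E, E'). E \<in> exts \<and> E' \<in> exts \<and> extension_iso G Y E E'} `` {E} = ext_class E"
    if E: "E \<in> exts" for E using E extension_iso_iff[OF E] by auto
  from image_cong[OF refl this] show ?thesis
    unfolding extension_classes_def quotient_def UNION_singleton_eq_range .
qed

lemma class_C0_class:
  assumes "E \<in> exts"
  shows "class_C0 Y (ext_class E) = ext_alg E"
proof -
  have "(\<lambda>F. ext_alg F) ` ext_class E = {ext_alg E}" using assms by blast
  then show ?thesis unfolding class_C0_def by simp
qed

text \<open>A class is the set of extensions with a given algebra, whence injectivity. Surjectivity
  needs room in the type \<open>'z\<close> for the points of a quotient of \<open>Y\<close>; an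
  injection of \<open>Y\<close> into \<open>'z\<close> provides it.\<close>

lemma bij_betw_class_C0:
  fixes L :: "('g, 'x, 'y, 'z) extension set set"
  assumes L: "L = extension_classes G X \<alpha> Y \<beta> \<pi>" and univ: "topspace Y \<lesssim> (UNIV :: 'z set)"
  shows "bij_betw (class_C0 Y) L inv_algs"
  unfolding L extension_classes_eq bij_betw_def
proof
  let ?cls = "ext_class :: ('g, 'x, 'y, 'z) extension \<Rightarrow> _"
  show "inj_on (class_C0 Y) (?cls ` exts)"
    by (rule inj_onI) (auto simp: class_C0_class)
  have "class_C0 Y ` ?cls ` exts = (\<lambda>E. ext_alg E) ` (exts :: ('g, 'x, 'y, 'z) extension set)"
    unfolding image_image by (rule image_cong[OF refl class_C0_class])
  also have "\<dots> = inv_algs"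
  proof (intro equalityI subsetI)
    fix A assume A: "A \<in> inv_algs"
    obtain j :: "'y \<Rightarrow> 'z" where j: "inj_on j (topspace Y)"
      using univ unfolding lepoll_def by blast
    obtain E :: "('g, 'x, 'y, 'z) extension" where "E \<in> exts" "ext_alg E = A"
      by (rule extension_of_invariant_algebra[OF A j])
    then show "A \<in> (\<lambda>E. ext_alg E) ` (exts :: ('g, 'x, 'y, 'z) extension set)" by blast
  qed (use extension_algebra_invariant in blast)
  finally show "class_C0 Y ` ?cls ` exts = inv_algs" .
qed

end

section \<open>Operators on square-summable families\<close>

lemma ell2_eqI: "(\<And>i. ell2_apply x i = ell2_apply y i) \<Longrightarrow> x = y"
  by (metis ell2_apply_inject ext)

lemma blinfun_ell2_eqI:
  fixes S T :: "'i ell2 \<Rightarrow>\<^sub>L 'i ell2"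
  shows "(\<And>x i. ell2_apply (blinfun_apply S x) i = ell2_apply (blinfun_apply T x) i) \<Longrightarrow> S = T"
  by (intro blinfun_eqI ell2_eqI)

lemma ell2_apply_sum: "ell2_apply (\<Sum>k\<in>S. x k) i = (\<Sum>k\<in>S. ell2_apply (x k) i)"
  by (induction S rule: infinite_finite_induct) (simp_all add: zero_ell2.rep_eq plus_ell2.rep_eq)

lemma blinfun_apply_sum: "blinfun_apply (\<Sum>k\<in>S. T k) x = (\<Sum>k\<in>S. blinfun_apply (T k) x)"
  by (induction S rule: infinite_finite_induct) (simp_all add: blinfun.add_left)

lemma norm_ell2_leI:
  fixes x :: "'i ell2"
  assumes "0 \<le> C" "\<And>F. finite F \<Longrightarrow> (\<Sum>i\<in>F. (cmod (ell2_apply x i))\<^sup>2) \<le> C\<^sup>2"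
  shows "norm x \<le> C"
proof -
  have "(norm x)\<^sup>2 \<le> C\<^sup>2"
    unfolding norm_ell2_square using ell2_apply[of x] assms(2) by (intro infsum_le_finite_sums) auto
  then show ?thesis using assms(1) power2_le_imp_le by blast
qed

definition finvec :: "'i set \<Rightarrow> ('i \<Rightarrow> complex) \<Rightarrow> 'i ell2" where
  "finvec W x = Abs_ell2 (\<lambda>i. if i \<in> W then x i else 0)"

lemma finvec_apply:
  assumes "finite W"
  shows "ell2_apply (finvec W x) i = (if i \<in> W then x i else 0)"
proof -
  have "(\<lambda>i. (cmod (if i \<in> W then x i else 0))\<^sup>2) summable_on UNIV"
    by (subst summable_on_cong_neutral[where T = W and g = "\<lambda>i. (cmod (x i))\<^sup>2"]) (use assms in auto)
  then show ?thesis by (simp add: finvec_def Abs_ell2_inverse)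
qed

lemma norm_finvec:
  assumes "finite W"
  shows "(norm (finvec W x))\<^sup>2 = (\<Sum>i\<in>W. (cmod (x i))\<^sup>2)"
proof -
  have "(norm (finvec W x))\<^sup>2 = (\<Sum>\<^sub>\<infinity>i\<in>W. (cmod (x i))\<^sup>2)"
    unfolding norm_ell2_square finvec_apply[OF assms] by (rule infsum_cong_neutral) auto
  then show ?thesis using assms by simp
qed

lemma cscale_apply:
  "ell2_apply (blinfun_apply (cscale c T) x) i = c * ell2_apply (blinfun_apply T x) i"
  unfolding cscale_def blinfun_apply_blinfun_compose
  by (subst wcomp_apply[of _ "cmod c"]) auto

lemma norm_wcomp_le:
  assumes "\<And>i. cmod (a i) \<le> B" "inj_on \<sigma> {i. a i \<noteq> 0}" "0 \<le> B"
  shows "norm (wcomp a \<sigma>) \<le> B"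
proof (rule norm_blinfun_bound[OF assms(3)])
  fix x
  have "(norm (blinfun_apply (wcomp a \<sigma>) x))\<^sup>2 \<le> (B * norm x)\<^sup>2"
    unfolding norm_ell2_square wcomp_apply[OF assms(1,2)] by (rule wcomp_square_summable(2)[OF assms(1,2)])
  then show "norm (blinfun_apply (wcomp a \<sigma>) x) \<le> B * norm x"
    by (rule power2_le_imp_le) (intro mult_nonneg_nonneg assms(3) norm_ge_zero)
qed

lemma norm_cscale_le: "norm (cscale c T) \<le> cmod c * norm T"
proof -
  have "norm (wcomp (\<lambda>_::'a. c) id) \<le> cmod c" by (rule norm_wcomp_le) auto
  then show ?thesis unfolding cscale_def
    by (rule order_trans[OF norm_blinfun_compose mult_right_mono[OF _ norm_ge_zero]])
qed

lemma cscale_add_right: "cscale c (S + T) = cscale c S + cscale c T"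
  and cscale_diff_right: "cscale c (S - T) = cscale c S - cscale c T"
  and cscale_scaleR: "cscale c (r *\<^sub>R T) = r *\<^sub>R cscale c T"
  and cscale_cscale: "cscale c (cscale d T) = cscale (c * d) T"
  and cscale_of_real: "cscale (complex_of_real r) T = r *\<^sub>R T"
  by (rule blinfun_ell2_eqI; simp add: cscale_apply blinfun.add_left blinfun.diff_left blinfun.scaleR_left
        plus_ell2.rep_eq minus_ell2.rep_eq scaleR_ell2.rep_eq algebra_simps)+

lemma cscale_sum: "cscale c (\<Sum>k\<in>S. T k) = (\<Sum>k\<in>S. cscale c (T k))"
  by (rule blinfun_ell2_eqI) (simp add: cscale_apply blinfun_apply_sum ell2_apply_sum sum_distrib_left)

lemma bounded_linear_cscale: "bounded_linear (cscale c)"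
proof (rule bounded_linear_intro[where K = "cmod c"])
  show "norm (cscale c T) \<le> norm T * cmod c" for T
    using norm_cscale_le[of c T] by (simp only: mult.commute)
qed (rule cscale_add_right cscale_scaleR)+

section \<open>The complex inner product and adjoints\<close>

lemma cinner_add_left: "cinner (x + y) z = cinner x z + cinner y z"
  unfolding cinner_def infsum_add[OF cinner_summable cinner_summable, symmetric]
  by (simp add: plus_ell2.rep_eq algebra_simps)

lemma cinner_add_right: "cinner x (y + z) = cinner x y + cinner x z"
  unfolding cinner_def infsum_add[OF cinner_summable cinner_summable, symmetric]
  by (simp add: plus_ell2.rep_eq algebra_simps)

lemma cinner_scaleR_left: "cinner (r *\<^sub>R x) y = complex_of_real r * cinner x y"
  unfolding cinner_def infsum_cmult_right'[symmetric] by (simp add: scaleR_ell2.rep_eq algebra_simps)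

lemma cinner_scaleR_right: "cinner x (r *\<^sub>R y) = complex_of_real r * cinner x y"
  unfolding cinner_def infsum_cmult_right'[symmetric] by (simp add: scaleR_ell2.rep_eq algebra_simps)

lemma cinner_cscale: 
  "cinner x (blinfun_apply (cscale c id_blinfun) y) = c * cinner x y"
  "cinner (blinfun_apply (cscale c id_blinfun) x) y = cnj c * cinner x y"
  unfolding cinner_def infsum_cmult_right'[symmetric] by (simp_all add: cscale_apply algebra_simps)

text \<open>The real Cauchy--Schwarz inequality is applied to the real and imaginary parts
  separately. This costs the factor 2, which is harmless since only continuity of
  \<open>cinner\<close> is wanted.\<close>

lemma norm_cinner_le: "cmod (cinner x y) \<le> norm x * norm y * 2"
proof -
  \<comment> \<open>The scalar -\<i> turns the imaginary part of \<open>cinner x y\<close> into a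
    real part.\<close>
  let ?y = "blinfun_apply (cscale (-\<i>) id_blinfun) y"
  have "Im (cinner x y) = inner x ?y"
    by (simp add: inner_ell2_def cinner_cscale)
  moreover have "norm ?y \<le> norm y"
  proof -
    have "norm (cscale (-\<i>) (id_blinfun :: 'a ell2 \<Rightarrow>\<^sub>L _)) \<le> 1 * norm (id_blinfun :: 'a ell2 \<Rightarrow>\<^sub>L _)"
      using norm_cscale_le[of "-\<i>" "id_blinfun :: 'a ell2 \<Rightarrow>\<^sub>L _"] by simp
    also have "\<dots> \<le> 1" using norm_blinfun_id_le by simp
    finally have "norm (cscale (-\<i>) (id_blinfun :: 'a ell2 \<Rightarrow>\<^sub>L _)) * norm y \<le> 1 * norm y"
      by (rule mult_right_mono) simp
    with norm_blinfun[of "cscale (-\<i>) id_blinfun" y] show ?thesis by simp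
  qed
  ultimately have "\<bar>Im (cinner x y)\<bar> \<le> norm x * norm y"
    using Cauchy_Schwarz_ineq2[of x ?y] mult_left_mono[of "norm ?y" "norm y" "norm x"] by simp
  moreover have "\<bar>Re (cinner x y)\<bar> \<le> norm x * norm y"
    using Cauchy_Schwarz_ineq2[of x y] by (simp add: inner_ell2_def)
  ultimately show ?thesis using cmod_le[of "cinner x y"] by simp
qed

lemma bounded_bilinear_cinner: "bounded_bilinear cinner"
proof
  show "\<exists>K. \<forall>x y :: 'a ell2. norm (cinner x y) \<le> norm x * norm y * K"
    by (intro exI[of _ 2] allI norm_cinner_le)
qed (simp_all only: cinner_add_left cinner_add_right cinner_scaleR_left cinner_scaleR_right scaleR_conv_of_real)

lemma adjoint_inner: "is_adjoint S T \<Longrightarrow> inner (blinfun_apply S x) y = inner x (blinfun_apply T y)"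
  by (simp add: is_adjoint_def inner_ell2_def)

lemma adjoint_unique:
  assumes "is_adjoint S T" "is_adjoint S' T"
  shows "S = S'"
proof (rule blinfun_eqI)
  fix x
  let ?d = "blinfun_apply S x - blinfun_apply S' x"
  have "inner ?d ?d = 0"
    unfolding inner_diff_left adjoint_inner[OF assms(1)] adjoint_inner[OF assms(2)] by simp
  then show "blinfun_apply S x = blinfun_apply S' x" by simp
qed

text \<open>The square of the norm of Sx is the inner product of x with TSx. Applied to differences,
  the bound makes adjoints of a Cauchy sequence Cauchy again.\<close>

lemma adjoint_norm_le:
  assumes "is_adjoint S T"
  shows "norm S \<le> norm T"
proof (rule norm_blinfun_bound)
  fix x
  let ?Sx = "blinfun_apply S x"
  have "norm ?Sx * norm ?Sx = inner ?Sx ?Sx" by (simp add: power2_norm_eq_inner flip: power2_eq_square)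
  also have "\<dots> = inner x (blinfun_apply T ?Sx)" by (rule adjoint_inner[OF assms])
  also have "\<dots> \<le> norm x * norm (blinfun_apply T ?Sx)" using Cauchy_Schwarz_ineq2 by (metis abs_le_D1)
  also have "\<dots> \<le> norm x * (norm T * norm ?Sx)" by (intro mult_left_mono norm_blinfun) simp
  finally have "norm ?Sx * norm ?Sx \<le> (norm T * norm x) * norm ?Sx" by (simp add: algebra_simps)
  then show "norm ?Sx \<le> norm T * norm x"
    by (cases "norm ?Sx = 0") (auto simp: mult_le_cancel_right)
qed simp

lemma adjoint_add: "is_adjoint S T \<Longrightarrow> is_adjoint S' T' \<Longrightarrow> is_adjoint (S + S') (T + T')"
  by (simp add: is_adjoint_def blinfun.add_left cinner_add_left cinner_add_right)

lemma adjoint_scaleR: "is_adjoint S T \<Longrightarrow> is_adjoint (r *\<^sub>R S) (r *\<^sub>R T)"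
  by (simp add: is_adjoint_def blinfun.scaleR_left cinner_scaleR_left cinner_scaleR_right)

lemma adjoint_diff: "is_adjoint S T \<Longrightarrow> is_adjoint S' T' \<Longrightarrow> is_adjoint (S - S') (T - T')"
  using adjoint_add[of S T "-S'" "-T'"] adjoint_scaleR[of S' T' "-1"] by simp

lemma adjoint_zero: "is_adjoint 0 0"
  by (simp add: is_adjoint_def cinner_def zero_ell2.rep_eq)

lemma adjoint_limit:
  assumes "\<And>n::nat. is_adjoint (S n) (T n)" "S \<longlonglongrightarrow> S'" "T \<longlonglongrightarrow> T'"
  shows "is_adjoint S' T'"
  unfolding is_adjoint_def
proof (intro allI)
  fix x y
  interpret bounded_bilinear cinner by (rule bounded_bilinear_cinner)
  have "(\<lambda>n. cinner (blinfun_apply (S n) x) y) \<longlonglongrightarrow> cinner (blinfun_apply S' x) y"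
    by (intro tendsto tendsto_const blinfun.tendsto assms)
  moreover have "(\<lambda>n. cinner x (blinfun_apply (T n) y)) \<longlonglongrightarrow> cinner x (blinfun_apply T' y)"
    by (intro tendsto tendsto_const blinfun.tendsto assms)
  moreover have "cinner (blinfun_apply (S n) x) y = cinner x (blinfun_apply (T n) y)" for n
    using assms(1) unfolding is_adjoint_def by blast
  ultimately show "cinner (blinfun_apply S' x) y = cinner x (blinfun_apply T' y)"
    using LIMSEQ_unique by simp
qed

section \<open>Closures and intersections of operator C*-algebras\<close>

lemma
  assumes "op_cstar_algebra A"
  shows oca_zero: "0 \<in> A"
    and oca_add: "S \<in> A \<Longrightarrow> T \<in> A \<Longrightarrow> S + T \<in> A"
    and oca_cscale: "T \<in> A \<Longrightarrow> cscale c T \<in> A"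
    and oca_compose: "S \<in> A \<Longrightarrow> T \<in> A \<Longrightarrow> S o\<^sub>L T \<in> A"
    and oca_adjoint: "T \<in> A \<Longrightarrow> \<exists>S\<in>A. is_adjoint S T"
    and oca_closed: "closed A"
  using assms unfolding op_cstar_algebra_def by blast+

lemma oca_subspace: "op_cstar_algebra A \<Longrightarrow> subspace A"
  unfolding subspace_def using oca_zero oca_add oca_cscale[of A _ "complex_of_real _"] cscale_of_real by metis

lemma oca_sum: "op_cstar_algebra A \<Longrightarrow> (\<And>k. k \<in> S \<Longrightarrow> T k \<in> A) \<Longrightarrow> (\<Sum>k\<in>S. T k) \<in> A"
  using subspace_sum[OF oca_subspace] by blast

lemma closureI_seq: "(\<And>n::nat. x n \<in> A) \<Longrightarrow> x \<longlonglongrightarrow> l \<Longrightarrow> l \<in> closure A"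
  for l :: "'a::first_countable_topology"
  using closure_sequential by blast

text \<open>Only adjoints need care, since \<open>op_cstar_algebra\<close> merely asserts their
  existence: chosen adjoints of a convergent sequence form a Cauchy sequence, and its limit is the
  adjoint of the limit.\<close>

lemma op_cstar_algebra_closure:
  assumes zero: "0 \<in> A" and add: "\<And>S T. S \<in> A \<Longrightarrow> T \<in> A \<Longrightarrow> S + T \<in> A"
    and cscale: "\<And>c T. T \<in> A \<Longrightarrow> cscale c T \<in> A"
    and comp: "\<And>S T. S \<in> A \<Longrightarrow> T \<in> A \<Longrightarrow> S o\<^sub>L T \<in> A"
    and adj: "\<And>T. T \<in> A \<Longrightarrow> \<exists>S\<in>A. is_adjoint S T"
  shows "op_cstar_algebra (closure A)"
  unfolding op_cstar_algebra_def
proof (intro conjI ballI allI)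
  show "0 \<in> closure A" using zero closure_subset by blast
  fix S T assume "S \<in> closure A" "T \<in> closure A"
  then obtain s t where st: "\<And>n. s n \<in> A" "s \<longlonglongrightarrow> S" "\<And>n. t n \<in> A" "t \<longlonglongrightarrow> T"
    unfolding closure_sequential by blast
  show "S + T \<in> closure A"
    by (rule closureI_seq[OF _ tendsto_add[OF st(2,4)]]) (intro add st)
  have "(\<lambda>n. s n o\<^sub>L t n) \<longlonglongrightarrow> (S o\<^sub>L T)"
    by (rule bounded_bilinear.tendsto[OF bounded_bilinear_blinfun_compose st(2,4)])
  then show "S o\<^sub>L T \<in> closure A" by (rule closureI_seq[rotated]) (intro comp st)
next
  fix c T assume "T \<in> closure A"
  then obtain t where t: "\<And>n. t n \<in> A" "t \<longlonglongrightarrow> T"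
    unfolding closure_sequential by blast
  show "cscale c T \<in> closure A"
    by (rule closureI_seq[OF _ bounded_linear.tendsto[OF bounded_linear_cscale t(2)]]) (intro cscale t)
next
  fix T assume "T \<in> closure A"
  then obtain t where t: "\<And>n. t n \<in> A" "t \<longlonglongrightarrow> T"
    unfolding closure_sequential by blast
  have "\<forall>n. \<exists>S. S \<in> A \<and> is_adjoint S (t n)" using adj[OF t(1)] by blast
  then obtain s where s: "\<And>n. s n \<in> A" "\<And>n. is_adjoint (s n) (t n)" by metis
  have "Cauchy s"
  proof (rule metric_CauchyI)
    fix e :: real assume "0 < e"
    then obtain M where M: "\<And>m n. M \<le> m \<Longrightarrow> M \<le> n \<Longrightarrow> dist (t m) (t n) < e"
      using LIMSEQ_imp_Cauchy[OF t(2)] unfolding Cauchy_def by blast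
    have "dist (s m) (s n) < e" if "M \<le> m" "M \<le> n" for m n
      using adjoint_norm_le[OF adjoint_diff[OF s(2)[of m] s(2)[of n]]] M[OF that] by (simp add: dist_norm)
    then show "\<exists>M. \<forall>m\<ge>M. \<forall>n\<ge>M. dist (s m) (s n) < e" by blast
  qed
  then obtain S where S: "s \<longlonglongrightarrow> S" using Cauchy_convergent convergent_def by blast
  then show "\<exists>S\<in>closure A. is_adjoint S T"
    using adjoint_limit[OF s(2) S t(2)] closureI_seq[OF s(1) S] by blast
qed simp

text \<open>Each member provides an adjoint of its own; by uniqueness all of these are the same
  operator.\<close>

lemma op_cstar_algebra_Inter:
  assumes alg: "\<And>A. A \<in> \<A> \<Longrightarrow> op_cstar_algebra A" and ne: "\<A> \<noteq> {}"
  shows "op_cstar_algebra (\<Inter>\<A>)"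
  unfolding op_cstar_algebra_def
proof (intro conjI ballI allI)
  fix T assume T: "T \<in> \<Inter>\<A>"
  obtain A where A: "A \<in> \<A>" using ne by blast
  obtain S where S: "is_adjoint S T" using oca_adjoint[OF alg[OF A]] A T by blast
  have "S \<in> B" if B: "B \<in> \<A>" for B
  proof -
    obtain S' where "S' \<in> B" "is_adjoint S' T" using oca_adjoint[OF alg[OF B]] B T by blast
    then show ?thesis using adjoint_unique[OF S] by blast
  qed
  then show "\<exists>S\<in>\<Inter>\<A>. is_adjoint S T" using S by blast
next
  show "closed (\<Inter>\<A>)" using oca_closed[OF alg] by (intro closed_Inter) blast
next
  show "0 \<in> \<Inter>\<A>" using oca_zero[OF alg] by blast
  fix S T assume "S \<in> \<Inter>\<A>" "T \<in> \<Inter>\<A>"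
  then show "S + T \<in> \<Inter>\<A>" "S o\<^sub>L T \<in> \<Inter>\<A>"
    using oca_add[OF alg] oca_compose[OF alg] by blast+
next
  fix c T assume "T \<in> \<Inter>\<A>"
  then show "cscale c T \<in> \<Inter>\<A>" using oca_cscale[OF alg] by blast
qed

section \<open>The generators of the crossed product\<close>

context G_space
begin

abbreviation cop :: "('y \<Rightarrow> complex) \<Rightarrow> 'g \<Rightarrow> ('g \<times> 'y) ell2 \<Rightarrow>\<^sub>L ('g \<times> 'y) ell2" where
  "cop \<equiv> crossed_op G Y \<beta>"

abbreviation cp :: "('y \<Rightarrow> complex) set \<Rightarrow> (('g \<times> 'y) ell2 \<Rightarrow>\<^sub>L ('g \<times> 'y) ell2) set" where
  "cp \<equiv> crossed_product G Y \<beta>"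

lemma inj_on_shift:
  assumes "s \<in> carrier G"
  shows "inj_on (\<lambda>(t, y). (inv s \<otimes> t, y)) {i. (case i of (t, y) \<Rightarrow> if t \<in> carrier G \<and> y \<in> topspace Y then f (\<beta> t y) else 0) \<noteq> 0}"
  using assms by (auto simp: inj_on_def split: if_splits)

lemma cop_apply:
  assumes s: "s \<in> carrier G" and B: "\<And>y. y \<in> topspace Y \<Longrightarrow> cmod (f y) \<le> B"
  shows "ell2_apply (blinfun_apply (cop f s) x) (t, y) =
    (if t \<in> carrier G \<and> y \<in> topspace Y then f (\<beta> t y) * ell2_apply x (inv s \<otimes> t, y) else 0)"
  unfolding crossed_op_def
proof (subst wcomp_apply[where B = "max B 0", OF _ inj_on_shift[OF s]])
  fix i :: "'g \<times> 'y"
  show "cmod (case i of (t, y) \<Rightarrow> if t \<in> carrier G \<and> y \<in> topspace Y then f (\<beta> t y) else 0) \<le> max B 0"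
    using B by (cases i) (auto simp: le_max_iff_disj)
qed simp

lemma cop_apply_C0:
  assumes "s \<in> carrier G" "f \<in> C0 Y"
  shows "ell2_apply (blinfun_apply (cop f s) x) (t, y) =
    (if t \<in> carrier G \<and> y \<in> topspace Y then f (\<beta> t y) * ell2_apply x (inv s \<otimes> t, y) else 0)"
proof -
  obtain B where "\<And>y. cmod (f y) \<le> B" using C0_bounded[OF assms(2)] by blast
  then show ?thesis by (intro cop_apply[OF assms(1)])
qed

lemma norm_cop_le:
  assumes s: "s \<in> carrier G" and B: "\<And>y. y \<in> topspace Y \<Longrightarrow> cmod (f y) \<le> B" "0 \<le> B"
  shows "norm (cop f s) \<le> B"
  unfolding crossed_op_def
proof (rule norm_wcomp_le[OF _ inj_on_shift[OF s] B(2)])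
  fix i :: "'g \<times> 'y"
  show "cmod (case i of (t, y) \<Rightarrow> if t \<in> carrier G \<and> y \<in> topspace Y then f (\<beta> t y) else 0) \<le> B"
    using B by (cases i) auto
qed

lemma cop_add:
  assumes "s \<in> carrier G" "f \<in> C0 Y" "g \<in> C0 Y"
  shows "cop (\<lambda>y. f y + g y) s = cop f s + cop g s"
  by (rule blinfun_ell2_eqI)
     (auto simp: cop_apply_C0 assms fca_add[OF C0_algebra] blinfun.add_left plus_ell2.rep_eq algebra_simps
       split: prod.splits)

lemma cop_zero: "s \<in> carrier G \<Longrightarrow> cop (\<lambda>_. 0) s = 0"
  by (rule blinfun_ell2_eqI)
     (auto simp: cop_apply_C0 fca_zero[OF C0_algebra] zero_ell2.rep_eq split: prod.splits)

lemma cop_cscale: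
  assumes "s \<in> carrier G" "f \<in> C0 Y"
  shows "cop (\<lambda>y. c * f y) s = cscale c (cop f s)"
proof (rule blinfun_ell2_eqI)
  fix x and i :: "'g \<times> 'y"
  obtain t y where i: "i = (t, y)" by (cases i)
  show "ell2_apply (blinfun_apply (cop (\<lambda>y. c * f y) s) x) i = ell2_apply (blinfun_apply (cscale c (cop f s)) x) i"
    unfolding i cscale_apply cop_apply_C0[OF assms(1) fca_scale[OF C0_algebra assms(2)]] cop_apply_C0[OF assms]
    by simp
qed

lemma cop_diff:
  assumes "s \<in> carrier G" "f \<in> C0 Y" "g \<in> C0 Y"
  shows "cop (\<lambda>y. f y - g y) s = cop f s - cop g s"
proof -
  have "(\<lambda>y. (-1) * g y) \<in> C0 Y" by (rule fca_scale[OF C0_algebra assms(3)])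
  from cop_add[OF assms(1,2) this] show ?thesis
    unfolding cop_cscale[OF assms(1,3)] using cscale_of_real[of "-1" "cop g s"] by simp
qed

text \<open>The covariance relation: moving g to the left past \<lambda>(s) turns it into g composed
  with \<beta> of the inverse of s.\<close>

lemma cop_compose:
  assumes s: "s \<in> carrier G" and r: "r \<in> carrier G" and f: "f \<in> C0 Y" and g: "g \<in> C0 Y"
  shows "cop f s o\<^sub>L cop g r = cop (\<lambda>y. f y * translate Y \<beta> (inv s) g y) (s \<otimes> r)"
proof (rule blinfun_ell2_eqI)
  fix x and i :: "'g \<times> 'y"
  obtain t y where i: "i = (t, y)" by (cases i)
  have fg: "(\<lambda>y. f y * translate Y \<beta> (inv s) g y) \<in> C0 Y"
    by (intro fca_mult[OF C0_algebra] f translate_C0 g inv_closed s)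
  show "ell2_apply (blinfun_apply (cop f s o\<^sub>L cop g r) x) i =
      ell2_apply (blinfun_apply (cop (\<lambda>y. f y * translate Y \<beta> (inv s) g y) (s \<otimes> r)) x) i"
  proof (cases "t \<in> carrier G \<and> y \<in> topspace Y")
    case True
    then have "\<beta> (inv s \<otimes> t) y = \<beta> (inv s) (\<beta> t y)" using s by (simp add: act_mult)
    moreover have "inv r \<otimes> (inv s \<otimes> t) = inv (s \<otimes> r) \<otimes> t" using True s r by (simp add: inv_mult_group m_assoc)
    ultimately show ?thesis
      using True s r
      unfolding i blinfun_apply_blinfun_compose cop_apply_C0[OF s f] cop_apply_C0[OF r g] cop_apply_C0[OF m_closed[OF s r] fg]
      by (simp add: translate_def)
  next
    case False
    show ?thesis
      unfolding i blinfun_apply_blinfun_compose cop_apply_C0[OF s f] cop_apply_C0[OF m_closed[OF s r] fg] if_not_P[OF False] ..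
  qed
qed

text \<open>The adjoint of f\<lambda>(s) is \<lambda>(s)^(-1) times the conjugate of f, brought into
  normal form by covariance. In coordinates this is the substitution of s t for t.\<close>

lemma cop_adjoint:
  assumes s: "s \<in> carrier G" and f: "f \<in> C0 Y"
  shows "is_adjoint (cop (translate Y \<beta> s (\<lambda>y. cnj (f y))) (inv s)) (cop f s)"
  unfolding is_adjoint_def
proof (intro allI)
  fix x z :: "('g \<times> 'y) ell2"
  let ?g = "translate Y \<beta> s (\<lambda>y. cnj (f y))" and ?C = "carrier G \<times> topspace Y"
  have g: "?g \<in> C0 Y" by (intro translate_C0 s fca_cnj[OF C0_algebra] f)
  let ?h = "\<lambda>(t, y). cnj (ell2_apply x (t, y)) * (f (\<beta> t y) * ell2_apply z (inv s \<otimes> t, y))"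
  have "cinner x (blinfun_apply (cop f s) z) = (\<Sum>\<^sub>\<infinity>i\<in>?C. ?h i)"
    unfolding cinner_def by (rule infsum_cong_neutral) (auto simp: cop_apply_C0[OF s f] split: if_splits)
  also have "\<dots> = (\<Sum>\<^sub>\<infinity>i\<in>(\<lambda>(t, y). (s \<otimes> t, y)) ` ?C. ?h i)"
  proof (rule arg_cong[of _ _ "infsum ?h"], intro equalityI subsetI)
    fix i assume "i \<in> ?C"
    then obtain t y where i: "i = (t, y)" "t \<in> carrier G" "y \<in> topspace Y" by blast
    then have "i = (\<lambda>(t, y). (s \<otimes> t, y)) (inv s \<otimes> t, y)" using s by (simp add: m_assoc[symmetric])
    then show "i \<in> (\<lambda>(t, y). (s \<otimes> t, y)) ` ?C" by (rule image_eqI) (use i s in auto)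
  qed (use s in auto)
  also have "\<dots> = (\<Sum>\<^sub>\<infinity>i\<in>?C. ?h ((\<lambda>(t, y). (s \<otimes> t, y)) i))"
    by (subst infsum_reindex) (use s in \<open>auto simp: inj_on_def o_def\<close>)
  also have "\<dots> = cinner (blinfun_apply (cop ?g (inv s)) x) z"
    unfolding cinner_def
  proof (rule infsum_cong_neutral)
    fix i assume "i \<in> UNIV - ?C"
    then show "cnj (ell2_apply (blinfun_apply (cop ?g (inv s)) x) i) * ell2_apply z i = 0"
      by (cases i) (auto simp only: cop_apply_C0[OF inv_closed[OF s] g] mem_Times_iff split: if_splits, auto)
  next
    fix i assume "i \<in> ?C \<inter> UNIV"
    then obtain t y where i: "i = (t, y)" "t \<in> carrier G" "y \<in> topspace Y" by blast
    then show "?h ((\<lambda>(t, y). (s \<otimes> t, y)) i) = cnj (ell2_apply (blinfun_apply (cop ?g (inv s)) x) i) * ell2_apply z i"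
      unfolding i(1) cop_apply_C0[OF inv_closed[OF s] g]
      using s by (simp add: translate_def act_mult m_assoc[symmetric])
  qed simp
  finally show "cinner (blinfun_apply (cop ?g (inv s)) x) z = cinner x (blinfun_apply (cop f s) z)" by simp
qed

text \<open>The coefficient at \<open>s\<close>, that is \<open>E(T \<lambda>\<^sub>s\<^sup>*)\<close> for the canonical conditional expectation \<open>E\<close> onto
  \<open>C\<^sub>0(Y)\<close>, read off as a matrix entry.\<close>

definition coefficient :: "'g \<Rightarrow> (('g \<times> 'y) ell2 \<Rightarrow>\<^sub>L ('g \<times> 'y) ell2) \<Rightarrow> 'y \<Rightarrow> complex" where
  "coefficient s T y = (if y \<in> topspace Y
     then ell2_apply (blinfun_apply T (finvec {(inv s, y)} (\<lambda>_. 1))) (\<one>, y) else 0)"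

lemma coefficient_add: "coefficient s (S + T) y = coefficient s S y + coefficient s T y"
  and coefficient_diff: "coefficient s (S - T) y = coefficient s S y - coefficient s T y"
  and coefficient_zero: "coefficient s 0 y = 0"
  by (simp_all add: coefficient_def blinfun.add_left blinfun.diff_left blinfun.scaleR_left
      plus_ell2.rep_eq minus_ell2.rep_eq scaleR_ell2.rep_eq zero_ell2.rep_eq)

lemma coefficient_sum: "coefficient s (\<Sum>k\<in>S. T k) y = (\<Sum>k\<in>S. coefficient s (T k) y)"
  by (induction S rule: infinite_finite_induct) (simp_all add: coefficient_zero coefficient_add)

text \<open>A coefficient value is a matrix entry at a unit vector. The bound is uniform in
  \<open>y\<close>, so norm limits of operators give uniform limits of coefficients.\<close>

lemma norm_coefficient_le: "cmod (coefficient s T y) \<le> norm T"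
proof -
  let ?v = "finvec {(inv s, y)} (\<lambda>_. 1)"
  have "(norm ?v)\<^sup>2 = 1" by (subst norm_finvec) auto
  then have "norm ?v = 1" by (metis norm_ge_zero one_power2 power2_eq_imp_eq zero_le_one)
  then have "norm (blinfun_apply T ?v) \<le> norm T" using norm_blinfun[of T ?v] by simp
  from order_trans[OF ell2_apply_le_norm this] show ?thesis by (simp add: coefficient_def)
qed

lemma coefficient_cop:
  assumes "s \<in> carrier G" "r \<in> carrier G" "f \<in> C0 Y"
  shows "coefficient s (cop f r) = (if r = s then f else (\<lambda>_. 0))"
proof
  fix y
  have "inv r = inv s \<longleftrightarrow> r = s" using assms by (metis inv_inv)
  then show "coefficient s (cop f r) y = (if r = s then f else (\<lambda>_. 0)) y"
    using assms C0_outside[OF assms(3), of y] by (simp add: coefficient_def cop_apply_C0 finvec_apply)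
qed

section \<open>Finite sums, that is, the algebraic crossed product, and its closure\<close>

definition finite_sums :: "('y \<Rightarrow> complex) set \<Rightarrow> (('g \<times> 'y) ell2 \<Rightarrow>\<^sub>L ('g \<times> 'y) ell2) set" where
  "finite_sums A = {\<Sum>s\<in>S. cop (F s) s | S F. finite S \<and> S \<subseteq> carrier G \<and> (\<forall>s. F s \<in> A)}"

abbreviation supp :: "(('g \<times> 'y) ell2 \<Rightarrow>\<^sub>L ('g \<times> 'y) ell2) \<Rightarrow> 'g set" where
  "supp T \<equiv> {s \<in> carrier G. coefficient s T \<noteq> (\<lambda>_. 0)}"

text \<open>The coefficients return the functions of any representation as a finite sum, so two sums
  can be compared over a common index set; this is why \<open>R\<close> may be any finite set
  containing the support.\<close>

lemma
  assumes T: "T \<in> finite_sums A" and A: "fun_cstar_algebra Y A"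
  shows finite_supp: "finite (supp T)"
    and finite_sums_coefficient: "s \<in> carrier G \<Longrightarrow> coefficient s T \<in> A"
    and finite_sums_expand: "finite R \<Longrightarrow> supp T \<subseteq> R \<Longrightarrow> R \<subseteq> carrier G \<Longrightarrow> T = (\<Sum>s\<in>R. cop (coefficient s T) s)"
proof -
  obtain S F where S: "finite S" "S \<subseteq> carrier G" and F: "\<And>s. F s \<in> A" and Teq: "T = (\<Sum>s\<in>S. cop (F s) s)"
    using T unfolding finite_sums_def by blast
  have co: "coefficient s T = (if s \<in> S then F s else (\<lambda>_. 0))" if s: "s \<in> carrier G" for s
  proof
    fix y
    have "coefficient s T y = (\<Sum>r\<in>S. if r = s then F s y else 0)"
      unfolding Teq coefficient_sum
    proof (rule sum.cong)
      fix r assume "r \<in> S"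
      then show "coefficient s (cop (F r) r) y = (if r = s then F s y else 0)"
        using coefficient_cop[OF s, of r "F r"] S(2) fca_C0[OF A F] by auto
    qed simp
    also have "\<dots> = (if s \<in> S then F s else (\<lambda>_. 0)) y" using S(1) by auto
    finally show "coefficient s T y = (if s \<in> S then F s else (\<lambda>_. 0)) y" .
  qed
  have sub: "supp T \<subseteq> S" using co by auto
  then show fin: "finite (supp T)" using S(1) finite_subset by blast
  show "s \<in> carrier G \<Longrightarrow> coefficient s T \<in> A" for s using co F fca_zero[OF A] by simp
  have "T = (\<Sum>s\<in>S. cop (coefficient s T) s)"
    unfolding Teq by (rule sum.cong) (use co S(2) in \<open>auto simp: Teq[symmetric]\<close>)
  also have "\<dots> = (\<Sum>s\<in>supp T. cop (coefficient s T) s)"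
    by (rule sum.mono_neutral_right) (use S sub cop_zero in \<open>auto simp: subset_iff\<close>)
  finally have T_supp: "T = (\<Sum>s\<in>supp T. cop (coefficient s T) s)" .
  assume R: "finite R" "supp T \<subseteq> R" "R \<subseteq> carrier G"
  have "(\<Sum>s\<in>supp T. cop (coefficient s T) s) = (\<Sum>s\<in>R. cop (coefficient s T) s)"
    by (rule sum.mono_neutral_left) (use R cop_zero in \<open>auto simp: subset_iff\<close>)
  with T_supp show "T = (\<Sum>s\<in>R. cop (coefficient s T) s)" by (rule trans)
qed

lemma finite_sumsI:
  assumes "finite S" "S \<subseteq> carrier G" "\<And>s. s \<in> S \<Longrightarrow> F s \<in> A" "fun_cstar_algebra Y A"
  shows "(\<Sum>s\<in>S. cop (F s) s) \<in> finite_sums A"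
proof -
  have "(\<Sum>s\<in>S. cop (F s) s) = (\<Sum>s\<in>S. cop (if s \<in> S then F s else (\<lambda>_. 0)) s)" by simp
  then show ?thesis unfolding finite_sums_def
    using assms(1-3) fca_zero[OF assms(4)]
    by (intro CollectI exI[of _ S] exI[of _ "\<lambda>s. if s \<in> S then F s else (\<lambda>_. 0)"]) auto
qed

lemma cop_in_finite_sums:
  assumes "s \<in> carrier G" "f \<in> A" "fun_cstar_algebra Y A"
  shows "cop f s \<in> finite_sums A"
  using finite_sumsI[of "{s}" "\<lambda>_. f" A] assms by simp

lemma finite_sums_add:
  assumes A: "fun_cstar_algebra Y A" and T: "T \<in> finite_sums A" and T': "T' \<in> finite_sums A"
  shows "T + T' \<in> finite_sums A"
proof -
  let ?S = "supp T \<union> supp T'"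
  have S: "finite ?S" "?S \<subseteq> carrier G" using finite_supp[OF T A] finite_supp[OF T' A] by auto
  have "T + T' = (\<Sum>s\<in>?S. cop (coefficient s T) s) + (\<Sum>s\<in>?S. cop (coefficient s T') s)"
    using finite_sums_expand[OF T A S(1) _ S(2)] finite_sums_expand[OF T' A S(1) _ S(2)] by simp
  also have "\<dots> = (\<Sum>s\<in>?S. cop (\<lambda>y. coefficient s T y + coefficient s T' y) s)"
    unfolding sum.distrib[symmetric]
    by (rule sum.cong)
       (auto intro!: cop_add[symmetric] fca_C0[OF A] finite_sums_coefficient[OF T A] finite_sums_coefficient[OF T' A])
  also have "\<dots> \<in> finite_sums A"
    by (rule finite_sumsI[OF S _ A])
       (auto intro!: fca_add[OF A] finite_sums_coefficient[OF T A] finite_sums_coefficient[OF T' A])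
  finally show ?thesis .
qed

lemma finite_sums_cscale:
  assumes A: "fun_cstar_algebra Y A" and T: "T \<in> finite_sums A"
  shows "cscale c T \<in> finite_sums A"
proof -
  obtain S F where S: "finite S" "S \<subseteq> carrier G" and F: "\<And>s. F s \<in> A" and Teq: "T = (\<Sum>s\<in>S. cop (F s) s)"
    using T unfolding finite_sums_def by blast
  have "cscale c T = (\<Sum>s\<in>S. cop (\<lambda>y. c * F s y) s)"
    unfolding Teq cscale_sum by (rule sum.cong) (use S F fca_C0[OF A F] in \<open>auto simp: cop_cscale\<close>)
  also have "\<dots> \<in> finite_sums A" by (rule finite_sumsI) (use S A F fca_scale[OF A] in auto)
  finally show ?thesis .
qed

lemma finite_sums_eq_span:
  assumes A: "fun_cstar_algebra Y A"
  shows "finite_sums A = span {cop f s | f s. f \<in> A \<and> s \<in> carrier G}"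
proof (intro equalityI)
  show "finite_sums A \<subseteq> span {cop f s | f s. f \<in> A \<and> s \<in> carrier G}"
  proof
    fix T assume "T \<in> finite_sums A"
    then obtain S F where "S \<subseteq> carrier G" "\<And>s. F s \<in> A" "T = (\<Sum>s\<in>S. cop (F s) s)"
      unfolding finite_sums_def by blast
    then show "T \<in> span {cop f s | f s. f \<in> A \<and> s \<in> carrier G}"
      by (simp only:, intro span_sum span_base) blast
  qed
  show "span {cop f s | f s. f \<in> A \<and> s \<in> carrier G} \<subseteq> finite_sums A"
  proof (rule span_minimal)
    show "{cop f s | f s. f \<in> A \<and> s \<in> carrier G} \<subseteq> finite_sums A"
      using cop_in_finite_sums[OF _ _ A] by blast
    have "0 \<in> finite_sums A" using finite_sumsI[of "{}" "\<lambda>_ _. 0" A] A by simp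
    then show "subspace (finite_sums A)"
      unfolding subspace_def
      using finite_sums_add[OF A] finite_sums_cscale[OF A, of _ "complex_of_real _"] cscale_of_real by metis
  qed
qed

lemma crossed_product_eq:
  "fun_cstar_algebra Y A \<Longrightarrow> cp A = closure (finite_sums A)"
  by (simp add: crossed_product_def finite_sums_eq_span)

lemma cop_in_crossed_product:
  "s \<in> carrier G \<Longrightarrow> f \<in> A \<Longrightarrow> cop f s \<in> cp A"
  unfolding crossed_product_def by (intro subsetD[OF closure_subset] span_base) blast

lemma crossed_product_mono: "A \<subseteq> B \<Longrightarrow> cp A \<subseteq> cp B"
  unfolding crossed_product_def by (intro closure_mono span_mono) blast

lemma finite_sums_sum:
  assumes A: "fun_cstar_algebra Y A" and "\<And>k. k \<in> S \<Longrightarrow> T k \<in> finite_sums A"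
  shows "(\<Sum>k\<in>S. T k) \<in> finite_sums A"
  using assms(2) unfolding finite_sums_eq_span[OF A] by (rule span_sum)

text \<open>Products and adjoints of terms translate their coefficient functions; invariance keeps
  these in \<open>A\<close>, so the finite sums form a *-algebra and its closure can be
  taken.\<close>

lemma crossed_product_op_cstar_algebra:
  assumes A: "fun_cstar_algebra Y A" and inv: "\<And>s f. s \<in> carrier G \<Longrightarrow> f \<in> A \<Longrightarrow> translate Y \<beta> s f \<in> A"
  shows "op_cstar_algebra (cp A)"
  unfolding crossed_product_eq[OF A]
proof (rule op_cstar_algebra_closure)
  show "0 \<in> finite_sums A" using finite_sumsI[of "{}" "\<lambda>_ _. 0" A] A by simp
  fix T U assume T: "T \<in> finite_sums A" and U: "U \<in> finite_sums A"
  show "T + U \<in> finite_sums A" by (rule finite_sums_add[OF A T U])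
  obtain S F where S: "finite S" "S \<subseteq> carrier G" and F: "\<And>s. F s \<in> A" and Teq: "T = (\<Sum>s\<in>S. cop (F s) s)"
    using T unfolding finite_sums_def by blast
  obtain R H where R: "finite R" "R \<subseteq> carrier G" and H: "\<And>s. H s \<in> A" and Ueq: "U = (\<Sum>s\<in>R. cop (H s) s)"
    using U unfolding finite_sums_def by blast
  have "T o\<^sub>L U = (\<Sum>s\<in>S. \<Sum>r\<in>R. cop (F s) s o\<^sub>L cop (H r) r)"
    unfolding Teq Ueq
    by (simp only: bounded_bilinear.sum_left[OF bounded_bilinear_blinfun_compose]
          bounded_bilinear.sum_right[OF bounded_bilinear_blinfun_compose] sum.swap[of _ R S])
  also have "\<dots> \<in> finite_sums A"
  proof (intro finite_sums_sum[OF A])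
    fix s r assume sr: "s \<in> S" "r \<in> R"
    then have "cop (F s) s o\<^sub>L cop (H r) r = cop (\<lambda>y. F s y * translate Y \<beta> (inv s) (H r) y) (s \<otimes> r)"
      using S R fca_C0[OF A] F H by (intro cop_compose) auto
    also have "\<dots> \<in> finite_sums A"
      using sr S R F H inv fca_mult[OF A] by (intro cop_in_finite_sums A) auto
    finally show "cop (F s) s o\<^sub>L cop (H r) r \<in> finite_sums A" .
  qed
  finally show "T o\<^sub>L U \<in> finite_sums A" .
next
  fix c T assume "T \<in> finite_sums A"
  then show "cscale c T \<in> finite_sums A" by (rule finite_sums_cscale[OF A])
next
  fix T assume T: "T \<in> finite_sums A"
  obtain S F where S: "finite S" "S \<subseteq> carrier G" and F: "\<And>s. F s \<in> A" and Teq: "T = (\<Sum>s\<in>S. cop (F s) s)"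
    using T unfolding finite_sums_def by blast
  let ?g = "\<lambda>s. translate Y \<beta> s (\<lambda>y. cnj (F s y))"
  have "is_adjoint (\<Sum>s\<in>S. cop (?g s) (inv s)) T"
    unfolding Teq using S
  proof (induction S rule: finite_induct)
    case empty then show ?case by (simp add: adjoint_zero)
  next
    case (insert s S)
    then show ?case using cop_adjoint[of s "F s"] fca_C0[OF A F] by (auto intro: adjoint_add)
  qed
  moreover have "(\<Sum>s\<in>S. cop (?g s) (inv s)) \<in> finite_sums A"
    using S F by (intro finite_sums_sum[OF A] cop_in_finite_sums A inv fca_cnj[OF A]) auto
  ultimately show "\<exists>S\<in>finite_sums A. is_adjoint S T" by blast
qed

text \<open>Coefficients of approximating finite sums lie in \<open>A\<close> and converge
  uniformly.\<close>

lemma coefficient_limit: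
  assumes A: "fun_cstar_algebra Y A" and T: "T \<in> cp A" and s: "s \<in> carrier G"
  shows "coefficient s T \<in> A"
proof -
  have approx: "\<exists>g\<in>A. \<forall>y\<in>topspace Y. cmod (coefficient s T y - g y) \<le> e" if "0 < e" for e
  proof -
    have "T \<in> closure (finite_sums A)" using T by (simp add: crossed_product_eq[OF A])
    then obtain U where U: "U \<in> finite_sums A" "dist U T < e"
      using \<open>0 < e\<close> closure_approachable by blast
    then have "coefficient s U \<in> A" by (intro finite_sums_coefficient[OF _ A s])
    moreover have "cmod (coefficient s T y - coefficient s U y) \<le> e" for y
      using norm_coefficient_le[of s "T - U" y] U(2)
      by (simp add: coefficient_diff dist_norm norm_minus_commute)
    ultimately show ?thesis by blast
  qed
  have "coefficient s T \<in> C0 Y"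
  proof (rule C0_uniform_limit)
    fix e :: real assume "0 < e"
    then show "\<exists>g\<in>C0 Y. \<forall>y\<in>topspace Y. cmod (coefficient s T y - g y) \<le> e"
      using approx fca_C0[OF A] by blast
  qed (simp add: coefficient_def)
  then show ?thesis using approx by (rule fca_limit[OF A])
qed

text \<open>The coefficient at \<open>s\<close> recovers \<open>f\<close>, so an algebra can be read
  off from its crossed product.\<close>

lemma cop_in_crossed_product_iff:
  assumes A: "fun_cstar_algebra Y A" and f: "f \<in> C0 Y" and s: "s \<in> carrier G"
  shows "cop f s \<in> cp A \<longleftrightarrow> f \<in> A"
  using coefficient_limit[OF A _ s, of "cop f s"] coefficient_cop[OF s s f] cop_in_crossed_product[OF s] by auto

end

section \<open>Averaging over a partition of unity\<close>

text \<open>For a single s, disjoint neighbourhoods V of x and W of \<beta>(s)x give the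
  neighbourhood of those points of V that \<beta>(s) sends into W. Finiteness of \<open>S\<close>
  allows the intersection over all s.\<close>

lemma (in G_space) displaced_neighbourhood:
  assumes h: "Hausdorff_space Y" and S: "finite S" "S \<subseteq> carrier G"
    and move: "\<forall>s\<in>S. \<forall>y\<in>topspace Y. \<beta> s y \<noteq> y" and x: "x \<in> topspace Y"
  obtains U where "openin Y U" "x \<in> U" "\<And>s y. s \<in> S \<Longrightarrow> y \<in> U \<Longrightarrow> \<beta> s y \<notin> U"
proof -
  have ex: "\<exists>U. openin Y U \<and> x \<in> U \<and> (\<forall>y\<in>U. \<beta> s y \<notin> U)" if "s \<in> S" for s
  proof -
    have s: "s \<in> carrier G" using that S by blast
    have "\<beta> s x \<noteq> x" using move that x by blast
    then have "x \<in> topspace Y \<and> \<beta> s x \<in> topspace Y \<and> x \<noteq> \<beta> s x" using x s by simp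
    from h[unfolded Hausdorff_space_def, rule_format, OF this]
    obtain V W where VW: "openin Y V" "openin Y W" "x \<in> V" "\<beta> s x \<in> W" "disjnt V W"
      by (elim exE conjE)
    have "openin Y {y \<in> topspace Y. \<beta> s y \<in> W}"
      by (rule openin_continuous_map_preimage[OF act_continuous[OF s] VW(2)])
    then have "openin Y (V \<inter> {y \<in> topspace Y. \<beta> s y \<in> W})" using VW(1) by blast
    moreover have "x \<in> V \<inter> {y \<in> topspace Y. \<beta> s y \<in> W}" using VW x by simp
    moreover have "\<forall>y \<in> V \<inter> {y \<in> topspace Y. \<beta> s y \<in> W}. \<beta> s y \<notin> V \<inter> {y \<in> topspace Y. \<beta> s y \<in> W}"
      using VW(5) by (auto simp: disjnt_iff)
    ultimately show ?thesis by blast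
  qed
  from bchoice[OF ballI[OF this]] obtain U where
    "\<forall>s\<in>S. openin Y (U s) \<and> x \<in> U s \<and> (\<forall>y\<in>U s. \<beta> s y \<notin> U s)" by (rule exE)
  then have U: "\<And>s. s \<in> S \<Longrightarrow> openin Y (U s)" "\<And>s. s \<in> S \<Longrightarrow> x \<in> U s"
    "\<And>s y. s \<in> S \<Longrightarrow> y \<in> U s \<Longrightarrow> \<beta> s y \<notin> U s" by blast+
  \<comment> \<open>The factor \<open>topspace Y\<close> matters for empty \<open>S\<close>, where
    the intersection over the family is the whole type.\<close>
  let ?U = "topspace Y \<inter> \<Inter>(U ` S)"
  show thesis
  proof
    show "openin Y ?U" by (rule openin_Int_Inter) (use S U in auto)
    show "x \<in> ?U" using x U by blast
    show "\<beta> s y \<notin> ?U" if "s \<in> S" "y \<in> ?U" for s y using U(3)[of s y] that by blast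
  qed
qed

text \<open>Bumps supported in displaced neighbourhoods cover \<open>K\<close>. Squares are summed
  because each function will stand on both sides of an operator. For empty \<open>S\<close> this is
  an ordinary partition of unity.\<close>

lemma (in G_space) displaced_partition:
  assumes lc: "locally_compact_space Y" and h: "Hausdorff_space Y" and S: "finite S" "S \<subseteq> carrier G"
    and move: "\<forall>s\<in>S. \<forall>y\<in>topspace Y. \<beta> s y \<noteq> y" and K: "compactin Y K"
  obtains I and h :: "'y \<Rightarrow> 'y \<Rightarrow> real"
  where "finite I" "\<And>i. i \<in> I \<Longrightarrow> (\<lambda>y. complex_of_real (h i y)) \<in> C0 Y"
    "\<And>y. (\<Sum>i\<in>I. (h i y)\<^sup>2) \<le> 1" "\<And>y. y \<in> K \<Longrightarrow> (\<Sum>i\<in>I. (h i y)\<^sup>2) = 1"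
    "\<And>i s y. i \<in> I \<Longrightarrow> s \<in> S \<Longrightarrow> y \<in> topspace Y \<Longrightarrow> h i y * h i (\<beta> s y) = 0"
proof -
  have K_sub: "K \<subseteq> topspace Y" by (rule compactin_subset_topspace[OF K])
  have "\<exists>u :: 'y \<Rightarrow> real. (\<lambda>y. complex_of_real (u y)) \<in> C0 Y \<and> continuous_map Y euclideanreal u \<and>
      (\<forall>y. 0 \<le> u y) \<and> u x = 1 \<and> (\<forall>s\<in>S. \<forall>y\<in>topspace Y. u y * u (\<beta> s y) = 0)"
    if x: "x \<in> topspace Y" for x
  proof -
    obtain U where U: "openin Y U" "x \<in> U" "\<And>s y. s \<in> S \<Longrightarrow> y \<in> U \<Longrightarrow> \<beta> s y \<notin> U"
      by (rule displaced_neighbourhood[OF h S move x]) (rule that)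
    show ?thesis
    proof (rule C0_bump[OF lc h U(1,2)])
      fix u :: "'y \<Rightarrow> real"
      assume u: "(\<lambda>x. complex_of_real (u x)) \<in> C0 Y" "continuous_map Y euclideanreal u"
        "\<And>x. 0 \<le> u x" "u x = 1" "\<And>y. y \<notin> U \<Longrightarrow> u y = 0"
      have "u y * u (\<beta> s y) = 0" if "s \<in> S" for s y
        using U(3)[OF that, of y] u(5) by (cases "y \<in> U") auto
      then show ?thesis using u by blast
    qed
  qed
  from bchoice[OF ballI[OF this]] obtain u :: "'y \<Rightarrow> 'y \<Rightarrow> real" where
    u: "\<forall>x\<in>topspace Y. (\<lambda>y. complex_of_real (u x y)) \<in> C0 Y \<and> continuous_map Y euclideanreal (u x) \<and>
      (\<forall>y. 0 \<le> u x y) \<and> u x x = 1 \<and> (\<forall>s\<in>S. \<forall>y\<in>topspace Y. u x y * u x (\<beta> s y) = 0)" by (rule exE)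
  have uC: "\<And>x. x \<in> topspace Y \<Longrightarrow> (\<lambda>y. complex_of_real (u x y)) \<in> C0 Y"
    and uc: "\<And>x. x \<in> topspace Y \<Longrightarrow> continuous_map Y euclideanreal (u x)"
    and u0: "\<And>x y. x \<in> topspace Y \<Longrightarrow> 0 \<le> u x y" and u1: "\<And>x. x \<in> topspace Y \<Longrightarrow> u x x = 1"
    and us: "\<And>x s y. x \<in> topspace Y \<Longrightarrow> s \<in> S \<Longrightarrow> y \<in> topspace Y \<Longrightarrow> u x y * u x (\<beta> s y) = 0"
    using u by blast+
  define W where "W x = {y \<in> topspace Y. u x y \<in> {1/2<..}}" for x
  have Wo: "openin Y (W x)" if "x \<in> topspace Y" for x
    unfolding W_def by (rule openin_continuous_map_preimage[OF uc[OF that]]) simp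
  have "K \<subseteq> \<Union>(W ` K)" using K_sub u1 by (force simp: W_def)
  then obtain \<F> where F: "finite \<F>" "\<F> \<subseteq> W ` K" "K \<subseteq> \<Union>\<F>"
    using compactinD[OF K, of "W ` K"] Wo K_sub by blast
  then obtain I where I: "finite I" "I \<subseteq> K" "\<F> = W ` I"
    using finite_subset_image[OF F(1,2)] by blast
  have IY: "x \<in> topspace Y" if "x \<in> I" for x using I(2) K_sub that by blast
  define v where "v y = (\<Sum>i\<in>I. u i y)" for y
  \<comment> \<open>The denominator never falls below 1/2, which keeps \<open>h\<close> continuous
    everywhere. On \<open>K\<close> some bump exceeds 1/2, so there the denominator is
    \<open>v\<close> itself and the squares sum to 1.\<close>
  define h where "h i y = sqrt (u i y / max (v y) (1/2))" for i y
  have vc: "continuous_map Y euclideanreal v"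
    unfolding v_def by (intro continuous_map_sum I uc IY)
  have pos: "0 < max (v y) (1/2)" for y by simp
  have h2: "(h i y)\<^sup>2 = u i y / max (v y) (1/2)" if "i \<in> I" for i y
    unfolding h_def by (rule real_sqrt_pow2) (intro divide_nonneg_pos u0 IY that pos)
  have sum_h: "(\<Sum>i\<in>I. (h i y)\<^sup>2) = v y / max (v y) (1/2)" for y
  proof -
    have "(\<Sum>i\<in>I. (h i y)\<^sup>2) = (\<Sum>i\<in>I. u i y / max (v y) (1/2))" by (rule sum.cong) (auto simp: h2)
    then show ?thesis by (simp add: v_def sum_divide_distrib)
  qed
  show thesis
  proof
    show "finite I" by (rule I)
    show "(\<Sum>i\<in>I. (h i y)\<^sup>2) \<le> 1" for y
      unfolding sum_h using pos[of y] by (simp add: pos_divide_le_eq)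
    show "(\<Sum>i\<in>I. (h i y)\<^sup>2) = 1" if y: "y \<in> K" for y
    proof -
      obtain i where i: "i \<in> I" "y \<in> W i" using F(3) I(3) y by blast
      have "u i y \<le> v y" unfolding v_def by (rule member_le_sum[OF i(1)]) (use I u0 IY in auto)
      then have "1/2 < v y" using i(2) by (simp add: W_def)
      then show ?thesis unfolding sum_h by (simp add: max_def)
    qed
    show "h i y * h i (\<beta> s y) = 0" if "i \<in> I" "s \<in> S" "y \<in> topspace Y" for i s y
      using us[OF IY[OF that(1)] that(2,3)] by (auto simp: h_def)
    show "(\<lambda>y. complex_of_real (h i y)) \<in> C0 Y" if i: "i \<in> I" for i
    proof (rule C0I)
      have "continuous_map Y (prod_topology euclideanreal euclideanreal) (\<lambda>y. (u i y, v y))"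
        using uc[OF IY[OF i]] vc by (intro continuous_map_pairedI)
      then have "continuous_map Y euclidean ((\<lambda>(a, b). complex_of_real (sqrt (a / max b (1/2)))) \<circ> (\<lambda>y. (u i y, v y)))"
      proof (rule continuous_map_compose)
        have "continuous_on UNIV (\<lambda>z::real \<times> real. complex_of_real (sqrt (fst z / max (snd z) (1/2))))"
        proof (intro continuous_intros ballI)
          fix z :: "real \<times> real" show "max (snd z) (1/2) \<noteq> 0" by (simp add: max_def)
        qed
        then show "continuous_map (prod_topology euclideanreal euclideanreal) euclidean
            (\<lambda>(a, b). complex_of_real (sqrt (a / max b (1/2))))"
          by (simp add: case_prod_unfold)
      qed
      then show "continuous_map Y euclidean (\<lambda>y. complex_of_real (h i y))"
        by (simp add: o_def h_def)
      fix e :: real assume e: "0 < e"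
      \<comment> \<open>The denominator is at least 1/2, so the square of \<open>h i\<close> is at
        most twice \<open>u i\<close>.\<close>
      have "e\<^sup>2/2 \<le> cmod (complex_of_real (u i y))" if "e \<le> cmod (complex_of_real (h i y))" for y
      proof -
        have "e\<^sup>2 \<le> \<bar>h i y\<bar>\<^sup>2" using that e by (intro power_mono) auto
        also have "\<dots> = u i y / max (v y) (1/2)" using h2[OF i] by simp
        also have "\<dots> \<le> u i y / (1/2)" by (rule divide_left_mono) (use u0[OF IY[OF i]] pos in auto)
        finally show ?thesis by simp
      qed
      then show "\<exists>K. compactin Y K \<and> {y \<in> topspace Y. e \<le> cmod (complex_of_real (h i y))} \<subseteq> K"
        using C0_compact[OF uC[OF IY[OF i]], of "e\<^sup>2/2"] e
        by (intro exI[of _ "{y \<in> topspace Y. e\<^sup>2/2 \<le> cmod (complex_of_real (u i y))}"]) auto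
    next
      fix y assume "y \<notin> topspace Y"
      then have "complex_of_real (u i y) = 0" using C0_outside[OF uC[OF IY[OF i]]] by blast
      then show "complex_of_real (h i y) = 0" by (simp add: h_def)
    qed
  qed
qed

context G_space
begin

lemma translate_one: "f \<in> C0 Y \<Longrightarrow> translate Y \<beta> \<one> f = f"
  by (rule ext) (simp add: translate_def C0_outside)

lemma cop_sum:
  assumes s: "s \<in> carrier G" and I: "finite I" and F: "\<And>i. i \<in> I \<Longrightarrow> F i \<in> C0 Y"
  shows "(\<lambda>y. \<Sum>i\<in>I. F i y) \<in> C0 Y" "cop (\<lambda>y. \<Sum>i\<in>I. F i y) s = (\<Sum>i\<in>I. cop (F i) s)"
proof -
  have "(\<lambda>y. \<Sum>i\<in>I. F i y) \<in> C0 Y \<and> cop (\<lambda>y. \<Sum>i\<in>I. F i y) s = (\<Sum>i\<in>I. cop (F i) s)"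
    using I F
  proof (induction I rule: finite_induct)
    case empty
    then show ?case using cop_zero[OF s] fca_zero[OF C0_algebra] by simp
  next
    case (insert i I)
    then have Fi: "F i \<in> C0 Y" and FI: "(\<lambda>y. \<Sum>i\<in>I. F i y) \<in> C0 Y"
      "cop (\<lambda>y. \<Sum>i\<in>I. F i y) s = (\<Sum>i\<in>I. cop (F i) s)" by auto
    show ?case
      using fca_add[OF C0_algebra Fi FI(1)] cop_add[OF s Fi FI(1)] FI(2) insert(1,2) by simp
  qed
  then show "(\<lambda>y. \<Sum>i\<in>I. F i y) \<in> C0 Y" "cop (\<lambda>y. \<Sum>i\<in>I. F i y) s = (\<Sum>i\<in>I. cop (F i) s)" by auto
qed

lemma cop_sandwich:
  assumes r: "r \<in> carrier G" and h: "h \<in> C0 Y" and f: "f \<in> C0 Y" and k: "k \<in> C0 Y"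
  shows "cop h \<one> o\<^sub>L cop f r o\<^sub>L cop k \<one> = cop (\<lambda>y. h y * f y * translate Y \<beta> (inv r) k y) r"
proof -
  have "cop h \<one> o\<^sub>L cop f r = cop (\<lambda>y. h y * f y) r"
    using cop_compose[OF one_closed r h f] translate_one[OF f] r by simp
  then show ?thesis
    using cop_compose[OF r one_closed fca_mult[OF C0_algebra h f] k] r by simp
qed

text \<open>The column of multiplications by the real functions h_i is a contraction, since the sum
  of their squares is multiplication by a function with values in [0,1].\<close>

lemma norm_row_le:
  assumes I: "finite I" and h: "\<And>i. i \<in> I \<Longrightarrow> (\<lambda>y. complex_of_real (h i y)) \<in> C0 Y"
    and le: "\<And>y. y \<in> topspace Y \<Longrightarrow> (\<Sum>i\<in>I. (h i y)\<^sup>2) \<le> 1"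
  shows "(\<Sum>i\<in>I. (norm (blinfun_apply (cop (\<lambda>y. complex_of_real (h i y)) \<one>) x))\<^sup>2) \<le> (norm x)\<^sup>2"
proof -
  let ?H = "\<lambda>i. cop (\<lambda>y. complex_of_real (h i y)) \<one>"
  have "(norm (blinfun_apply (?H i) x))\<^sup>2 = inner x (blinfun_apply (cop (\<lambda>y. complex_of_real ((h i y)\<^sup>2)) \<one>) x)"
    if i: "i \<in> I" for i
  proof -
    have adj: "is_adjoint (?H i) (?H i)"
      using cop_adjoint[OF one_closed h[OF i]] translate_one[OF h[OF i]] by simp
    have HH: "?H i o\<^sub>L ?H i = cop (\<lambda>y. complex_of_real ((h i y)\<^sup>2)) \<one>"
      using cop_compose[OF one_closed one_closed h[OF i] h[OF i]] translate_one[OF h[OF i]]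
      by (simp add: power2_eq_square)
    show ?thesis
      unfolding power2_norm_eq_inner adjoint_inner[OF adj] HH[symmetric] blinfun_apply_blinfun_compose ..
  qed
  then have "(\<Sum>i\<in>I. (norm (blinfun_apply (?H i) x))\<^sup>2) =
      inner x (blinfun_apply (\<Sum>i\<in>I. cop (\<lambda>y. complex_of_real ((h i y)\<^sup>2)) \<one>) x)"
    unfolding blinfun_apply_sum inner_sum_right by (intro sum.cong) simp_all
  also have "(\<Sum>i\<in>I. cop (\<lambda>y. complex_of_real ((h i y)\<^sup>2)) \<one>) = cop (\<lambda>y. \<Sum>i\<in>I. complex_of_real ((h i y)\<^sup>2)) \<one>"
  proof (rule cop_sum(2)[OF one_closed I, symmetric])
    fix i assume "i \<in> I"
    then show "(\<lambda>y. complex_of_real ((h i y)\<^sup>2)) \<in> C0 Y"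
      using fca_mult[OF C0_algebra h h, of i i] by (simp add: power2_eq_square)
  qed
  also have "inner x (blinfun_apply (cop (\<lambda>y. \<Sum>i\<in>I. complex_of_real ((h i y)\<^sup>2)) \<one>) x) \<le> norm x * (1 * norm x)"
  proof -
    have "norm (cop (\<lambda>y. \<Sum>i\<in>I. complex_of_real ((h i y)\<^sup>2)) \<one>) \<le> 1"
    proof (rule norm_cop_le[OF one_closed])
      fix y assume "y \<in> topspace Y"
      moreover have "0 \<le> (\<Sum>i\<in>I. (h i y)\<^sup>2)" by (intro sum_nonneg) simp
      ultimately show "cmod (\<Sum>i\<in>I. complex_of_real ((h i y)\<^sup>2)) \<le> 1"
        using le[of y] unfolding of_real_sum[symmetric] norm_of_real by simp
    qed simp
    from order_trans[OF norm_blinfun mult_right_mono[OF this norm_ge_zero]]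
    have "norm (blinfun_apply (cop (\<lambda>y. \<Sum>i\<in>I. complex_of_real ((h i y)\<^sup>2)) \<one>) x) \<le> 1 * norm x" .
    from order_trans[OF norm_cauchy_schwarz mult_left_mono[OF this norm_ge_zero]] show ?thesis .
  qed
  finally show ?thesis by (simp add: power2_eq_square)
qed

text \<open>The average is a row contraction times copies of T on the diagonal times a column
  contraction, written out with two Cauchy--Schwarz estimates. The bound is independent of the size
  of \<open>I\<close>.\<close>

lemma norm_average_le:
  assumes I: "finite I"
    and h: "\<And>i. i \<in> I \<Longrightarrow> (\<lambda>y. complex_of_real (h i y)) \<in> C0 Y" "\<And>y. y \<in> topspace Y \<Longrightarrow> (\<Sum>i\<in>I. (h i y)\<^sup>2) \<le> 1"
    and k: "\<And>i. i \<in> I \<Longrightarrow> (\<lambda>y. complex_of_real (k i y)) \<in> C0 Y" "\<And>y. y \<in> topspace Y \<Longrightarrow> (\<Sum>i\<in>I. (k i y)\<^sup>2) \<le> 1"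
  shows "norm (\<Sum>i\<in>I. cop (\<lambda>y. complex_of_real (h i y)) \<one> o\<^sub>L T o\<^sub>L cop (\<lambda>y. complex_of_real (k i y)) \<one>) \<le> norm T"
    (is "norm (\<Sum>i\<in>I. ?H i o\<^sub>L T o\<^sub>L ?K i) \<le> _")
proof (rule norm_blinfun_bound)
  fix x
  define v where "v = blinfun_apply (\<Sum>i\<in>I. ?H i o\<^sub>L T o\<^sub>L ?K i) x"
  have adj: "is_adjoint (?H i) (?H i)" if i: "i \<in> I" for i
    using cop_adjoint[OF one_closed h(1)[OF i]] translate_one[OF h(1)[OF i]] by simp
  have row: "L2_set (\<lambda>i. norm (blinfun_apply (?H i) z)) I \<le> norm z" for z
    unfolding L2_set_def using norm_row_le[OF I h, of z] by (intro real_le_lsqrt) (auto intro: sum_nonneg)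
  have col: "L2_set (\<lambda>i. norm (blinfun_apply (?K i) z)) I \<le> norm z" for z
    unfolding L2_set_def using norm_row_le[OF I k, of z] by (intro real_le_lsqrt) (auto intro: sum_nonneg)
  have "norm v * norm v = inner v (\<Sum>i\<in>I. blinfun_apply (?H i) (blinfun_apply T (blinfun_apply (?K i) x)))"
    unfolding v_def blinfun_apply_sum blinfun_apply_blinfun_compose
    by (simp add: power2_norm_eq_inner flip: power2_eq_square)
  also have "\<dots> = (\<Sum>i\<in>I. inner (blinfun_apply (?H i) v) (blinfun_apply T (blinfun_apply (?K i) x)))"
    unfolding inner_sum_right by (rule sum.cong) (simp_all add: adjoint_inner[OF adj])
  also have "\<dots> \<le> (\<Sum>i\<in>I. norm T * (norm (blinfun_apply (?H i) v) * norm (blinfun_apply (?K i) x)))"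
  proof (rule sum_mono)
    fix i assume "i \<in> I"
    have "inner (blinfun_apply (?H i) v) (blinfun_apply T (blinfun_apply (?K i) x))
        \<le> norm (blinfun_apply (?H i) v) * norm (blinfun_apply T (blinfun_apply (?K i) x))"
      by (rule norm_cauchy_schwarz)
    also have "\<dots> \<le> norm (blinfun_apply (?H i) v) * (norm T * norm (blinfun_apply (?K i) x))"
      by (intro mult_left_mono norm_blinfun) simp
    finally show "inner (blinfun_apply (?H i) v) (blinfun_apply T (blinfun_apply (?K i) x))
      \<le> norm T * (norm (blinfun_apply (?H i) v) * norm (blinfun_apply (?K i) x))" by (simp only: mult.left_commute)
  qed
  also have "\<dots> = norm T * (\<Sum>i\<in>I. \<bar>norm (blinfun_apply (?H i) v)\<bar> * \<bar>norm (blinfun_apply (?K i) x)\<bar>)"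
    by (simp add: sum_distrib_left)
  also have "\<dots> \<le> norm T * (L2_set (\<lambda>i. norm (blinfun_apply (?H i) v)) I * L2_set (\<lambda>i. norm (blinfun_apply (?K i) x)) I)"
    by (intro mult_left_mono L2_set_mult_ineq) simp
  also have "\<dots> \<le> norm T * (norm v * norm x)"
    by (intro mult_left_mono mult_mono row col) (auto simp: L2_set_nonneg)
  finally have "norm v * norm v \<le> (norm T * norm x) * norm v" by (simp only: ac_simps)
  then have "norm v \<le> norm T * norm x"
    by (cases "norm v = 0") (auto simp: mult_le_cancel_right)
  then show "norm (blinfun_apply (\<Sum>i\<in>I. ?H i o\<^sub>L T o\<^sub>L ?K i) x) \<le> norm T * norm x" by (simp only: v_def)
qed simp

end

section \<open>Fourier terms of elements of an intermediate algebra\<close>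

context proper_factor
begin

lemma translate_C0_via:
  assumes "s \<in> carrier G" "f \<in> C0_via Y \<pi> X"
  shows "translate Y \<beta> s f \<in> C0_via Y \<pi> X"
  using assms(2) unfolding C0_via_\<pi>
  by (rule Y.translate_C0_fibres[OF assms(1)]) (simp add: equivariant assms(1))

text \<open>Sandwiching \<open>T\<close> between the functions of the partition kills every coefficient of an
  approximating finite sum except the one at \<open>s\<close>.\<close>

lemma coefficient_in_intermediate_algebra:
  assumes D: "op_cstar_algebra D" and sub: "Y.cp (C0_via Y \<pi> X) \<subseteq> D"
    and free: "free_action G X \<alpha>" and T: "T \<in> D" "T \<in> Y.cp (C0 Y)"
    and s: "s \<in> carrier G"
  shows "Y.cop (Y.coefficient s T) s \<in> D"
proof -
  note CY = C0_algebra[of Y]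
  have "Y.cop (Y.coefficient s T) s \<in> closure D"
    unfolding closure_approachable
  proof (intro allI impI)
    fix e :: real assume e: "0 < e"
    have "T \<in> closure (Y.finite_sums (C0 Y))" using T(2) by (simp only: Y.crossed_product_eq[OF CY])
    then obtain T0 where T0: "T0 \<in> Y.finite_sums (C0 Y)" "dist T0 T < e/4"
      using closure_approachable[of T "Y.finite_sums (C0 Y)"] e by (meson divide_pos_pos zero_less_numeral)
    define R where "R = Y.supp T0"
    have R: "finite R" "R \<subseteq> carrier G" "T0 = (\<Sum>r\<in>R. Y.cop (Y.coefficient r T0) r)"
      using Y.finite_supp[OF T0(1) CY] Y.finite_sums_expand[OF T0(1) CY] by (auto simp only: R_def)
    note C = Y.finite_sums_coefficient[OF T0(1) CY]
    have zero: "Y.coefficient r T0 = (\<lambda>_. 0)" if "r \<in> carrier G" "r \<notin> R" for r using that by (auto simp: R_def)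
    \<comment> \<open>Moving the right-hand function past \<lambda>(r) leaves a translate by s
      r^(-1), so these are the elements whose displacement kills the coefficients at r other than
      s.\<close>
    let ?S = "(\<lambda>r. s \<otimes> inv r) ` (R - {s})" and ?f = "Y.coefficient s T0"
    have f: "?f \<in> C0 Y" by (rule C[OF s])
    have one: "\<one> \<notin> ?S"
    proof
      assume "\<one> \<in> ?S"
      then obtain r where r: "r \<in> R" "r \<noteq> s" "\<one> = s \<otimes> inv r" by auto
      then have "r \<in> carrier G" using R(2) by blast
      then have "s = r" using X.inv_equality[of s "inv r"] r(3) s by simp
      then show False using r by simp
    qed
    have SG: "?S \<subseteq> carrier G" using R(2) s by auto
    have move: "\<forall>r\<in>?S. \<forall>x\<in>topspace X. \<alpha> r x \<noteq> x"
    proof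
      fix r assume r: "r \<in> ?S"
      have "r \<in> carrier G" by (rule subsetD[OF SG r])
      moreover have "r \<noteq> \<one>" using r one by metis
      ultimately show "\<forall>x\<in>topspace X. \<alpha> r x \<noteq> x" using free unfolding free_action_def by (elim ballE[of _ _ r] impE) auto
    qed
    \<comment> \<open>Here the squares are to sum to 1. Off this set the coefficient is below e/4
      and the weights lie in [0,1], so their values there do not matter.\<close>
    have K: "compactin X (\<pi> ` {y \<in> topspace Y. e/4 \<le> cmod (?f y)})"
      using e by (intro image_compactin[OF C0_compact[OF f] quotient_imp_continuous_map[OF quot]]) simp
    obtain I and h :: "'x \<Rightarrow> 'x \<Rightarrow> real" where I: "finite I"
      and hC: "\<And>i. i \<in> I \<Longrightarrow> (\<lambda>x. complex_of_real (h i x)) \<in> C0 X"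
      and h_le: "\<And>x. (\<Sum>i\<in>I. (h i x)\<^sup>2) \<le> 1"
      and h_eq: "\<And>x. x \<in> \<pi> ` {y \<in> topspace Y. e/4 \<le> cmod (?f y)} \<Longrightarrow> (\<Sum>i\<in>I. (h i x)\<^sup>2) = 1"
      and h_orth: "\<And>i r x. i \<in> I \<Longrightarrow> r \<in> ?S \<Longrightarrow> x \<in> topspace X \<Longrightarrow> h i x * h i (\<alpha> r x) = 0"
      by (rule X.displaced_partition[OF lcX hX finite_imageI[OF finite_Diff[OF R(1)]] SG move K]) (rule that)
    define hY where "hY i y = (if y \<in> topspace Y then h i (\<pi> y) else 0)" for i y
    \<comment> \<open>The right-hand functions are translated by \<open>s\<close> in advance, so
      that passing \<lambda>(s) turns them back into the left-hand ones.\<close>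
    define kY where "kY i y = (if y \<in> topspace Y then h i (\<pi> (\<beta> s y)) else 0)" for i y
    have hv: "(\<lambda>y. complex_of_real (hY i y)) \<in> C0_via Y \<pi> X" if "i \<in> I" for i
      unfolding C0_via_def
      by (intro CollectI exI[of _ "\<lambda>x. complex_of_real (h i x)"] conjI hC that) (auto simp: hY_def)
    have kt: "(\<lambda>y. complex_of_real (kY i y)) = translate Y \<beta> s (\<lambda>y. complex_of_real (hY i y))" for i
      using s by (auto simp: kY_def hY_def translate_def)
    have kv: "(\<lambda>y. complex_of_real (kY i y)) \<in> C0_via Y \<pi> X" if "i \<in> I" for i
      unfolding kt by (rule translate_C0_via[OF s hv[OF that]])
    have viaC: "g \<in> C0 Y" if "g \<in> C0_via Y \<pi> X" for g
      using that C0_fibresD1 by (simp only: C0_via_\<pi>)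
    note hC0 = viaC[OF hv] and kC0 = viaC[OF kv]
    have h_le': "(\<Sum>i\<in>I. (hY i y)\<^sup>2) \<le> 1" and k_le': "(\<Sum>i\<in>I. (kY i y)\<^sup>2) \<le> 1" for y
      using h_le by (cases "y \<in> topspace Y"; simp add: hY_def kY_def)+
    let ?H = "\<lambda>i. Y.cop (\<lambda>y. complex_of_real (hY i y)) \<one>" and ?K = "\<lambda>i. Y.cop (\<lambda>y. complex_of_real (kY i y)) \<one>"
    let ?av = "\<lambda>T. \<Sum>i\<in>I. ?H i o\<^sub>L T o\<^sub>L ?K i"
    have "?av T \<in> D"
      using subsetD[OF sub Y.cop_in_crossed_product[OF X.one_closed hv]]
        subsetD[OF sub Y.cop_in_crossed_product[OF X.one_closed kv]] T(1)
      by (intro oca_sum[OF D] oca_compose[OF D])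
    moreover have "dist (?av T) (Y.cop (Y.coefficient s T) s) < e"
    proof -
      have n1: "norm (?av (T - T0)) \<le> norm (T - T0)"
        by (rule Y.norm_average_le[OF I hC0 h_le' kC0 k_le'])
      have av_diff: "?av (T - T0) = ?av T - ?av T0"
        unfolding sum_subtractf[symmetric]
        by (intro sum.cong refl blinfun_eqI) (simp add: blinfun.diff_left blinfun.diff_right)
      have sandwich: "?H i o\<^sub>L Y.cop (Y.coefficient r T0) r o\<^sub>L ?K i =
          (if r = s then Y.cop (\<lambda>y. complex_of_real ((hY i y)\<^sup>2) * ?f y) s else 0)"
        if i: "i \<in> I" and r: "r \<in> R" for i r
      proof -
        have rG: "r \<in> carrier G" using r R(2) by blast
        have "complex_of_real (hY i y) * Y.coefficient r T0 y * translate Y \<beta> (inv r) (\<lambda>y. complex_of_real (kY i y)) y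
          = (if r = s then complex_of_real ((hY i y)\<^sup>2) * ?f y else 0)" for y
        proof (cases "y \<in> topspace Y")
          case True
          have "\<pi> (\<beta> s (\<beta> (inv r) y)) = \<alpha> (s \<otimes> inv r) (\<pi> y)"
            using True rG s by (simp add: Y.act_mult[symmetric] equivariant)
          then have kk: "translate Y \<beta> (inv r) (\<lambda>y. complex_of_real (kY i y)) y = complex_of_real (h i (\<alpha> (s \<otimes> inv r) (\<pi> y)))"
            using True rG by (simp add: translate_def kY_def)
          show ?thesis
          proof (cases "r = s")
            case True
            then show ?thesis using \<open>y \<in> topspace Y\<close> s unfolding kk by (simp add: hY_def power2_eq_square)
          next
            case False
            then have "h i (\<pi> y) * h i (\<alpha> (s \<otimes> inv r) (\<pi> y)) = 0"
              using r True by (intro h_orth[OF i]) auto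
            then show ?thesis using False True unfolding kk by (auto simp: hY_def)
          qed
        qed (simp add: hY_def)
        then have eq: "(\<lambda>y. complex_of_real (hY i y) * Y.coefficient r T0 y * translate Y \<beta> (inv r) (\<lambda>y. complex_of_real (kY i y)) y)
          = (if r = s then (\<lambda>y. complex_of_real ((hY i y)\<^sup>2) * ?f y) else (\<lambda>_. 0))"
          by (intro ext) (simp only: if_distribR)
        show ?thesis
          unfolding Y.cop_sandwich[OF rG hC0[OF i] C[OF rG] kC0[OF i]] eq
          using Y.cop_zero[OF s] Y.cop_zero[OF rG] by (cases "r = s") simp_all
      qed
      have "?av T0 = (\<Sum>i\<in>I. \<Sum>r\<in>R. ?H i o\<^sub>L Y.cop (Y.coefficient r T0) r o\<^sub>L ?K i)"
        by (subst (1) R(3))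
           (simp only: bounded_bilinear.sum_left[OF bounded_bilinear_blinfun_compose]
             bounded_bilinear.sum_right[OF bounded_bilinear_blinfun_compose])
      also have "\<dots> = (\<Sum>i\<in>I. \<Sum>r\<in>R. if r = s then Y.cop (\<lambda>y. complex_of_real ((hY i y)\<^sup>2) * ?f y) s else 0)"
        by (intro sum.cong refl sandwich)
      also have "\<dots> = (\<Sum>i\<in>I. Y.cop (\<lambda>y. complex_of_real ((hY i y)\<^sup>2) * ?f y) s)"
      proof (cases "s \<in> R")
        case False
        then have "?f = (\<lambda>_. 0)" using zero[OF s] by blast
        then show ?thesis using False Y.cop_zero[OF s] R(1) by (simp add: sum.delta)
      qed (simp add: sum.delta R(1))
      also have "\<dots> = Y.cop (\<lambda>y. \<Sum>i\<in>I. complex_of_real ((hY i y)\<^sup>2) * ?f y) s"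
      proof (rule Y.cop_sum(2)[OF s I, symmetric])
        fix i assume i: "i \<in> I"
        show "(\<lambda>y. complex_of_real ((hY i y)\<^sup>2) * ?f y) \<in> C0 Y"
          using fca_mult[OF CY fca_mult[OF CY hC0[OF i] hC0[OF i]] f] by (simp add: power2_eq_square)
      qed
      finally have av0: "?av T0 = Y.cop (\<lambda>y. \<Sum>i\<in>I. complex_of_real ((hY i y)\<^sup>2) * ?f y) s" .
      have gC: "(\<lambda>y. \<Sum>i\<in>I. complex_of_real ((hY i y)\<^sup>2) * ?f y) \<in> C0 Y"
      proof (rule Y.cop_sum(1)[OF s I])
        fix i assume i: "i \<in> I"
        show "(\<lambda>y. complex_of_real ((hY i y)\<^sup>2) * ?f y) \<in> C0 Y"
          using fca_mult[OF CY fca_mult[OF CY hC0[OF i] hC0[OF i]] f] by (simp add: power2_eq_square)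
      qed
      have n2: "norm (?av T0 - Y.cop ?f s) \<le> e/4"
        unfolding av0 Y.cop_diff[OF s gC f, symmetric]
      proof (rule Y.norm_cop_le[OF s])
        fix y assume y: "y \<in> topspace Y"
        let ?q = "\<Sum>i\<in>I. (hY i y)\<^sup>2"
        have eq: "(\<Sum>i\<in>I. complex_of_real ((hY i y)\<^sup>2) * ?f y) - ?f y = complex_of_real (?q - 1) * ?f y"
          by (simp add: sum_distrib_left algebra_simps)
        have q: "0 \<le> ?q" by (intro sum_nonneg) simp
        show "cmod ((\<Sum>i\<in>I. complex_of_real ((hY i y)\<^sup>2) * ?f y) - ?f y) \<le> e/4"
        proof (cases "e/4 \<le> cmod (?f y)")
          case True
          then have "?q = 1" using h_eq[of "\<pi> y"] y by (simp add: hY_def)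
          then show ?thesis unfolding eq using e by simp
        next
          case False
          have "cmod (complex_of_real (?q - 1) * ?f y) \<le> 1 * cmod (?f y)"
            unfolding norm_mult norm_of_real using q h_le'[of y] by (intro mult_right_mono) auto
          then show ?thesis unfolding eq using False by simp
        qed
      qed (use e in simp)
      have TC: "Y.coefficient s T \<in> C0 Y" by (rule Y.coefficient_limit[OF CY T(2) s])
      have n3: "norm (Y.cop ?f s - Y.cop (Y.coefficient s T) s) \<le> norm (T0 - T)"
        unfolding Y.cop_diff[OF s f TC, symmetric]
      proof (rule Y.norm_cop_le[OF s])
        show "cmod (?f y - Y.coefficient s T y) \<le> norm (T0 - T)" for y
          using Y.norm_coefficient_le[of s "T0 - T" y] by (simp only: Y.coefficient_diff)
      qed simp
      \<comment> \<open>Three errors are added: replacing T by T0 in the average, the average of T0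
        by its term at s, and that term by the term of T.\<close>
      have a: "norm (?av T - ?av T0) < e/4"
        using n1 T0(2) unfolding av_diff dist_norm norm_minus_commute[of T T0] by (rule order_le_less_trans)
      have b: "norm (?av T - Y.cop ?f s) \<le> e/4 + e/4"
        by (rule norm_diff_triangle_le[OF less_imp_le[OF a] n2])
      have c: "norm (Y.cop ?f s - Y.cop (Y.coefficient s T) s) \<le> e/4"
        using n3 less_imp_le[OF T0(2)] unfolding dist_norm by (rule order_trans)
      have "norm (?av T - Y.cop (Y.coefficient s T) s) \<le> e/4 + e/4 + e/4"
        by (rule norm_diff_triangle_le[OF b c])
      also have "\<dots> < e" using e by simp
      finally show ?thesis unfolding dist_norm .
    qed
    ultimately show "\<exists>U\<in>D. dist U (Y.cop (Y.coefficient s T) s) < e" by blast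
  qed
  then show ?thesis using closure_closed[OF oca_closed[OF D]] by blast
qed

end

section \<open>Separation of a point from a closed subspace\<close>

text \<open>Homogeneity is required only as an inequality; rescaling by 1/r gives equality for
  positive r.\<close>

definition sublinear :: "('a::real_vector \<Rightarrow> real) \<Rightarrow> bool" where
  "sublinear q \<longleftrightarrow> (\<forall>u v. q (u + v) \<le> q u + q v) \<and> (\<forall>r\<ge>0. \<forall>u. q (r *\<^sub>R u) \<le> r * q u)"

lemma
  assumes "sublinear q"
  shows sublinear_add: "q (u + v) \<le> q u + q v"
    and sublinear_scale: "0 \<le> r \<Longrightarrow> q (r *\<^sub>R u) \<le> r * q u"
    and sublinear_zero: "q 0 = 0"
    and sublinear_minus: "- q (- u) \<le> q u"
proof -
  show add: "q (u + v) \<le> q u + q v" for u v using assms unfolding sublinear_def by blast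
  show scale: "0 \<le> r \<Longrightarrow> q (r *\<^sub>R u) \<le> r * q u" for r u using assms unfolding sublinear_def by blast
  show zero: "q 0 = 0" using add[of 0 0] scale[of 0 0] by simp
  show "- q (- u) \<le> q u" using add[of u "-u"] zero by simp
qed

text \<open>The functional \<open>p\<close> is the largest sublinear one below \<open>q\<close>
  whose value at -y is at most -q(y). The listed bounds are the terms t = 0 and t = 1 of the
  infimum.\<close>

lemma sublinear_shift:
  fixes y :: "'a::real_vector"
  assumes q: "sublinear q"
  defines "p \<equiv> \<lambda>u. INF t\<in>{0..}. q (u + t *\<^sub>R y) - t * q y"
  shows "sublinear p" "p u \<le> q u" "p (- y) \<le> - q y" "p u \<le> q (u + y) - q y"
proof -
  note add = sublinear_add[OF q] and scale = sublinear_scale[OF q]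
  \<comment> \<open>A lower bound independent of \<open>t\<close>, so the infimum is taken over a
    set bounded below.\<close>
  have lower: "- q (- u) \<le> q (u + t *\<^sub>R y) - t * q y" if "0 \<le> t" for u t
  proof -
    have "t * q y \<le> q (t *\<^sub>R y)"
    proof (cases "t = 0")
      case False
      then have t: "0 < t" using that by simp
      have "q y \<le> (1/t) * q (t *\<^sub>R y)" using scale[of "1/t" "t *\<^sub>R y"] t by simp
      then show ?thesis using t by (simp add: pos_le_divide_eq mult.commute)
    qed (simp add: sublinear_zero[OF q])
    moreover have "q (t *\<^sub>R y) \<le> q (u + t *\<^sub>R y) + q (- u)" using add[of "u + t *\<^sub>R y" "- u"] by simp
    ultimately show ?thesis by simp
  qed
  have bdd: "bdd_below ((\<lambda>t. q (u + t *\<^sub>R y) - t * q y) ` {0..})" for u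
    using lower by (intro bdd_belowI2[of _ "- q (- u)"]) simp
  have le: "p u \<le> q (u + t *\<^sub>R y) - t * q y" if "0 \<le> t" for u t
    unfolding p_def by (rule cINF_lower[OF bdd]) (use that in simp)
  have ge: "c \<le> p u" if "\<And>t. 0 \<le> t \<Longrightarrow> c \<le> q (u + t *\<^sub>R y) - t * q y" for c u
    unfolding p_def by (rule cINF_greatest) (use that in auto)
  show "p u \<le> q u" using le[of 0 u] by simp
  show "p u \<le> q (u + y) - q y" using le[of 1 u] by simp
  show "p (- y) \<le> - q y" using le[of 1 "- y"] sublinear_zero[OF q] by simp
  show "sublinear p"
    unfolding sublinear_def
  proof (intro conjI allI impI)
    fix u v
    have "p (u + v) - (q (u + s *\<^sub>R y) - s * q y) \<le> q (v + t *\<^sub>R y) - t * q y" if "0 \<le> s" "0 \<le> t" for s t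
    proof -
      have "p (u + v) \<le> q (u + v + (s + t) *\<^sub>R y) - (s + t) * q y" using that by (intro le) simp
      also have "u + v + (s + t) *\<^sub>R y = (u + s *\<^sub>R y) + (v + t *\<^sub>R y)" by (simp add: algebra_simps)
      also have "q \<dots> \<le> q (u + s *\<^sub>R y) + q (v + t *\<^sub>R y)" by (rule add)
      finally show ?thesis by (simp add: algebra_simps)
    qed
    then have "p (u + v) - (q (u + s *\<^sub>R y) - s * q y) \<le> p v" if "0 \<le> s" for s
      using that by (intro ge)
    then have "p (u + v) - p v \<le> q (u + s *\<^sub>R y) - s * q y" if "0 \<le> s" for s
      using that by (simp add: algebra_simps)
    then have "p (u + v) - p v \<le> p u" by (rule ge)
    then show "p (u + v) \<le> p u + p v" by simp
  next
    fix r :: real and u assume r: "0 \<le> r"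
    show "p (r *\<^sub>R u) \<le> r * p u"
    proof (cases "r = 0")
      case True
      then show ?thesis using le[of 0 0] sublinear_zero[OF q] by simp
    next
      case False
      then have r: "0 < r" using r by simp
      have "p (r *\<^sub>R u) / r \<le> q (u + t *\<^sub>R y) - t * q y" if "0 \<le> t" for t
      proof -
        have "p (r *\<^sub>R u) \<le> q (r *\<^sub>R u + (r * t) *\<^sub>R y) - (r * t) * q y" using r that by (intro le) simp
        also have "r *\<^sub>R u + (r * t) *\<^sub>R y = r *\<^sub>R (u + t *\<^sub>R y)" by (simp add: algebra_simps)
        also have "q \<dots> \<le> r * q (u + t *\<^sub>R y)" using r by (intro scale) simp
        finally have "p (r *\<^sub>R u) \<le> (q (u + t *\<^sub>R y) - t * q y) * r" by (simp add: algebra_simps)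
        then show ?thesis using r by (simp only: pos_divide_le_eq)
      qed
      then have "p (r *\<^sub>R u) / r \<le> p u" by (rule ge)
      then show ?thesis using r by (simp add: pos_divide_le_eq mult.commute)
    qed
  qed
qed

text \<open>A minimal sublinear functional \<open>q\<close> coincides with its shifts and is therefore additive.\<close>

lemma minimal_sublinear_linear:
  fixes q :: "'a::real_vector \<Rightarrow> real"
  assumes q: "sublinear q" and min: "\<And>p. sublinear p \<Longrightarrow> (\<And>u. p u \<le> q u) \<Longrightarrow> p = q"
  shows "linear q"
proof -
  have add: "q (u + v) = q u + q v" for u v
  proof (rule antisym[OF sublinear_add[OF q]])
    have "(\<lambda>u. INF t\<in>{0..}. q (u + t *\<^sub>R v) - t * q v) = q"
      by (rule min) (rule sublinear_shift[OF q])+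
    from fun_cong[OF this, of u] sublinear_shift(4)[OF q, of u v]
    show "q u + q v \<le> q (u + v)" by simp
  qed
  have neg: "q (- u) = - q u" for u using add[of u "- u"] sublinear_zero[OF q] by simp
  have nonneg: "q (r *\<^sub>R u) = r * q u" if "0 \<le> r" for r u
    using sublinear_scale[OF q that, of u] sublinear_scale[OF q that, of "- u"] neg[of "r *\<^sub>R u"] neg[of u] by simp
  have "q (r *\<^sub>R u) = r * q u" for r u
  proof (cases "0 \<le> r")
    case False
    then have "q ((- r) *\<^sub>R u) = (- r) * q u" by (intro nonneg) simp
    then show ?thesis using neg[of "r *\<^sub>R u"] by simp
  qed (rule nonneg)
  with add show ?thesis by (intro linearI) auto
qed

text \<open>This is the Hahn--Banach theorem by Zorn's lemma without extension from subspaces. Along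
  a chain the pointwise infimum stays finite, being bounded below by -p(-u), and it is sublinear
  because any two members have a common minorant in the chain.\<close>

lemma sublinear_dominates_linear:
  fixes p :: "'a::real_vector \<Rightarrow> real"
  assumes p: "sublinear p"
  obtains q where "linear q" "\<And>u. q u \<le> p u"
proof -
  let ?A = "{q. sublinear q \<and> (\<forall>u. q u \<le> p u)}"
  \<comment> \<open>The order is reversed, so that the maximal element supplied by Zorn's lemma is a
    minimal functional.\<close>
  let ?P = "\<lambda>f g :: 'a \<Rightarrow> real. \<forall>u. g u \<le> f u"
  have "\<exists>m\<in>?A. \<forall>a\<in>?A. ?P m a \<longrightarrow> a = m"
  proof (rule predicate_Zorn)
    show "partial_order_on ?A (relation_of ?P ?A)"
      by (rule partial_order_on_relation_ofI) (auto simp: fun_eq_iff intro: order_trans antisym)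
    fix C assume C: "C \<in> Chains (relation_of ?P ?A)"
    have CA: "C \<subseteq> ?A" using C by (auto simp: Chains_def relation_of_def)
    have chain: "?P f g \<or> ?P g f" if "f \<in> C" "g \<in> C" for f g
      using C that unfolding Chains_def relation_of_def by blast
    show "\<exists>u\<in>?A. \<forall>a\<in>C. ?P a u"
    proof (cases "C = {}")
      case True
      then show ?thesis using p by (intro bexI[of _ p]) auto
    next
      case False
      define m where "m u = (INF f\<in>C. f u)" for u
      have lower: "- p (- u) \<le> f u" if "f \<in> C" for f u
      proof -
        have f: "sublinear f" "f (- u) \<le> p (- u)" using CA that by auto
        show ?thesis using sublinear_minus[OF f(1), of u] f(2) by simp
      qed
      have bdd: "bdd_below ((\<lambda>f. f u) ` C)" for u using lower by (intro bdd_belowI2)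
      have le: "m u \<le> f u" if "f \<in> C" for f u unfolding m_def by (rule cINF_lower[OF bdd that])
      have ge: "c \<le> m u" if "\<And>f. f \<in> C \<Longrightarrow> c \<le> f u" for c u
        unfolding m_def by (rule cINF_greatest[OF False that])
      have "sublinear m"
        unfolding sublinear_def
      proof (intro conjI allI impI)
        fix u v
        have "m (u + v) - f u \<le> g v" if fg: "f \<in> C" "g \<in> C" for f g
        proof -
          obtain k where k: "k \<in> C" "\<And>u. k u \<le> f u" "\<And>u. k u \<le> g u"
            using chain[OF fg] fg by blast
          have "sublinear k" using CA k(1) by auto
          then have "m (u + v) \<le> k u + k v" using le[OF k(1)] sublinear_add order_trans by blast
          then show ?thesis using k(2)[of u] k(3)[of v] by linarith
        qed
        then have "m (u + v) - f u \<le> m v" if "f \<in> C" for f using that by (intro ge)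
        then have "m (u + v) - m v \<le> f u" if "f \<in> C" for f using that by (simp add: algebra_simps)
        then have "m (u + v) - m v \<le> m u" by (rule ge)
        then show "m (u + v) \<le> m u + m v" by simp
      next
        fix r :: real and u assume r: "0 \<le> r"
        have *: "m (r *\<^sub>R u) \<le> r * f u" if "f \<in> C" for f
        proof -
          have "sublinear f" using CA that by auto
          from sublinear_scale[OF this r] show ?thesis using le[OF that] order_trans by blast
        qed
        show "m (r *\<^sub>R u) \<le> r * m u"
        proof (cases "r = 0")
          case True
          then show ?thesis using * False by auto
        next
          case False
          then have r: "0 < r" using r by simp
          have "m (r *\<^sub>R u) / r \<le> m u"
            by (rule ge) (use * r in \<open>simp add: pos_divide_le_eq mult.commute\<close>)
          then show ?thesis using r by (simp add: pos_divide_le_eq mult.commute)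
        qed
      qed
      moreover have "m u \<le> p u" for u
      proof -
        obtain f where "f \<in> C" using False by blast
        then show ?thesis using le[of f u] CA by (auto intro: order_trans)
      qed
      ultimately show ?thesis using le by (intro bexI[of _ m]) auto
    qed
  qed
  then obtain m where m: "sublinear m" "\<And>u. m u \<le> p u"
    and min: "\<And>a. sublinear a \<Longrightarrow> (\<forall>u. a u \<le> p u) \<Longrightarrow> (\<forall>u. a u \<le> m u) \<Longrightarrow> a = m"
    by auto
  have "linear m"
  proof (rule minimal_sublinear_linear[OF m(1)])
    fix a assume a: "sublinear a" "\<And>u. a u \<le> m u"
    show "a = m" by (rule min) (use a m(2) in \<open>auto intro: order_trans\<close>)
  qed
  then show thesis using m(2) by (rule that)
qed

text \<open>The distance to \<open>V\<close> is sublinear and vanishes on \<open>V\<close>, so every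
  linear functional below it vanishes on \<open>V\<close> and is bounded by the norm. Shifting the
  distance at \<open>x\<close> first prevents the functional from vanishing at
  \<open>x\<close>.\<close>

lemma functional_separating_closed_subspace:
  fixes V :: "'a::real_normed_vector set"
  assumes V: "subspace V" "closed V" and x: "x \<notin> V"
  obtains f :: "'a \<Rightarrow> real" where "bounded_linear f" "\<And>v. v \<in> V \<Longrightarrow> f v = 0" "f x = 1"
proof -
  have V0: "0 \<in> V" by (rule subspace_0[OF V(1)])
  have ne: "V \<noteq> {}" using V0 by blast
  define p where "p u = infdist u V" for u
  have p_le: "p u \<le> norm (u - v)" if "v \<in> V" for u v
    unfolding p_def using infdist_le[OF that, of u] by (simp add: dist_norm)
  have p_ge: "c \<le> p u" if "\<And>v. v \<in> V \<Longrightarrow> c \<le> norm (u - v)" for c u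
    unfolding p_def infdist_notempty[OF ne] dist_norm by (rule cINF_greatest[OF ne that])
  have sub: "sublinear p"
    unfolding sublinear_def
  proof (intro conjI allI impI)
    fix u w
    have "p (u + w) - norm (u - v) \<le> norm (w - v')" if "v \<in> V" "v' \<in> V" for v v'
    proof -
      have "p (u + w) \<le> norm ((u + w) - (v + v'))" by (rule p_le[OF subspace_add[OF V(1) that]])
      also have "(u + w) - (v + v') = (u - v) + (w - v')" by simp
      also have "norm \<dots> \<le> norm (u - v) + norm (w - v')" by (rule norm_triangle_ineq)
      finally show ?thesis by simp
    qed
    then have "p (u + w) - norm (u - v) \<le> p w" if "v \<in> V" for v using that by (intro p_ge)
    then have "p (u + w) - p w \<le> norm (u - v)" if "v \<in> V" for v using that by (simp add: algebra_simps)
    then have "p (u + w) - p w \<le> p u" by (rule p_ge)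
    then show "p (u + w) \<le> p u + p w" by simp
  next
    fix r :: real and u assume r: "0 \<le> r"
    show "p (r *\<^sub>R u) \<le> r * p u"
    proof (cases "r = 0")
      case True
      then show ?thesis using p_le[OF V0, of 0] by simp
    next
      case False
      then have r: "0 < r" using r by simp
      have "p (r *\<^sub>R u) / r \<le> p u"
      proof (rule p_ge)
        fix v assume v: "v \<in> V"
        have "p (r *\<^sub>R u) \<le> norm (r *\<^sub>R u - r *\<^sub>R v)" by (rule p_le[OF subspace_scale[OF V(1) v]])
        also have "\<dots> = r * norm (u - v)" using r by (simp flip: scaleR_diff_right)
        finally show "p (r *\<^sub>R u) / r \<le> norm (u - v)" using r by (simp add: pos_divide_le_eq mult.commute)
      qed
      then show ?thesis using r by (simp add: pos_divide_le_eq mult.commute)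
    qed
  qed
  have pV: "p v \<le> 0" if "v \<in> V" for v using p_le[OF that, of v] by simp
  have px: "0 < p x" unfolding p_def using infdist_pos_not_in_closed[OF V(2) ne x] .
  \<comment> \<open>Being below the shift forces the value at -x down to -p(x); together with the
    bound by \<open>p\<close> this fixes the value at \<open>x\<close>.\<close>
  let ?q = "\<lambda>u. INF t\<in>{0..}. p (u + t *\<^sub>R x) - t * p x"
  obtain g where g: "linear g" "\<And>u. g u \<le> ?q u"
    by (rule sublinear_dominates_linear[OF sublinear_shift(1)[OF sub, of x]]) (rule that)
  have gp: "g u \<le> p u" for u using g(2)[of u] sublinear_shift(2)[OF sub, of u x] by simp
  have gx: "g x = p x"
  proof (rule antisym[OF gp])
    have "g (- x) \<le> - p x" using g(2)[of "- x"] sublinear_shift(3)[OF sub, of x] by simp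
    then show "p x \<le> g x" using linear_neg[OF g(1), of x] by simp
  qed
  have gV: "g v = 0" if v: "v \<in> V" for v
  proof -
    have "- v \<in> V" by (rule subspace_neg[OF V(1) v])
    then show ?thesis using gp[of v] gp[of "- v"] pV[OF v] pV[of "- v"] linear_neg[OF g(1), of v] by simp
  qed
  have g_norm: "norm (g u) \<le> norm u * 1" for u
    using gp[of u] gp[of "- u"] p_le[OF V0, of u] p_le[OF V0, of "- u"] linear_neg[OF g(1), of u] by simp
  have "bounded_linear g"
    by (rule bounded_linear_intro[OF linear_add[OF g(1)] _ g_norm]) (simp add: linear_scale[OF g(1)])
  then have "bounded_linear (\<lambda>u. g u / p x)" by (rule bounded_linear_compose[OF bounded_linear_divide])
  then show thesis by (rule that) (use gV gx px in auto)
qed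

section \<open>Herz--Schur multipliers act on matrices\<close>

text \<open>For nonnegative \<open>C\<close>: the finite matrix \<open>m\<close> has operator norm
  at most \<open>C\<close> on the space of square-summable families over \<open>W\<close>. Arbitrary
  index sets are allowed because matrices over group elements and points of \<open>Y\<close> are
  later renumbered by naturals.\<close>

definition matrix_bound :: "'w set \<Rightarrow> ('w \<Rightarrow> 'w \<Rightarrow> complex) \<Rightarrow> real \<Rightarrow> bool" where
  "matrix_bound W m C \<longleftrightarrow>
     (\<forall>x. (\<Sum>k\<in>W. (cmod (\<Sum>j\<in>W. m k j * x j))\<^sup>2) \<le> C\<^sup>2 * (\<Sum>j\<in>W. (cmod (x j))\<^sup>2))"

lemma matrix_boundD:
  "matrix_bound W m C \<Longrightarrow> (\<Sum>k\<in>W. (cmod (\<Sum>j\<in>W. m k j * x j))\<^sup>2) \<le> C\<^sup>2 * (\<Sum>j\<in>W. (cmod (x j))\<^sup>2)"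
  unfolding matrix_bound_def by blast

lemma matrix_bound_reindex:
  fixes h :: "'v \<Rightarrow> 'w"
  assumes h: "bij_betw h V W"
  shows "matrix_bound W m C \<longleftrightarrow> matrix_bound V (\<lambda>k j. m (h k) (h j)) C"
proof
  assume b: "matrix_bound V (\<lambda>k j. m (h k) (h j)) C"
  show "matrix_bound W m C"
    unfolding matrix_bound_def
  proof
    fix x :: "'w \<Rightarrow> complex"
    show "(\<Sum>k\<in>W. (cmod (\<Sum>j\<in>W. m k j * x j))\<^sup>2) \<le> C\<^sup>2 * (\<Sum>j\<in>W. (cmod (x j))\<^sup>2)"
      using matrix_boundD[OF b, of "\<lambda>j. x (h j)"]
      by (simp only: sum.reindex_bij_betw[OF h, symmetric])
  qed
next
  assume b: "matrix_bound W m C"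
  show "matrix_bound V (\<lambda>k j. m (h k) (h j)) C"
    unfolding matrix_bound_def
  proof
    fix x :: "'v \<Rightarrow> complex"
    let ?x = "\<lambda>j. x (inv_into V h j)"
    have inj: "inj_on h V" using h by (rule bij_betw_imp_inj_on)
    have x: "(\<Sum>j\<in>V. f j * ?x (h j)) = (\<Sum>j\<in>V. f j * x j)" for f :: "_ \<Rightarrow> complex"
      by (rule sum.cong) (simp_all add: inv_into_f_f[OF inj])
    have x': "(\<Sum>j\<in>V. (cmod (?x (h j)))\<^sup>2) = (\<Sum>j\<in>V. (cmod (x j))\<^sup>2)"
      by (rule sum.cong) (simp_all add: inv_into_f_f[OF inj])
    show "(\<Sum>k\<in>V. (cmod (\<Sum>j\<in>V. m (h k) (h j) * x j))\<^sup>2) \<le> C\<^sup>2 * (\<Sum>j\<in>V. (cmod (x j))\<^sup>2)"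
      using matrix_boundD[OF b, of ?x] by (simp only: sum.reindex_bij_betw[OF h, symmetric] x x')
  qed
qed

section \<open>From completely bounded multipliers to Schur multipliers\<close>

context group
begin

lemma unit_shift_apply:
  assumes "s \<in> carrier G"
  shows "ell2_apply (blinfun_apply (unit_shift G i j s) x) (t, k) =
    (if t \<in> carrier G \<and> k = i then ell2_apply x (inv s \<otimes> t, j) else 0)"
proof -
  have inj: "inj_on (\<lambda>(t, k). (inv s \<otimes> t, j)) {w. (case w of (t, k) \<Rightarrow> if t \<in> carrier G \<and> k = i then 1 else (0::complex)) \<noteq> 0}"
    using assms by (auto simp: inj_on_def split: if_splits)
  show ?thesis
    unfolding unit_shift_def by (subst wcomp_apply[where B = 1, OF _ inj]) (auto split: prod.splits)
qed

text \<open>The shape is dictated by \<open>cb_bound\<close>, which speaks of sums over group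
  elements with matrix coefficients: all entries with the same product
  \<open>g k \<otimes> inv (g j)\<close> are collected into the coefficient there.\<close>

definition twisted_op :: "nat \<Rightarrow> (nat \<Rightarrow> 'a) \<Rightarrow> (nat \<Rightarrow> nat \<Rightarrow> complex) \<Rightarrow> ('a \<times> nat) ell2 \<Rightarrow>\<^sub>L ('a \<times> nat) ell2" where
  "twisted_op n g m = matrix_group_op G n ((\<lambda>(k, j). g k \<otimes> inv (g j)) ` ({..<n} \<times> {..<n}))
     (\<lambda>s k j. if s = g k \<otimes> inv (g j) then m k j else 0)"

text \<open>The matrix \<open>\<Sum>\<^sub>k\<^sub>j m\<^sub>k\<^sub>j E\<^sub>k\<^sub>j \<otimes> \<lambda>(g\<^sub>k g\<^sub>j\<^sup>-\<^sup>1)\<close> is conjugate to \<open>m \<otimes> 1\<close> by the unitary with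
  diagonal entries \<open>\<lambda>(g\<^sub>k)\<close>.\<close>

lemma twisted_op_apply:
  fixes g :: "nat \<Rightarrow> 'a"
  assumes g: "\<And>j. j < n \<Longrightarrow> g j \<in> carrier G"
  shows "ell2_apply (blinfun_apply (twisted_op n g m) x) (t, k) =
    (if t \<in> carrier G \<and> k < n then \<Sum>j<n. m k j * ell2_apply x (g j \<otimes> (inv (g k) \<otimes> t), j) else 0)"
proof -
  define S where "S = (\<lambda>(k, j). g k \<otimes> inv (g j)) ` ({..<n} \<times> {..<n})"
  have SG: "s \<in> carrier G" if "s \<in> S" for s using that g by (auto simp: S_def)
  have "finite S" unfolding S_def by simp
  have "ell2_apply (blinfun_apply (twisted_op n g m) x) (t, k) =
    (\<Sum>s\<in>S. \<Sum>i<n. \<Sum>j<n. (if s = g i \<otimes> inv (g j) then m i j else 0) *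
        (if t \<in> carrier G \<and> k = i then ell2_apply x (inv s \<otimes> t, j) else 0))"
    unfolding twisted_op_def S_def[symmetric] matrix_group_op_def blinfun_apply_sum ell2_apply_sum cscale_apply
    by (intro sum.cong refl) (simp add: unit_shift_apply SG)
  also have "\<dots> = (\<Sum>i<n. \<Sum>j<n. \<Sum>s\<in>S. (if s = g i \<otimes> inv (g j) then m i j else 0) *
        (if t \<in> carrier G \<and> k = i then ell2_apply x (inv s \<otimes> t, j) else 0))"
    by (subst sum.swap, rule sum.cong[OF refl], rule sum.swap)
  also have "\<dots> = (\<Sum>i<n. \<Sum>j<n. if k = i then (if t \<in> carrier G then m i j * ell2_apply x (g j \<otimes> (inv (g i) \<otimes> t), j) else 0) else 0)"
  proof (intro sum.cong refl)
    fix i j assume ij: "i \<in> {..<n}" "j \<in> {..<n}"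
    let ?c = "\<lambda>s. if t \<in> carrier G \<and> k = i then ell2_apply x (inv s \<otimes> t, j) else 0"
    have "(\<Sum>s\<in>S. (if s = g i \<otimes> inv (g j) then m i j else 0) * ?c s) =
        (\<Sum>s\<in>S. if s = g i \<otimes> inv (g j) then m i j * ?c s else 0)"
      by (intro sum.cong refl) simp
    also have "\<dots> = m i j * ?c (g i \<otimes> inv (g j))"
      using \<open>finite S\<close> ij by (subst sum.delta) (auto simp: S_def)
    also have "\<dots> = (if k = i then (if t \<in> carrier G then m i j * ell2_apply x (g j \<otimes> (inv (g i) \<otimes> t), j) else 0) else 0)"
      using g ij by (auto simp: inv_mult_group m_assoc)
    finally show "(\<Sum>s\<in>S. (if s = g i \<otimes> inv (g j) then m i j else 0) * ?c s) =
      (if k = i then (if t \<in> carrier G then m i j * ell2_apply x (g j \<otimes> (inv (g i) \<otimes> t), j) else 0) else 0)" .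
  qed
  also have "\<dots> = (\<Sum>i<n. if k = i then (\<Sum>j<n. if t \<in> carrier G then m i j * ell2_apply x (g j \<otimes> (inv (g i) \<otimes> t), j) else 0) else 0)"
    by (intro sum.cong refl) auto
  also have "\<dots> = (if t \<in> carrier G \<and> k < n then \<Sum>j<n. m k j * ell2_apply x (g j \<otimes> (inv (g k) \<otimes> t), j) else 0)"
    by (subst sum.delta') auto
  finally show ?thesis .
qed

text \<open>Output coordinates (t,k) are relabelled by p = g_k^(-1) t. For each fixed p the operator
  applies \<open>m\<close> to the values of x at the points (g_j p, j), and for different p these
  points are disjoint.\<close>

lemma norm_twisted_op_le:
  fixes g :: "nat \<Rightarrow> 'a"
  assumes g: "\<And>j. j < n \<Longrightarrow> g j \<in> carrier G" and b: "matrix_bound {..<n} m C" and C: "0 \<le> C"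
  shows "norm (twisted_op n g m) \<le> C"
    (is "norm ?M \<le> C")
proof (rule norm_blinfun_bound[OF C], rule norm_ell2_leI)
  fix x and F :: "('a \<times> nat) set" assume F: "finite F"
  let ?F = "F \<inter> (carrier G \<times> {..<n})"
  define P where "P = (\<lambda>(t, k). inv (g k) \<otimes> t) ` ?F"
  have P: "finite P" "P \<subseteq> carrier G" using F g by (auto simp: P_def)
  define q where "q p k = (cmod (\<Sum>j<n. m k j * ell2_apply x (g j \<otimes> p, j)))\<^sup>2" for p k
  have "(\<Sum>w\<in>F. (cmod (ell2_apply (blinfun_apply ?M x) w))\<^sup>2) = (\<Sum>w\<in>?F. (cmod (ell2_apply (blinfun_apply ?M x) w))\<^sup>2)"
    by (rule sum.mono_neutral_right[OF F]) (auto simp: twisted_op_apply[OF g] split: if_splits)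
  also have "\<dots> = (\<Sum>w\<in>?F. case (case w of (t, k) \<Rightarrow> (inv (g k) \<otimes> t, k)) of (p, k) \<Rightarrow> q p k)"
    by (rule sum.cong) (auto simp: twisted_op_apply[OF g] q_def)
  also have "\<dots> = (\<Sum>(p, k)\<in>(\<lambda>(t, k). (inv (g k) \<otimes> t, k)) ` ?F. q p k)"
    by (subst sum.reindex) (use g in \<open>auto simp: inj_on_def o_def\<close>)
  also have "\<dots> \<le> (\<Sum>(p, k)\<in>P \<times> {..<n}. q p k)"
    by (rule sum_mono2) (use P in \<open>auto simp: P_def q_def\<close>)
  also have "\<dots> = (\<Sum>p\<in>P. \<Sum>k<n. q p k)"
    by (rule sum.cartesian_product[symmetric])
  also have "\<dots> \<le> (\<Sum>p\<in>P. C\<^sup>2 * (\<Sum>j<n. (cmod (ell2_apply x (g j \<otimes> p, j)))\<^sup>2))"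
    unfolding q_def by (intro sum_mono matrix_boundD[OF b])
  also have "\<dots> = C\<^sup>2 * (\<Sum>(p, j)\<in>P \<times> {..<n}. (cmod (ell2_apply x (g j \<otimes> p, j)))\<^sup>2)"
    by (simp only: sum_distrib_left[symmetric] sum.cartesian_product)
  also have "(\<Sum>(p, j)\<in>P \<times> {..<n}. (cmod (ell2_apply x (g j \<otimes> p, j)))\<^sup>2) =
      (\<Sum>w\<in>(\<lambda>(p, j). (g j \<otimes> p, j)) ` (P \<times> {..<n}). (cmod (ell2_apply x w))\<^sup>2)"
    by (subst sum.reindex) (use g in \<open>auto simp: inj_on_def o_def case_prod_unfold subsetD[OF P(2)]\<close>)
  also have "C\<^sup>2 * \<dots> \<le> C\<^sup>2 * (norm x)\<^sup>2"
    by (intro mult_left_mono ell2_finite_sum_le) (use P in auto)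
  finally show "(\<Sum>w\<in>F. (cmod (ell2_apply (blinfun_apply ?M x) w))\<^sup>2) \<le> (C * norm x)\<^sup>2"
    by (simp only: power_mult_distrib)
qed (use C in simp)

text \<open>Vectors supported on the points (g_j, j), the slice at the unit, see the matrix
  \<open>m\<close> itself.\<close>

lemma twisted_op_bound:
  fixes g :: "nat \<Rightarrow> 'a"
  assumes g: "\<And>j. j < n \<Longrightarrow> g j \<in> carrier G"
  shows "matrix_bound {..<n} m (norm (twisted_op n g m))"
    (is "matrix_bound _ _ (norm ?M)")
  unfolding matrix_bound_def
proof
  fix x :: "nat \<Rightarrow> complex"
  let ?W = "(\<lambda>j. (g j, j)) ` {..<n}"
  define z where "z = finvec ?W (\<lambda>(t, j). x j)"
  have inj: "inj_on (\<lambda>j. (g j, j)) {..<n}" by (auto simp: inj_on_def)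
  have z: "ell2_apply z (g j, j) = x j" if "j < n" for j
    using that by (simp add: z_def finvec_apply)
  have M: "ell2_apply (blinfun_apply ?M z) (g k, k) = (\<Sum>j<n. m k j * x j)" if k: "k < n" for k
    using k g by (auto simp: twisted_op_apply[OF g] z intro!: sum.cong)
  have "(\<Sum>k<n. (cmod (\<Sum>j<n. m k j * x j))\<^sup>2) = (\<Sum>k<n. (cmod (ell2_apply (blinfun_apply ?M z) (g k, k)))\<^sup>2)"
    by (intro sum.cong refl) (simp add: M)
  also have "\<dots> = (\<Sum>w\<in>?W. (cmod (ell2_apply (blinfun_apply ?M z) w))\<^sup>2)"
    by (subst sum.reindex[OF inj]) simp
  also have "\<dots> \<le> (norm (blinfun_apply ?M z))\<^sup>2" by (rule ell2_finite_sum_le) simp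
  also have "\<dots> \<le> (norm ?M * norm z)\<^sup>2" by (intro power_mono norm_blinfun) simp
  also have "\<dots> = (norm ?M)\<^sup>2 * (norm z)\<^sup>2" by (rule power_mult_distrib)
  also have "(norm z)\<^sup>2 = (\<Sum>j<n. (cmod (x j))\<^sup>2)"
    unfolding z_def by (subst norm_finvec) (simp_all add: sum.reindex[OF inj])
  finally show "(\<Sum>k<n. (cmod (\<Sum>j<n. m k j * x j))\<^sup>2) \<le> (norm ?M)\<^sup>2 * (\<Sum>j<n. (cmod (x j))\<^sup>2)" .
qed

lemma matrix_bound_mono:
  assumes "matrix_bound W m C" "0 \<le> C" "C \<le> D"
  shows "matrix_bound W m D"
  unfolding matrix_bound_def
proof
  fix x
  have "(\<Sum>k\<in>W. (cmod (\<Sum>j\<in>W. m k j * x j))\<^sup>2) \<le> C\<^sup>2 * (\<Sum>j\<in>W. (cmod (x j))\<^sup>2)" by (rule matrix_boundD[OF assms(1)])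
  also have "\<dots> \<le> D\<^sup>2 * (\<Sum>j\<in>W. (cmod (x j))\<^sup>2)"
    by (intro mult_right_mono power_mono assms sum_nonneg) simp
  finally show "(\<Sum>k\<in>W. (cmod (\<Sum>j\<in>W. m k j * x j))\<^sup>2) \<le> D\<^sup>2 * (\<Sum>j\<in>W. (cmod (x j))\<^sup>2)" .
qed

text \<open>In the twisted operator the entry (v,w) sits at the group element
  \<open>g v \<otimes> inv (g w)\<close>, so the multiplier multiplies it by \<phi> at that element,
  while twisting leaves the norm of a matrix unchanged. Repeated values of \<open>g\<close> are
  allowed; they occur for index pairs sharing their group component.\<close>

lemma cb_bound_Schur_multiplier:
  assumes \<phi>: "cb_bound G \<phi> K" and W: "finite W" and g: "\<And>w. w \<in> W \<Longrightarrow> g w \<in> carrier G"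
    and b: "matrix_bound W m C" and C: "0 \<le> C"
  shows "matrix_bound W (\<lambda>v w. \<phi> (g v \<otimes> inv (g w)) * m v w) (K * C)"
proof -
  obtain h where h: "bij_betw h {..<card W} W"
    using ex_bij_betw_nat_finite[OF W] unfolding lessThan_atLeast0 by blast
  let ?n = "card W" and ?g = "\<lambda>k. g (h k)" and ?m = "\<lambda>k j. m (h k) (h j)"
  have g': "?g j \<in> carrier G" if "j < ?n" for j using g h that by (auto simp: bij_betw_def)
  let ?S = "(\<lambda>(k, j). ?g k \<otimes> inv (?g j)) ` ({..<?n} \<times> {..<?n})"
  let ?a = "\<lambda>s k j. if s = ?g k \<otimes> inv (?g j) then ?m k j else 0"
  have K: "0 \<le> K" using \<phi> unfolding cb_bound_def by blast
  have S: "finite ?S" "?S \<subseteq> carrier G" using g' by auto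
  have a: "(\<lambda>s k j. if s = ?g k \<otimes> inv (?g j) then \<phi> (?g k \<otimes> inv (?g j)) * ?m k j else 0) = (\<lambda>s k j. \<phi> s * ?a s k j)"
    by (intro ext) auto
  have "norm (twisted_op ?n ?g (\<lambda>k j. \<phi> (?g k \<otimes> inv (?g j)) * ?m k j)) \<le> K * norm (twisted_op ?n ?g ?m)"
    unfolding twisted_op_def a
    using \<phi>[unfolded cb_bound_def, THEN conjunct2, THEN spec, THEN spec, THEN spec, THEN mp, OF conjI[OF S]] .
  also have "\<dots> \<le> K * C"
    by (rule mult_left_mono[OF norm_twisted_op_le[OF g' matrix_bound_reindex[OF h, THEN iffD1, OF b] C] K])
  finally show ?thesis
    unfolding matrix_bound_reindex[OF h]
    by (rule matrix_bound_mono[rotated 2, OF _ twisted_op_bound[OF g'] norm_ge_zero])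
qed

end

section \<open>Consequences of the approximation property\<close>

context G_space
begin

text \<open>The change of variable from s to r = s^(-1) t, so s = t r^(-1), turns a convolution sum
  into a row of a matrix product.\<close>

lemma finite_sum_as_matrix:
  fixes c :: "'g \<Rightarrow> complex"
  assumes S: "finite S" "S \<subseteq> carrier G" and W: "finite W" "W \<subseteq> carrier G \<times> topspace Y"
    and t: "t \<in> carrier G" and x: "\<And>w. w \<notin> W \<Longrightarrow> x w = 0"
  shows "(\<Sum>s\<in>S. c s * x (inv s \<otimes> t, y)) =
    (\<Sum>w\<in>W. (if snd w = y \<and> t \<otimes> inv (fst w) \<in> S then c (t \<otimes> inv (fst w)) else 0) * x w)"
proof -
  let ?S = "{s\<in>S. (inv s \<otimes> t, y) \<in> W}" and ?W = "{w\<in>W. snd w = y \<and> t \<otimes> inv (fst w) \<in> S}"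
  have "(\<Sum>s\<in>S. c s * x (inv s \<otimes> t, y)) = (\<Sum>s\<in>?S. c s * x (inv s \<otimes> t, y))"
    by (rule sum.mono_neutral_right[OF S(1)]) (use x in auto)
  also have "\<dots> = (\<Sum>w\<in>?W. c (t \<otimes> inv (fst w)) * x w)"
  proof (rule sum.reindex_bij_witness[where i = "\<lambda>w. t \<otimes> inv (fst w)" and j = "\<lambda>s. (inv s \<otimes> t, y)"])
    fix s assume s: "s \<in> ?S"
    then have sG: "s \<in> carrier G" using S(2) by blast
    have *: "t \<otimes> inv (inv s \<otimes> t) = s" using sG t by (simp add: inv_mult_group m_assoc[symmetric])
    show "t \<otimes> inv (fst (inv s \<otimes> t, y)) = s" using * by simp
    show "(inv s \<otimes> t, y) \<in> ?W" using * s by simp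
    show "c (t \<otimes> inv (fst (inv s \<otimes> t, y))) * x (inv s \<otimes> t, y) = c s * x (inv s \<otimes> t, y)" using * by simp
  next
    fix w assume w: "w \<in> ?W"
    then have rG: "fst w \<in> carrier G" using W(2) by auto
    have *: "inv (t \<otimes> inv (fst w)) \<otimes> t = fst w" using rG t by (simp add: inv_mult_group m_assoc)
    show "(inv (t \<otimes> inv (fst w)) \<otimes> t, y) = w" using * w by auto
    then show "t \<otimes> inv (fst w) \<in> ?S" using w by simp
  qed
  also have "\<dots> = (\<Sum>w\<in>?W. (if snd w = y \<and> t \<otimes> inv (fst w) \<in> S then c (t \<otimes> inv (fst w)) else 0) * x w)"
    by (rule sum.cong) auto
  also have "\<dots> = (\<Sum>w\<in>W. (if snd w = y \<and> t \<otimes> inv (fst w) \<in> S then c (t \<otimes> inv (fst w)) else 0) * x w)"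
    by (rule sum.mono_neutral_left[OF W(1)]) auto
  finally show ?thesis .
qed

lemma sum_cop_apply:
  assumes "S \<subseteq> carrier G" "\<And>s. s \<in> S \<Longrightarrow> F s \<in> C0 Y" "t \<in> carrier G" "y \<in> topspace Y"
  shows "ell2_apply (blinfun_apply (\<Sum>s\<in>S. cop (F s) s) x) (t, y) = (\<Sum>s\<in>S. F s (\<beta> t y) * ell2_apply x (inv s \<otimes> t, y))"
  unfolding blinfun_apply_sum ell2_apply_sum
proof (rule sum.cong[OF refl])
  fix s assume s: "s \<in> S"
  then have "s \<in> carrier G" using assms(1) by blast
  from cop_apply_C0[OF this assms(2)[OF s]]
  show "ell2_apply (blinfun_apply (cop (F s) s) x) (t, y) = F s (\<beta> t y) * ell2_apply x (inv s \<otimes> t, y)"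
    using assms(3,4) by simp
qed

lemma sum_cop_outside:
  assumes "S \<subseteq> carrier G" "\<And>s. s \<in> S \<Longrightarrow> F s \<in> C0 Y" "w \<notin> carrier G \<times> topspace Y"
  shows "ell2_apply (blinfun_apply (\<Sum>s\<in>S. cop (F s) s) x) w = 0"
  unfolding blinfun_apply_sum ell2_apply_sum
proof (rule sum.neutral, rule ballI)
  fix s assume s: "s \<in> S"
  then have sG: "s \<in> carrier G" using assms(1) by blast
  obtain t y where "w = (t, y)" by (cases w)
  then show "ell2_apply (blinfun_apply (cop (F s) s) x) w = 0"
    using cop_apply_C0[OF sG assms(2)[OF s], of x t y] assms(3) by (cases "t \<in> carrier G \<and> y \<in> topspace Y") auto
qed

text \<open>The matrix entry of the operator between (r,y) and (t,y) is the coefficient at t r^(-1),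
  evaluated at \<beta>(t)y. Multiplying the coefficients by \<phi> is therefore the Schur multiplier
  of \<phi>, and norms can be tested on finite sections.\<close>

lemma norm_multiplier_le:
  assumes \<phi>: "cb_bound G \<phi> K" and S: "finite S" "S \<subseteq> carrier G" and F: "\<And>s. s \<in> S \<Longrightarrow> F s \<in> C0 Y"
  shows "norm (\<Sum>s\<in>S. cop (\<lambda>y. \<phi> s * F s y) s) \<le> K * norm (\<Sum>s\<in>S. cop (F s) s)" (is "norm ?T' \<le> K * norm ?T")
proof (rule norm_blinfun_bound, goal_cases)
  have K: "0 \<le> K" using \<phi> unfolding cb_bound_def by blast
  case 1 then show ?case using K by simp
  case (2 x)
  have F': "(\<lambda>y. \<phi> s * F s y) \<in> C0 Y" if "s \<in> S" for s by (rule fca_scale[OF C0_algebra F[OF that]])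
  show ?case
  proof (rule norm_ell2_leI)
    show "0 \<le> K * norm ?T * norm x" using K by simp
    fix Q :: "('g \<times> 'y) set" assume Q: "finite Q"
    let ?Q = "Q \<inter> (carrier G \<times> topspace Y)"
    \<comment> \<open>\<open>W\<close> holds the tested output coordinates and every input
      coordinate they depend on, so on \<open>?Q\<close> the finite section computes the operator
      exactly.\<close>
    define W where "W = ?Q \<union> (\<lambda>((t, y), s). (inv s \<otimes> t, y)) ` (?Q \<times> S)"
    have W: "finite W" "W \<subseteq> carrier G \<times> topspace Y" using Q S by (auto simp: W_def)
    define m where "m v w = (if snd w = snd v \<and> fst v \<otimes> inv (fst w) \<in> S
        then F (fst v \<otimes> inv (fst w)) (\<beta> (fst v) (snd v)) else 0)" for v w :: "'g \<times> 'y"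
    have b: "matrix_bound W m (norm ?T)"
      unfolding matrix_bound_def
    proof
      fix z :: "'g \<times> 'y \<Rightarrow> complex"
      let ?z = "finvec W z"
      have z: "ell2_apply ?z w = (if w \<in> W then z w else 0)" for w by (rule finvec_apply[OF W(1)])
      have "(\<Sum>w\<in>W. m v w * z w) = ell2_apply (blinfun_apply ?T ?z) v" if v: "v \<in> W" for v
      proof -
        obtain t y where v': "v = (t, y)" "t \<in> carrier G" "y \<in> topspace Y" using v W(2) by blast
        have "ell2_apply (blinfun_apply ?T ?z) v = (\<Sum>s\<in>S. F s (\<beta> t y) * ell2_apply ?z (inv s \<otimes> t, y))"
          unfolding v'(1) by (rule sum_cop_apply[OF S(2) F v'(2,3)])
        also have "\<dots> = (\<Sum>w\<in>W. (if snd w = y \<and> t \<otimes> inv (fst w) \<in> S then F (t \<otimes> inv (fst w)) (\<beta> t y) else 0) * ell2_apply ?z w)"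
          by (rule finite_sum_as_matrix[OF S W v'(2)]) (simp add: z)
        also have "\<dots> = (\<Sum>w\<in>W. m v w * z w)"
          by (rule sum.cong) (simp_all add: z m_def v'(1))
        finally show ?thesis by simp
      qed
      then have "(\<Sum>v\<in>W. (cmod (\<Sum>w\<in>W. m v w * z w))\<^sup>2) = (\<Sum>v\<in>W. (cmod (ell2_apply (blinfun_apply ?T ?z) v))\<^sup>2)"
        by (intro sum.cong refl) simp
      also have "\<dots> \<le> (norm (blinfun_apply ?T ?z))\<^sup>2" by (rule ell2_finite_sum_le[OF W(1)])
      also have "\<dots> \<le> (norm ?T * norm ?z)\<^sup>2" by (intro power_mono norm_blinfun) simp
      also have "\<dots> = (norm ?T)\<^sup>2 * (\<Sum>w\<in>W. (cmod (z w))\<^sup>2)"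
        by (simp only: power_mult_distrib norm_finvec[OF W(1)])
      finally show "(\<Sum>v\<in>W. (cmod (\<Sum>w\<in>W. m v w * z w))\<^sup>2) \<le> (norm ?T)\<^sup>2 * (\<Sum>w\<in>W. (cmod (z w))\<^sup>2)" .
    qed
    have b': "matrix_bound W (\<lambda>v w. \<phi> (fst v \<otimes> inv (fst w)) * m v w) (K * norm ?T)"
      by (rule cb_bound_Schur_multiplier[OF \<phi> W(1) _ b norm_ge_zero]) (use W(2) in auto)
    let ?x = "\<lambda>w. if w \<in> W then ell2_apply x w else 0"
    have entry: "ell2_apply (blinfun_apply ?T' x) v = (\<Sum>w\<in>W. (\<phi> (fst v \<otimes> inv (fst w)) * m v w) * ?x w)" if v: "v \<in> ?Q" for v
    proof -
      obtain t y where v': "v = (t, y)" "t \<in> carrier G" "y \<in> topspace Y" using v by blast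
      have "ell2_apply (blinfun_apply ?T' x) v = (\<Sum>s\<in>S. (\<phi> s * F s (\<beta> t y)) * ell2_apply x (inv s \<otimes> t, y))"
        unfolding v'(1) by (rule sum_cop_apply[OF S(2) F' v'(2,3)])
      also have "\<dots> = (\<Sum>s\<in>S. (\<phi> s * F s (\<beta> t y)) * ?x (inv s \<otimes> t, y))"
      proof (rule sum.cong[OF refl])
        fix s assume "s \<in> S"
        then have "(inv s \<otimes> t, y) \<in> W" using v unfolding W_def v'(1) by (intro UnI2 image_eqI[of _ _ "((t, y), s)"]) auto
        then show "(\<phi> s * F s (\<beta> t y)) * ell2_apply x (inv s \<otimes> t, y) = (\<phi> s * F s (\<beta> t y)) * ?x (inv s \<otimes> t, y)" by simp
      qed
      also have "\<dots> = (\<Sum>w\<in>W. (if snd w = y \<and> t \<otimes> inv (fst w) \<in> S then \<phi> (t \<otimes> inv (fst w)) * F (t \<otimes> inv (fst w)) (\<beta> t y) else 0) * ?x w)"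
        by (rule finite_sum_as_matrix[OF S W v'(2)]) simp
      also have "\<dots> = (\<Sum>w\<in>W. (\<phi> (fst v \<otimes> inv (fst w)) * m v w) * ?x w)"
        by (rule sum.cong) (simp_all add: m_def v'(1))
      finally show ?thesis .
    qed
    have "(\<Sum>v\<in>Q. (cmod (ell2_apply (blinfun_apply ?T' x) v))\<^sup>2) = (\<Sum>v\<in>?Q. (cmod (ell2_apply (blinfun_apply ?T' x) v))\<^sup>2)"
      by (rule sum.mono_neutral_right[OF Q]) (use sum_cop_outside[OF S(2) F'] in auto)
    also have "\<dots> = (\<Sum>v\<in>?Q. (cmod (\<Sum>w\<in>W. (\<phi> (fst v \<otimes> inv (fst w)) * m v w) * ?x w))\<^sup>2)"
      by (rule sum.cong[OF refl]) (simp only: entry)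
    also have "\<dots> \<le> (\<Sum>v\<in>W. (cmod (\<Sum>w\<in>W. (\<phi> (fst v \<otimes> inv (fst w)) * m v w) * ?x w))\<^sup>2)"
      by (rule sum_mono2[OF W(1)]) (auto simp: W_def)
    also have "\<dots> \<le> (K * norm ?T)\<^sup>2 * (\<Sum>w\<in>W. (cmod (?x w))\<^sup>2)" by (rule matrix_boundD[OF b'])
    also have "(\<Sum>w\<in>W. (cmod (?x w))\<^sup>2) = (\<Sum>w\<in>W. (cmod (ell2_apply x w))\<^sup>2)" by (rule sum.cong) auto
    also have "(K * norm ?T)\<^sup>2 * \<dots> \<le> (K * norm ?T)\<^sup>2 * (norm x)\<^sup>2"
      by (intro mult_left_mono ell2_finite_sum_le W) simp
    finally show "(\<Sum>v\<in>Q. (cmod (ell2_apply (blinfun_apply ?T' x) v))\<^sup>2) \<le> (K * norm ?T * norm x)\<^sup>2"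
      by (simp only: power_mult_distrib)
  qed
qed

text \<open>Intended for finite sums, whose support is finite. Over an infinite support the sum
  takes the default value 0.\<close>

definition multiplier_map :: "('g \<Rightarrow> complex) \<Rightarrow> (('g \<times> 'y) ell2 \<Rightarrow>\<^sub>L ('g \<times> 'y) ell2) \<Rightarrow> (('g \<times> 'y) ell2 \<Rightarrow>\<^sub>L ('g \<times> 'y) ell2)" where
  "multiplier_map \<phi> T = (\<Sum>s\<in>supp T. cscale (\<phi> s) (cop (coefficient s T) s))"

text \<open>The index set is flexible: a common support of two operators gives additivity, and the
  support of a finitely supported \<phi> gives one sum for all approximants.\<close>

lemma multiplier_map_eq:
  assumes S: "finite S" "S \<subseteq> carrier G" and supp: "\<And>s. s \<in> carrier G \<Longrightarrow> s \<notin> S \<Longrightarrow> \<phi> s = 0 \<or> coefficient s T = (\<lambda>_. 0)"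
    and fin: "finite (supp T)"
  shows "multiplier_map \<phi> T = (\<Sum>s\<in>S. cscale (\<phi> s) (cop (coefficient s T) s))"
proof -
  let ?P = "(supp T)"
  have z: "cscale 0 U = 0" for U :: "('g \<times> 'y) ell2 \<Rightarrow>\<^sub>L ('g \<times> 'y) ell2" using cscale_of_real[of 0 U] by simp
  have z': "cscale c 0 = (0 :: ('g \<times> 'y) ell2 \<Rightarrow>\<^sub>L ('g \<times> 'y) ell2)" for c
    using cscale_scaleR[of c 0 "0 :: ('g \<times> 'y) ell2 \<Rightarrow>\<^sub>L ('g \<times> 'y) ell2"] by simp
  have "multiplier_map \<phi> T = (\<Sum>s\<in>?P \<union> S. cscale (\<phi> s) (cop (coefficient s T) s))"
    unfolding multiplier_map_def by (rule sum.mono_neutral_left) (use S fin cop_zero z' in auto)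
  also have "\<dots> = (\<Sum>s\<in>S. cscale (\<phi> s) (cop (coefficient s T) s))"
  proof (rule sum.mono_neutral_right)
    show "\<forall>s\<in>(?P \<union> S) - S. cscale (\<phi> s) (cop (coefficient s T) s) = 0"
    proof
      fix s assume "s \<in> (?P \<union> S) - S"
      then have "\<phi> s = 0" using supp by blast
      then show "cscale (\<phi> s) (cop (coefficient s T) s) = 0" by (simp only: z)
    qed
  qed (use S fin in auto)
  finally show ?thesis .
qed

lemma multiplier_map_diff:
  assumes T: "T \<in> finite_sums (C0 Y)" "U \<in> finite_sums (C0 Y)"
  shows "T - U \<in> finite_sums (C0 Y)" "multiplier_map \<phi> (T - U) = multiplier_map \<phi> T - multiplier_map \<phi> U"
proof -
  note C = C0_algebra[of Y]
  have "cscale (complex_of_real (-1)) U \<in> finite_sums (C0 Y)" by (rule finite_sums_cscale[OF C T(2)])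
  from finite_sums_add[OF C T(1) this] show TU: "T - U \<in> finite_sums (C0 Y)" unfolding cscale_of_real by simp
  let ?S = "(supp T) \<union> (supp U)"
  have S: "finite ?S" "?S \<subseteq> carrier G" using finite_supp[OF T(1) C0_algebra] finite_supp[OF T(2) C0_algebra] by auto
  have co: "coefficient s (T - U) = (\<lambda>y. coefficient s T y - coefficient s U y)" for s
    by (rule ext) (rule coefficient_diff)
  have inC: "coefficient s T \<in> C0 Y" "coefficient s U \<in> C0 Y" if "s \<in> carrier G" for s
    by (rule finite_sums_coefficient[OF T(1) C that] finite_sums_coefficient[OF T(2) C that])+
  have "multiplier_map \<phi> (T - U) = (\<Sum>s\<in>?S. cscale (\<phi> s) (cop (coefficient s (T - U)) s))"
    by (rule multiplier_map_eq[OF S _ finite_supp[OF TU C0_algebra]]) (auto simp: co)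
  also have "\<dots> = (\<Sum>s\<in>?S. cscale (\<phi> s) (cop (coefficient s T) s) - cscale (\<phi> s) (cop (coefficient s U) s))"
  proof (rule sum.cong[OF refl])
    fix s assume "s \<in> ?S"
    then have s: "s \<in> carrier G" by blast
    show "cscale (\<phi> s) (cop (coefficient s (T - U)) s) = cscale (\<phi> s) (cop (coefficient s T) s) - cscale (\<phi> s) (cop (coefficient s U) s)"
      unfolding co cop_diff[OF s inC(1)[OF s] inC(2)[OF s]] cscale_diff_right ..
  qed
  also have "\<dots> = multiplier_map \<phi> T - multiplier_map \<phi> U"
    unfolding sum_subtractf
    by (subst (1 2) multiplier_map_eq[OF S]) (use finite_supp[OF T(1) C0_algebra] finite_supp[OF T(2) C0_algebra] in auto)
  finally show "multiplier_map \<phi> (T - U) = multiplier_map \<phi> T - multiplier_map \<phi> U" .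
qed

lemma norm_multiplier_map_le:
  assumes \<phi>: "cb_bound G \<phi> K" and T: "T \<in> finite_sums (C0 Y)"
  shows "norm (multiplier_map \<phi> T) \<le> K * norm T"
proof -
  have S: "finite (supp T)" "supp T \<subseteq> carrier G" by (auto intro: finite_supp[OF T C0_algebra])
  have inC: "coefficient s T \<in> C0 Y" if "s \<in> supp T" for s
    using that by (intro finite_sums_coefficient[OF T C0_algebra]) blast
  have "multiplier_map \<phi> T = (\<Sum>s\<in>supp T. cop (\<lambda>y. \<phi> s * coefficient s T y) s)"
    unfolding multiplier_map_def
    by (rule sum.cong[OF refl]) (use inC in \<open>auto intro!: cop_cscale[symmetric]\<close>)
  then have "norm (multiplier_map \<phi> T) \<le> K * norm (\<Sum>s\<in>supp T. cop (coefficient s T) s)"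
    using norm_multiplier_le[OF \<phi> S inC] by simp
  then show ?thesis by (simp only: finite_sums_expand[OF T C0_algebra S(1) subset_refl S(2), symmetric])
qed

lemma multiplier_map_one:
  assumes T: "T \<in> finite_sums (C0 Y)"
  shows "multiplier_map (indicator (carrier G)) T = T"
proof -
  have "multiplier_map (indicator (carrier G)) T = (\<Sum>s\<in>supp T. cop (coefficient s T) s)"
    unfolding multiplier_map_def
    by (rule sum.cong[OF refl]) (use cscale_of_real[of 1] in \<open>auto simp: indicator_def\<close>)
  also have "\<dots> = T" by (rule finite_sums_expand[OF T C0_algebra, symmetric]) (auto intro: finite_supp[OF T C0_algebra])
  finally show ?thesis .
qed

text \<open>The functional \<open>\<phi> \<mapsto> \<omega> (M\<^sub>\<phi> T)\<close> on \<open>M\<^sub>0A(\<Gamma>)\<close>, with \<open>M\<^sub>\<phi> T\<close> defined by approximating \<open>T\<close>,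
  lies in \<open>Q(\<Gamma>)\<close>; by the approximation property it cannot vanish on all finitely supported \<open>\<phi>\<close> unless
  it vanishes at the constant function 1.\<close>

lemma approximation_property_Fourier:
  assumes AP: "approximation_property G" and T: "T \<in> cp (C0 Y)"
    and V: "op_cstar_algebra V" and coeff: "\<And>s. s \<in> carrier G \<Longrightarrow> cop (coefficient s T) s \<in> V"
  shows "T \<in> V"
proof (rule ccontr)
  assume "T \<notin> V"
  note C = C0_algebra[of Y]
  obtain h :: "(('g \<times> 'y) ell2 \<Rightarrow>\<^sub>L ('g \<times> 'y) ell2) \<Rightarrow> real" where h: "bounded_linear h" "\<And>U. U \<in> V \<Longrightarrow> h U = 0" "h T = 1"
    by (rule functional_separating_closed_subspace[OF oca_subspace[OF V] oca_closed[OF V] \<open>T \<notin> V\<close>]) (rule that)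
  \<comment> \<open>The usual complexification h(U) - \<i> h(\<i>U) of a real functional; it
    vanishes on \<open>V\<close> because \<open>V\<close> is a complex subspace.\<close>
  define \<omega> where "\<omega> U = Complex (h U) (- h (cscale \<i> U))" for U
  have h_lin: "h (U + U') = h U + h U'" "h (U - U') = h U - h U'" "h (r *\<^sub>R U) = r * h U" for U U' r
    using linear_simps[OF h(1)] by auto
  have \<omega>_diff: "\<omega> (U - U') = \<omega> U - \<omega> U'" for U U'
    by (simp add: \<omega>_def complex_eq_iff cscale_diff_right h_lin)
  have \<omega>_add: "\<omega> (U + U') = \<omega> U + \<omega> U'" for U U'
    by (simp add: \<omega>_def complex_eq_iff cscale_add_right h_lin)
  have \<omega>_zero: "\<omega> 0 = 0" using \<omega>_diff[of 0 0] by simp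
  have \<omega>_sum: "\<omega> (\<Sum>k\<in>P. U k) = (\<Sum>k\<in>P. \<omega> (U k))" for P :: "'g set" and U
    by (induction P rule: infinite_finite_induct) (simp_all add: \<omega>_zero \<omega>_add)
  have \<omega>_cscale: "\<omega> (cscale c U) = c * \<omega> U" for c U
  proof -
    have dec: "h (cscale d U) = Re d * h U + Im d * h (cscale \<i> U)" for d
    proof -
      have "cscale d U = Re d *\<^sub>R U + Im d *\<^sub>R cscale \<i> U"
        by (rule blinfun_ell2_eqI)
           (simp add: cscale_apply blinfun.add_left blinfun.scaleR_left plus_ell2.rep_eq scaleR_ell2.rep_eq
             complex_eq_iff algebra_simps)
      then show ?thesis by (simp add: h_lin)
    qed
    show ?thesis
      unfolding \<omega>_def cscale_cscale dec[of c] dec[of "\<i> * c"] by (simp add: complex_eq_iff algebra_simps)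
  qed
  have \<omega>V: "\<omega> U = 0" if "U \<in> V" for U
    using h(2)[OF that] h(2)[OF oca_cscale[OF V that, of \<i>]] by (simp add: \<omega>_def complex_eq_iff)
  obtain B0 where B0: "0 < B0" "\<And>U. norm (h U) \<le> norm U * B0" using bounded_linear.pos_bounded[OF h(1)] by blast
  have \<omega>_norm: "cmod (\<omega> U) \<le> (2 * B0) * norm U" for U
  proof -
    have "norm (cscale \<i> U) \<le> norm U" using norm_cscale_le[of \<i> U] by simp
    then have "norm (cscale \<i> U) * B0 \<le> norm U * B0" using B0(1) by (intro mult_right_mono) auto
    then have "\<bar>h (cscale \<i> U)\<bar> \<le> norm U * B0" using B0(2)[of "cscale \<i> U"] by simp
    moreover have "\<bar>h U\<bar> \<le> norm U * B0" using B0(2)[of U] by simp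
    moreover have "cmod (\<omega> U) \<le> \<bar>h U\<bar> + \<bar>h (cscale \<i> U)\<bar>" using cmod_le[of "\<omega> U"] by (simp add: \<omega>_def)
    moreover have "norm U * B0 + norm U * B0 = (2 * B0) * norm U" by simp
    ultimately show ?thesis by linarith
  qed
  let ?B = "2 * B0"
  have "T \<in> closure (finite_sums (C0 Y))" using T by (simp only: crossed_product_eq[OF C])
  then obtain U where U: "\<And>n::nat. U n \<in> finite_sums (C0 Y)" "U \<longlonglongrightarrow> T"
    unfolding closure_sequential by blast
  \<comment> \<open>The limit over n is the candidate functional of \<phi>. The next estimate shows
    that convergence is uniform relative to the multiplier norm.\<close>
  define a where "a \<phi> n = \<omega> (multiplier_map \<phi> (U n))" for \<phi> n
  have a_diff: "cmod (a \<phi> m - a \<phi> n) \<le> ?B * K * norm (U m - U n)" if "cb_bound G \<phi> K" for \<phi> K m n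
  proof -
    have "cmod (a \<phi> m - a \<phi> n) = cmod (\<omega> (multiplier_map \<phi> (U m - U n)))"
      unfolding a_def multiplier_map_diff(2)[OF U(1) U(1)] \<omega>_diff ..
    also have "\<dots> \<le> ?B * norm (multiplier_map \<phi> (U m - U n))" by (rule \<omega>_norm)
    also have "\<dots> \<le> ?B * (K * norm (U m - U n))"
      by (intro mult_left_mono norm_multiplier_map_le[OF that] multiplier_map_diff(1) U(1)) (use B0(1) in simp)
    finally show ?thesis by (simp only: mult.assoc)
  qed
  have Ucauchy: "\<exists>N. \<forall>m\<ge>N. \<forall>n\<ge>N. norm (U m - U n) < e" if "0 < e" for e
    using LIMSEQ_imp_Cauchy[OF U(2)] that unfolding Cauchy_iff by blast
  have a_conv: "a \<phi> \<longlonglongrightarrow> lim (a \<phi>)" if "\<phi> \<in> M0A G" for \<phi>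
  proof -
    obtain K where K: "cb_bound G \<phi> K" using \<open>\<phi> \<in> M0A G\<close> unfolding M0A_def by blast
    have K0: "0 \<le> K" using K unfolding cb_bound_def by blast
    have "Cauchy (a \<phi>)"
      unfolding Cauchy_iff
    proof (intro allI impI)
      fix e :: real assume e: "0 < e"
      \<comment> \<open>The added 1 keeps the denominator positive when \<open>K\<close> is
        0.\<close>
      let ?d = "e / (?B * K + 1)"
      have pos: "0 < ?B * K + 1" using B0(1) K0 by (intro add_nonneg_pos) auto
      then have "0 < ?d" using e by simp
      from Ucauchy[OF this] obtain N where N: "\<forall>m\<ge>N. \<forall>n\<ge>N. norm (U m - U n) < ?d" by (rule exE)
      have "norm (a \<phi> m - a \<phi> n) < e" if "N \<le> m" "N \<le> n" for m n
      proof -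
        have "norm (U m - U n) < ?d" using N that by blast
        then have "(?B * K + 1) * norm (U m - U n) < e" using pos by (simp add: pos_less_divide_eq mult.commute)
        moreover have "?B * K * norm (U m - U n) \<le> (?B * K + 1) * norm (U m - U n)"
          by (intro mult_right_mono) auto
        ultimately show ?thesis using a_diff[OF K, of m n] by linarith
      qed
      then show "\<exists>M. \<forall>m\<ge>M. \<forall>n\<ge>M. norm (a \<phi> m - a \<phi> n) < e" by blast
    qed
    then show ?thesis by (simp add: Cauchy_convergent_iff convergent_LIMSEQ_iff)
  qed
  have Q: "(\<lambda>\<phi>. lim (a \<phi>)) \<in> Q_space G"
    unfolding Q_space_def
  proof (intro CollectI allI impI)
    fix e :: real assume e: "0 < e"
    then have "0 < e / ?B" using B0(1) by simp
    from Ucauchy[OF this] obtain N where N: "\<forall>m\<ge>N. \<forall>n\<ge>N. norm (U m - U n) < e / ?B" by (rule exE)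
    let ?P = "(supp (U N))"
    have P: "finite ?P" by (rule finite_supp[OF U(1) C0_algebra])
    \<comment> \<open>A finitely supported function whose pairing with \<phi> is exactly the N-th
      term of the sequence; complex linearity of \<omega> is used here.\<close>
    define f where "f s = (if s \<in> ?P then \<omega> (cop (coefficient s (U N)) s) else 0)" for s
    have "(\<lambda>s. cmod (f s)) summable_on carrier G"
      by (subst summable_on_cong_neutral[where T = ?P and g = "\<lambda>s. cmod (f s)"]) (auto simp: f_def P)
    moreover have "cmod (lim (a \<phi>) - (\<Sum>\<^sub>\<infinity>s\<in>carrier G. f s * \<phi> s)) \<le> e * M0A_norm G \<phi>" if \<phi>: "\<phi> \<in> M0A G" for \<phi>
    proof -
      have "(\<Sum>\<^sub>\<infinity>s\<in>carrier G. f s * \<phi> s) = (\<Sum>\<^sub>\<infinity>s\<in>?P. f s * \<phi> s)"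
        by (rule infsum_cong_neutral) (auto simp: f_def)
      also have "\<dots> = (\<Sum>s\<in>?P. f s * \<phi> s)" using P by simp
      also have "\<dots> = a \<phi> N"
        unfolding a_def multiplier_map_def \<omega>_sum by (rule sum.cong) (simp_all add: f_def \<omega>_cscale)
      finally have sum: "(\<Sum>\<^sub>\<infinity>s\<in>carrier G. f s * \<phi> s) = a \<phi> N" .
      \<comment> \<open>Dividing by \<open>e\<close> makes the left side a lower bound for all
        admissible \<open>K\<close>, so it passes to their infimum, the multiplier norm.\<close>
      have "cmod (lim (a \<phi>) - a \<phi> N) / e \<le> K" if K: "cb_bound G \<phi> K" for K
      proof -
        have K0: "0 \<le> K" using K unfolding cb_bound_def by blast
        have "(\<lambda>n. cmod (a \<phi> n - a \<phi> N)) \<longlonglongrightarrow> cmod (lim (a \<phi>) - a \<phi> N)"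
          by (intro tendsto_norm tendsto_diff a_conv[OF \<phi>] tendsto_const)
        moreover have "cmod (a \<phi> n - a \<phi> N) \<le> e * K" if "N \<le> n" for n
        proof -
          have "norm (U n - U N) < e / ?B" using N that by blast
          then have "norm (U n - U N) * ?B < e" using B0(1) by (simp only: pos_less_divide_eq[of ?B] mult_pos_pos zero_less_numeral)
          then have "norm (U n - U N) * ?B * K \<le> e * K" using K0 by (intro mult_right_mono) auto
          then show ?thesis using a_diff[OF K, of n N] by (simp add: ac_simps)
        qed
        ultimately have "cmod (lim (a \<phi>) - a \<phi> N) \<le> e * K"
          by (intro LIMSEQ_le_const2) blast+
        then show ?thesis using e by (simp add: pos_divide_le_eq mult.commute)
      qed
      moreover have "{K. cb_bound G \<phi> K} \<noteq> {}" using \<phi> unfolding M0A_def by blast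
      ultimately have "cmod (lim (a \<phi>) - a \<phi> N) / e \<le> M0A_norm G \<phi>"
        unfolding M0A_norm_def by (intro cInf_greatest) auto
      then show ?thesis unfolding sum using e by (simp add: pos_divide_le_eq mult.commute)
    qed
    ultimately show "\<exists>f. (\<lambda>s. cmod (f s)) summable_on carrier G \<and>
       (\<forall>\<phi>\<in>M0A G. cmod (lim (a \<phi>) - (\<Sum>\<^sub>\<infinity>s\<in>carrier G. f s * \<phi> s)) \<le> e * M0A_norm G \<phi>)" by blast
  qed
  \<comment> \<open>Only finitely many coefficients enter. Those of the approximants converge to
    those of \<open>T\<close>, whose terms lie in \<open>V\<close> and are killed by
    \<omega>.\<close>
  have fin: "lim (a \<phi>) = 0" if \<phi>: "\<phi> \<in> M0A G" and fin: "finite {s. \<phi> s \<noteq> 0}" for \<phi>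
  proof -
    let ?S = "{s. \<phi> s \<noteq> 0}"
    have SG: "?S \<subseteq> carrier G" using \<phi> unfolding M0A_def by blast
    have an: "a \<phi> n = (\<Sum>s\<in>?S. \<phi> s * \<omega> (cop (coefficient s (U n)) s))" for n
    proof -
      have "multiplier_map \<phi> (U n) = (\<Sum>s\<in>?S. cscale (\<phi> s) (cop (coefficient s (U n)) s))"
        by (rule multiplier_map_eq[OF fin SG _ finite_supp[OF U(1) C0_algebra]]) simp
      then show ?thesis by (simp only: a_def \<omega>_sum \<omega>_cscale)
    qed
    have "(\<lambda>n. \<omega> (cop (coefficient s (U n)) s)) \<longlonglongrightarrow> 0" if s: "s \<in> carrier G" for s
    proof (rule Lim_null_comparison)
      show "(\<lambda>n. ?B * norm (U n - T)) \<longlonglongrightarrow> 0"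
        using tendsto_mult_right_zero[OF tendsto_norm_zero[OF LIM_zero[OF U(2)]], of ?B] by simp
      have "norm (\<omega> (cop (coefficient s (U n)) s)) \<le> ?B * norm (U n - T)" for n
      proof -
        have TC: "coefficient s T \<in> C0 Y" by (rule coefficient_limit[OF C T s])
        have "U n \<in> cp (C0 Y)"
          unfolding crossed_product_eq[OF C] by (rule subsetD[OF closure_subset U(1)])
        then have UC: "coefficient s (U n) \<in> C0 Y" by (rule coefficient_limit[OF C _ s])
        have "\<omega> (cop (coefficient s (U n)) s) = \<omega> (cop (coefficient s (U n)) s - cop (coefficient s T) s)"
          unfolding \<omega>_diff using \<omega>V[OF coeff[OF s]] by simp
        also have "norm \<dots> \<le> ?B * norm (cop (coefficient s (U n)) s - cop (coefficient s T) s)" by (rule \<omega>_norm)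
        also have "\<dots> \<le> ?B * norm (U n - T)"
        proof (rule mult_left_mono)
          show "norm (cop (coefficient s (U n)) s - cop (coefficient s T) s) \<le> norm (U n - T)"
            unfolding cop_diff[OF s UC TC, symmetric]
          proof (rule norm_cop_le[OF s])
            show "cmod (coefficient s (U n) y - coefficient s T y) \<le> norm (U n - T)" for y
              using norm_coefficient_le[of s "U n - T" y] by (simp only: coefficient_diff)
          qed simp
        qed (use B0(1) in simp)
        finally show ?thesis .
      qed
      then show "\<forall>\<^sub>F n in sequentially. norm (\<omega> (cop (coefficient s (U n)) s)) \<le> ?B * norm (U n - T)" by simp
    qed
    then have "a \<phi> \<longlonglongrightarrow> (\<Sum>s\<in>?S. \<phi> s * 0)"
      unfolding an using SG by (intro tendsto_sum tendsto_mult tendsto_const) blast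
    then show ?thesis by (simp add: limI)
  qed
  have one: "lim (a (indicator (carrier G))) = \<omega> T"
  proof -
    have "(\<lambda>n. \<omega> (U n)) \<longlonglongrightarrow> \<omega> T"
    proof (rule LIM_zero_cancel, rule Lim_null_comparison)
      show "(\<lambda>n. ?B * norm (U n - T)) \<longlonglongrightarrow> 0"
        using tendsto_mult_right_zero[OF tendsto_norm_zero[OF LIM_zero[OF U(2)]], of ?B] by simp
      show "\<forall>\<^sub>F n in sequentially. norm (\<omega> (U n) - \<omega> T) \<le> ?B * norm (U n - T)"
        unfolding \<omega>_diff[symmetric] using \<omega>_norm by simp
    qed
    then show ?thesis unfolding a_def multiplier_map_one[OF U(1)] by (rule limI)
  qed
  \<comment> \<open>Radius 1 suffices: the real part of \<omega> at \<open>T\<close> is 1, whereas a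
    finitely supported multiplier gives the value 0.\<close>
  let ?N = "{\<phi>\<in>M0A G. lim (a \<phi>) \<in> ball (\<omega> T) 1}"
  have cl: "indicator (carrier G) \<in> M0A_weak_topology G closure_of {\<phi>\<in>M0A G. finite {s. \<phi> s \<noteq> 0}}"
    using AP unfolding approximation_property_def .
  have open_N: "openin (M0A_weak_topology G) ?N"
    unfolding M0A_weak_topology_def
    by (rule topology_generated_by_Basis) (intro CollectI exI conjI, rule refl, rule Q, rule open_ball)
  have "indicator (carrier G) \<in> topspace (M0A_weak_topology G)"
    using cl unfolding in_closure_of by (rule conjunct1)
  then have "indicator (carrier G) \<in> M0A G"
    unfolding M0A_weak_topology_def topology_generated_by_topspace by blast
  then have "indicator (carrier G) \<in> ?N" by (simp add: one)
  from cl[unfolded in_closure_of, THEN conjunct2, THEN spec, THEN mp, OF conjI[OF this open_N]]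
  obtain \<phi> where \<phi>: "\<phi> \<in> M0A G" "finite {s. \<phi> s \<noteq> 0}" "lim (a \<phi>) \<in> ball (\<omega> T) 1"
    by (elim exE conjE CollectE)
  then have "0 \<in> ball (\<omega> T) 1" unfolding fin[OF \<phi>(1,2)] by simp
  then have "cmod (\<omega> T) < 1" by simp
  moreover have "Re (\<omega> T) = 1" by (simp add: \<omega>_def h(3))
  ultimately show False using complex_Re_le_cmod[of "\<omega> T"] by simp
qed

end

section \<open>Lattices of subalgebras\<close>

text \<open>In both lattices the order is inclusion and the meet is intersection, so the join is all
  that has to be axiomatised.\<close>

definition closed_under_lub :: "'a set set \<Rightarrow> ('a set \<Rightarrow> 'a set \<Rightarrow> 'a set) \<Rightarrow> bool" where
  "closed_under_lub \<A> jn \<longleftrightarrow> (\<forall>A\<in>\<A>. \<forall>B\<in>\<A>. A \<inter> B \<in> \<A> \<and> jn A B \<in> \<A> \<and> A \<subseteq> jn A B \<and> B \<subseteq> jn A B \<and>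
     (\<forall>C\<in>\<A>. A \<subseteq> C \<longrightarrow> B \<subseteq> C \<longrightarrow> jn A B \<subseteq> C))"

lemma closed_under_lubD:
  assumes "closed_under_lub \<A> jn" "A \<in> \<A>" "B \<in> \<A>"
  shows "A \<inter> B \<in> \<A>" "jn A B \<in> \<A>" "A \<subseteq> jn A B" "B \<subseteq> jn A B"
    and "C \<in> \<A> \<Longrightarrow> A \<subseteq> C \<Longrightarrow> B \<subseteq> C \<Longrightarrow> jn A B \<subseteq> C"
  using assms unfolding closed_under_lub_def by blast+

lemma lattice_ops_of_lub:
  assumes L: "closed_under_lub \<A> jn"
  shows "lattice_ops \<A> jn (\<inter>)"
  unfolding lattice_ops_def
proof (intro conjI ballI)
  fix A B assume A: "A \<in> \<A>" and B: "B \<in> \<A>"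
  note D = closed_under_lubD[OF L]
  show "jn A B \<in> \<A>" "A \<inter> B \<in> \<A>" by (rule D[OF A B])+
  show "jn A B = jn B A"
    by (intro equalityI D(5)[OF A B] D(5)[OF B A] D(2,3,4)[OF A B] D(2,3,4)[OF B A])
  show "A \<inter> B = B \<inter> A" by blast
  have AB: "A \<inter> B \<in> \<A>" by (rule D(1)[OF A B])
  show "jn A (A \<inter> B) = A"
    by (intro equalityI D(5)[OF A AB A] D(3)[OF A AB]) auto
  show "A \<inter> jn A B = A" using D(3)[OF A B] by blast
next
  fix A B C assume A: "A \<in> \<A>" and B: "B \<in> \<A>" and C: "C \<in> \<A>"
  note D = closed_under_lubD[OF L]
  have AB: "jn A B \<in> \<A>" and BC: "jn B C \<in> \<A>" by (rule D(2)[OF A B] D(2)[OF B C])+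
  note 1 = D(3,4)[OF A B] and 2 = D(3,4)[OF B C] and 3 = D(3,4)[OF AB C] and 4 = D(3,4)[OF A BC]
  have ABC: "jn (jn A B) C \<in> \<A>" "jn A (jn B C) \<in> \<A>" by (rule D(2)[OF AB C] D(2)[OF A BC])+
  show "jn (jn A B) C = jn A (jn B C)"
  proof
    have "jn A B \<subseteq> jn A (jn B C)" using D(5)[OF A B ABC(2)] 2 4 by blast
    then show "jn (jn A B) C \<subseteq> jn A (jn B C)" using D(5)[OF AB C ABC(2)] 2 4 by blast
    have "jn B C \<subseteq> jn (jn A B) C" using D(5)[OF B C ABC(1)] 1 3 by blast
    then show "jn A (jn B C) \<subseteq> jn (jn A B) C" using D(5)[OF A BC ABC(1)] 1 3 by blast
  qed
  show "A \<inter> B \<inter> C = A \<inter> (B \<inter> C)" by blast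
qed

lemma lattice_ops_transport:
  assumes \<kappa>: "bij_betw \<kappa> L \<A>" and ops: "lattice_ops \<A> jn mt"
  shows "lattice_ops L (\<lambda>a b. the_inv_into L \<kappa> (jn (\<kappa> a) (\<kappa> b))) (\<lambda>a b. the_inv_into L \<kappa> (mt (\<kappa> a) (\<kappa> b)))"
proof -
  have \<kappa>A: "\<kappa> a \<in> \<A>" if "a \<in> L" for a using \<kappa> that by (rule bij_betw_apply)
  have inv: "the_inv_into L \<kappa> A \<in> L" "\<kappa> (the_inv_into L \<kappa> A) = A" if "A \<in> \<A>" for A
    using \<kappa> that by (auto simp: bij_betw_def intro: the_inv_into_into f_the_inv_into_f)
  have inv': "the_inv_into L \<kappa> (\<kappa> a) = a" if "a \<in> L" for a
    using \<kappa> that by (auto simp: bij_betw_def intro: the_inv_into_f_f)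
  have 1: "jn A B \<in> \<A>" "mt A B \<in> \<A>" "jn A B = jn B A" "mt A B = mt B A" "jn A (mt A B) = A" "mt A (jn A B) = A"
    if "A \<in> \<A>" "B \<in> \<A>" for A B using ops that unfolding lattice_ops_def by blast+
  have 2: "jn (jn A B) C = jn A (jn B C)" "mt (mt A B) C = mt A (mt B C)"
    if "A \<in> \<A>" "B \<in> \<A>" "C \<in> \<A>" for A B C using ops that unfolding lattice_ops_def by blast+
  show ?thesis
    unfolding lattice_ops_def
    using 1(3,4)[OF \<kappa>A \<kappa>A]
    by (intro conjI ballI) (simp_all add: inv inv' 1(1,2,5,6) 2 \<kappa>A)
qed

lemma lattice_isomorphism_of_order_isomorphism:
  assumes \<kappa>: "bij_betw \<kappa> L \<A>" and A: "closed_under_lub \<A> jn" and B: "closed_under_lub \<B> jn'"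
    and \<Psi>: "bij_betw \<Psi> \<A> \<B>" and mono: "\<And>A A'. A \<in> \<A> \<Longrightarrow> A' \<in> \<A> \<Longrightarrow> \<Psi> A \<subseteq> \<Psi> A' \<longleftrightarrow> A \<subseteq> A'"
  shows "lattice_isomorphism L (\<lambda>a b. the_inv_into L \<kappa> (jn (\<kappa> a) (\<kappa> b))) (\<lambda>a b. the_inv_into L \<kappa> (\<kappa> a \<inter> \<kappa> b))
    \<B> jn' (\<inter>) (\<lambda>a. \<Psi> (\<kappa> a))"
  unfolding lattice_isomorphism_def
proof (intro conjI ballI)
  show "lattice_ops L (\<lambda>a b. the_inv_into L \<kappa> (jn (\<kappa> a) (\<kappa> b))) (\<lambda>a b. the_inv_into L \<kappa> (\<kappa> a \<inter> \<kappa> b))"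
    by (rule lattice_ops_transport[OF \<kappa> lattice_ops_of_lub[OF A]])
  show "lattice_ops \<B> jn' (\<inter>)" by (rule lattice_ops_of_lub[OF B])
  show "bij_betw (\<lambda>a. \<Psi> (\<kappa> a)) L \<B>"
    using bij_betw_trans[OF \<kappa> \<Psi>] by (simp add: o_def)
  fix a b assume a: "a \<in> L" and b: "b \<in> L"
  note DA = closed_under_lubD[OF A] and DB = closed_under_lubD[OF B]
  have ab: "\<kappa> a \<in> \<A>" "\<kappa> b \<in> \<A>" using \<kappa> a b by (auto intro: bij_betw_apply)
  have \<Psi>ab: "\<Psi> (\<kappa> a) \<in> \<B>" "\<Psi> (\<kappa> b) \<in> \<B>" using \<Psi> ab by (auto intro: bij_betw_apply)
  have inv: "\<kappa> (the_inv_into L \<kappa> C) = C" if "C \<in> \<A>" for C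
    by (rule f_the_inv_into_f_bij_betw[OF \<kappa> that])
  have surj: "\<exists>C\<in>\<A>. \<Psi> C = D" if "D \<in> \<B>" for D using \<Psi> that by (auto simp: bij_betw_def)
  have "\<Psi> (jn (\<kappa> a) (\<kappa> b)) = jn' (\<Psi> (\<kappa> a)) (\<Psi> (\<kappa> b))"
  proof
    \<comment> \<open>Pulling the join in the target back to \<open>C\<close> makes its upper bound
      property a statement about inclusions in the source.\<close>
    obtain C where C: "C \<in> \<A>" "\<Psi> C = jn' (\<Psi> (\<kappa> a)) (\<Psi> (\<kappa> b))" using surj[OF DB(2)[OF \<Psi>ab]] by blast
    have "\<kappa> a \<subseteq> C" "\<kappa> b \<subseteq> C"
      using DB(3,4)[OF \<Psi>ab] mono[OF ab(1) C(1)] mono[OF ab(2) C(1)] by (simp_all add: C(2))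
    then have "jn (\<kappa> a) (\<kappa> b) \<subseteq> C" by (rule DA(5)[OF ab C(1)])
    then show "\<Psi> (jn (\<kappa> a) (\<kappa> b)) \<subseteq> jn' (\<Psi> (\<kappa> a)) (\<Psi> (\<kappa> b))"
      using mono[OF DA(2)[OF ab] C(1)] by (simp add: C(2))
    have j: "\<Psi> (jn (\<kappa> a) (\<kappa> b)) \<in> \<B>" using \<Psi> DA(2)[OF ab] by (rule bij_betw_apply)
    show "jn' (\<Psi> (\<kappa> a)) (\<Psi> (\<kappa> b)) \<subseteq> \<Psi> (jn (\<kappa> a) (\<kappa> b))"
      by (rule DB(5)[OF \<Psi>ab j]) (use mono ab DA(2,3,4)[OF ab] in auto)
  qed
  then show "\<Psi> (\<kappa> (the_inv_into L \<kappa> (jn (\<kappa> a) (\<kappa> b)))) = jn' (\<Psi> (\<kappa> a)) (\<Psi> (\<kappa> b))"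
    by (simp only: inv[OF DA(2)[OF ab]])
  have "\<Psi> (\<kappa> a \<inter> \<kappa> b) = \<Psi> (\<kappa> a) \<inter> \<Psi> (\<kappa> b)"
  proof
    obtain C where C: "C \<in> \<A>" "\<Psi> C = \<Psi> (\<kappa> a) \<inter> \<Psi> (\<kappa> b)" using surj[OF DB(1)[OF \<Psi>ab]] by blast
    have "C \<subseteq> \<kappa> a \<inter> \<kappa> b" using mono[OF C(1) ab(1)] mono[OF C(1) ab(2)] C(2) by blast
    then show "\<Psi> (\<kappa> a) \<inter> \<Psi> (\<kappa> b) \<subseteq> \<Psi> (\<kappa> a \<inter> \<kappa> b)"
      using mono[OF C(1) DA(1)[OF ab]] C(2) by simp
    show "\<Psi> (\<kappa> a \<inter> \<kappa> b) \<subseteq> \<Psi> (\<kappa> a) \<inter> \<Psi> (\<kappa> b)"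
      using mono[OF DA(1)[OF ab] ab(1)] mono[OF DA(1)[OF ab] ab(2)] by blast
  qed
  then show "\<Psi> (\<kappa> (the_inv_into L \<kappa> (\<kappa> a \<inter> \<kappa> b))) = \<Psi> (\<kappa> a) \<inter> \<Psi> (\<kappa> b)"
    by (simp only: inv[OF DA(1)[OF ab]])
qed

section \<open>The lattices of invariant function algebras and of intermediate operator
  algebras\<close>

lemma fun_cstar_algebra_Inter:
  assumes alg: "\<And>A. A \<in> \<A> \<Longrightarrow> fun_cstar_algebra Y A" and ne: "\<A> \<noteq> {}"
  shows "fun_cstar_algebra Y (\<Inter>\<A>)"
  unfolding fun_cstar_algebra_def
proof (intro conjI ballI allI impI)
  show "\<Inter>\<A> \<subseteq> C0 Y" using ne fca_C0[OF alg] by blast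
  show "(\<lambda>_. 0) \<in> \<Inter>\<A>" using fca_zero[OF alg] by blast
next
  fix f g assume f: "f \<in> \<Inter>\<A>" and g: "g \<in> \<Inter>\<A>"
  show "(\<lambda>y. f y + g y) \<in> \<Inter>\<A>" "(\<lambda>y. f y * g y) \<in> \<Inter>\<A>"
    using f g by (auto intro: fca_add[OF alg] fca_mult[OF alg])
next
  fix c f assume f: "f \<in> \<Inter>\<A>"
  show "(\<lambda>y. c * f y) \<in> \<Inter>\<A>" using f by (auto intro: fca_scale[OF alg])
next
  fix f assume f: "f \<in> \<Inter>\<A>"
  show "(\<lambda>y. cnj (f y)) \<in> \<Inter>\<A>" using f by (auto intro: fca_cnj[OF alg])
next
  fix f assume f: "f \<in> C0 Y" and lim: "\<forall>e>0. \<exists>g\<in>\<Inter>\<A>. \<forall>y\<in>topspace Y. cmod (f y - g y) \<le> e"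
  show "f \<in> \<Inter>\<A>"
  proof
    fix A assume A: "A \<in> \<A>"
    show "f \<in> A"
    proof (rule fca_limit[OF alg[OF A] f])
      fix e :: real assume e: "0 < e"
      from lim[THEN spec, THEN mp, OF e] obtain g where g: "g \<in> \<Inter>\<A>" "\<forall>y\<in>topspace Y. cmod (f y - g y) \<le> e"
        by (rule bexE)
      then show "\<exists>g\<in>A. \<forall>y\<in>topspace Y. cmod (f y - g y) \<le> e" using A by (intro bexI[of _ g]) auto
    qed
  qed
qed

text \<open>Serves to show that the algebra generated by two invariant algebras is invariant,
  without describing its elements.\<close>

lemma (in G_space) fun_cstar_algebra_translate:
  assumes A: "fun_cstar_algebra Y A" and s: "s \<in> carrier G"
  shows "fun_cstar_algebra Y {f \<in> C0 Y. translate Y \<beta> s f \<in> A}" (is "fun_cstar_algebra Y ?B")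
proof -
  note C = C0_algebra[of Y]
  have t0: "translate Y \<beta> s (\<lambda>_. 0) = (\<lambda>_. 0)" by (simp add: translate_def)
  have ta: "translate Y \<beta> s (\<lambda>y. f y + g y) = (\<lambda>y. translate Y \<beta> s f y + translate Y \<beta> s g y)"
    and tm: "translate Y \<beta> s (\<lambda>y. f y * g y) = (\<lambda>y. translate Y \<beta> s f y * translate Y \<beta> s g y)"
    and ts: "translate Y \<beta> s (\<lambda>y. c * f y) = (\<lambda>y. c * translate Y \<beta> s f y)"
    and tc: "translate Y \<beta> s (\<lambda>y. cnj (f y)) = (\<lambda>y. cnj (translate Y \<beta> s f y))" for f g c
    by (auto simp: translate_def)
  have "?B \<subseteq> C0 Y" by blast
  moreover have "(\<lambda>_. 0) \<in> ?B" using fca_zero[OF A] fca_zero[OF C] by (simp add: t0)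
  moreover have "(\<lambda>y. f y + g y) \<in> ?B" "(\<lambda>y. f y * g y) \<in> ?B" if "f \<in> ?B" "g \<in> ?B" for f g
    using that by (auto simp: ta tm intro: fca_add[OF A] fca_mult[OF A] fca_add[OF C] fca_mult[OF C])
  moreover have "(\<lambda>y. c * f y) \<in> ?B" "(\<lambda>y. cnj (f y)) \<in> ?B" if "f \<in> ?B" for c f
    using that by (auto simp: ts tc intro: fca_scale[OF A] fca_cnj[OF A] fca_scale[OF C] fca_cnj[OF C])
  moreover have "f \<in> ?B" if f: "f \<in> C0 Y" and lim: "\<forall>e>0. \<exists>g\<in>?B. \<forall>y\<in>topspace Y. cmod (f y - g y) \<le> e" for f
  proof -
    have "translate Y \<beta> s f \<in> A"
    proof (rule fca_limit[OF A translate_C0[OF s f]])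
      fix e :: real assume e: "0 < e"
      from lim[THEN spec, THEN mp, OF e] obtain g where g: "g \<in> ?B" "\<forall>y\<in>topspace Y. cmod (f y - g y) \<le> e"
        by (rule bexE)
      have "cmod (translate Y \<beta> s f y - translate Y \<beta> s g y) \<le> e" if "y \<in> topspace Y" for y
        using bspec[OF g(2) act_closed[OF s that]] that by (simp add: translate_def)
      then show "\<exists>g\<in>A. \<forall>y\<in>topspace Y. cmod (translate Y \<beta> s f y - g y) \<le> e" using g(1) by blast
    qed
    then show ?thesis using f by blast
  qed
  ultimately show ?thesis unfolding fun_cstar_algebra_def by (intro conjI allI impI ballI)
qed

context proper_factor
begin

lemma invariant_algebraD:
  assumes "A \<in> inv_algs"
  shows "fun_cstar_algebra Y A" "C0_via Y \<pi> X \<subseteq> A" "s \<in> carrier G \<Longrightarrow> f \<in> A \<Longrightarrow> translate Y \<beta> s f \<in> A"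
  using assms unfolding invariant_algebras_def by blast+

lemma closed_under_lub_invariant_algebras:
  "closed_under_lub (inv_algs) (\<lambda>A B. fun_cstar_gen Y (A \<union> B))"
  unfolding closed_under_lub_def
proof (intro ballI conjI impI)
  fix A B assume A: "A \<in> inv_algs" and B: "B \<in> inv_algs"
  note DA = invariant_algebraD[OF A] and DB = invariant_algebraD[OF B]
  have "fun_cstar_algebra Y (\<Inter>{A, B})" by (rule fun_cstar_algebra_Inter) (use DA(1) DB(1) in auto)
  then show "A \<inter> B \<in> inv_algs"
    unfolding invariant_algebras_def using DA(2,3) DB(2,3) by auto
  let ?\<F> = "{C. fun_cstar_algebra Y C \<and> A \<union> B \<subseteq> C}"
  have "C0 Y \<in> ?\<F>" using C0_algebra fca_C0[OF DA(1)] fca_C0[OF DB(1)] by blast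
  then have alg: "fun_cstar_algebra Y (\<Inter>?\<F>)" by (intro fun_cstar_algebra_Inter) blast+
  \<comment> \<open>The functions translated by \<open>s\<close> into \<open>C\<close> form another
    algebra containing \<open>A\<close> and \<open>B\<close>, so the generated algebra lies inside
    it.\<close>
  have inv: "translate Y \<beta> s f \<in> C" if s: "s \<in> carrier G" and f: "f \<in> \<Inter>?\<F>" and C: "C \<in> ?\<F>" for s f C
  proof -
    have "A \<union> B \<subseteq> {f \<in> C0 Y. translate Y \<beta> s f \<in> C}"
      using C DA(3)[OF s] DB(3)[OF s] fca_C0[OF DA(1)] fca_C0[OF DB(1)] by blast
    then have "{f \<in> C0 Y. translate Y \<beta> s f \<in> C} \<in> ?\<F>"
      using Y.fun_cstar_algebra_translate[OF _ s] C by blast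
    then show ?thesis using f by blast
  qed
  show "fun_cstar_gen Y (A \<union> B) \<in> inv_algs"
    unfolding invariant_algebras_def fun_cstar_gen_def
    using alg inv DA(2) by (intro CollectI conjI ballI) blast+
  show "A \<subseteq> fun_cstar_gen Y (A \<union> B)" "B \<subseteq> fun_cstar_gen Y (A \<union> B)"
    unfolding fun_cstar_gen_def by blast+
  show "fun_cstar_gen Y (A \<union> B) \<subseteq> C"
    if "C \<in> inv_algs" "A \<subseteq> C" "B \<subseteq> C" for C
    unfolding fun_cstar_gen_def using invariant_algebraD(1)[OF that(1)] that(2,3) by blast
qed

lemma op_cstar_algebra_full: "op_cstar_algebra (Y.cp (C0 Y))"
  by (rule Y.crossed_product_op_cstar_algebra[OF C0_algebra Y.translate_C0])

lemma closed_under_lub_intermediate_algebras: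
  "closed_under_lub (intermediate_algebras (Y.cp (C0_via Y \<pi> X)) (Y.cp (C0 Y)))
     (\<lambda>C D. op_cstar_gen (C \<union> D))"
  (is "closed_under_lub (intermediate_algebras ?A ?B) _")
  unfolding closed_under_lub_def
proof (intro ballI conjI impI)
  fix C D assume C: "C \<in> intermediate_algebras ?A ?B" and D: "D \<in> intermediate_algebras ?A ?B"
  have C': "op_cstar_algebra C" "?A \<subseteq> C" "C \<subseteq> ?B" and D': "op_cstar_algebra D" "?A \<subseteq> D" "D \<subseteq> ?B"
    using C D unfolding intermediate_algebras_def by blast+
  have "op_cstar_algebra (\<Inter>{C, D})" by (rule op_cstar_algebra_Inter) (use C' D' in auto)
  then show "C \<inter> D \<in> intermediate_algebras ?A ?B"
    unfolding intermediate_algebras_def using C' D' by auto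
  let ?\<F> = "{E. op_cstar_algebra E \<and> C \<union> D \<subseteq> E}"
  have B: "?B \<in> ?\<F>" using op_cstar_algebra_full C' D' by blast
  then have "op_cstar_algebra (\<Inter>?\<F>)" by (intro op_cstar_algebra_Inter) blast+
  then show "op_cstar_gen (C \<union> D) \<in> intermediate_algebras ?A ?B"
    unfolding intermediate_algebras_def op_cstar_gen_def using B C'(2) by blast
  show "C \<subseteq> op_cstar_gen (C \<union> D)" "D \<subseteq> op_cstar_gen (C \<union> D)"
    unfolding op_cstar_gen_def by blast+
  show "op_cstar_gen (C \<union> D) \<subseteq> E" if "E \<in> intermediate_algebras ?A ?B" "C \<subseteq> E" "D \<subseteq> E" for E
    using that unfolding op_cstar_gen_def intermediate_algebras_def by blast
qed

text \<open>The image under \<pi> of the set where \<open>f\<close> is large is compact. The sum of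
  squares from a partition of unity is 1 there and between 0 and 1 elsewhere, where \<open>f\<close>
  is small anyway.\<close>

lemma approximate_unit:
  assumes f: "f \<in> C0 Y" and e: "0 < e"
  obtains u where "u \<in> C0_via Y \<pi> X" "\<And>y. y \<in> topspace Y \<Longrightarrow> cmod (f y - f y * u y) \<le> e"
proof -
  have K: "compactin X (\<pi> ` {y \<in> topspace Y. e \<le> cmod (f y)})"
    by (rule image_compactin[OF C0_compact[OF f e] quotient_imp_continuous_map[OF quot]])
  obtain I and h :: "'x \<Rightarrow> 'x \<Rightarrow> real" where I: "finite I"
    and hC: "\<And>i. i \<in> I \<Longrightarrow> (\<lambda>x. complex_of_real (h i x)) \<in> C0 X"
    and h_le: "\<And>x. (\<Sum>i\<in>I. (h i x)\<^sup>2) \<le> 1"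
    and h_eq: "\<And>x. x \<in> \<pi> ` {y \<in> topspace Y. e \<le> cmod (f y)} \<Longrightarrow> (\<Sum>i\<in>I. (h i x)\<^sup>2) = 1"
    by (rule X.displaced_partition[OF lcX hX finite.emptyI empty_subsetI Set.ball_empty[THEN iffD2, OF TrueI] K]) (rule that)
  define u where "u x = (\<Sum>i\<in>I. complex_of_real ((h i x)\<^sup>2))" for x
  have "u \<in> C0 X"
    unfolding u_def
  proof (rule X.cop_sum(1)[OF X.one_closed I])
    fix i assume "i \<in> I"
    then show "(\<lambda>x. complex_of_real ((h i x)\<^sup>2)) \<in> C0 X"
      using fca_mult[OF C0_algebra hC hC, of i i] by (simp add: power2_eq_square)
  qed
  then have "(\<lambda>y. if y \<in> topspace Y then u (\<pi> y) else 0) \<in> C0_via Y \<pi> X" unfolding C0_via_def by blast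
  moreover have "cmod (f y - f y * (if y \<in> topspace Y then u (\<pi> y) else 0)) \<le> e" if y: "y \<in> topspace Y" for y
  proof -
    let ?q = "\<Sum>i\<in>I. (h i (\<pi> y))\<^sup>2"
    have eq: "f y - f y * (if y \<in> topspace Y then u (\<pi> y) else 0) = complex_of_real (1 - ?q) * f y"
      using y by (simp add: u_def algebra_simps)
    show ?thesis
    proof (cases "e \<le> cmod (f y)")
      case True
      then have "?q = 1" using h_eq[of "\<pi> y"] y by blast
      then show ?thesis unfolding eq using e by simp
    next
      case False
      have "0 \<le> ?q" by (intro sum_nonneg) simp
      then have "cmod (complex_of_real (1 - ?q) * f y) \<le> 1 * cmod (f y)"
        unfolding norm_mult norm_of_real using h_le[of "\<pi> y"] by (intro mult_right_mono) auto
      then show ?thesis unfolding eq using False by simp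
    qed
  qed
  ultimately show thesis by (rule that)
qed

text \<open>The candidate algebra consists of the functions f with f\<lambda>(e) in
  \<open>D\<close>. The main point is that f\<lambda>(s) lies in \<open>D\<close> for one s exactly
  when it does for every s; this is where an approximate unit from \<open>C0 X\<close> replaces
  multiplication by the unitaries.\<close>

lemma intermediate_algebra_is_crossed_product:
  assumes AP: "approximation_property G" and free: "free_action G X \<alpha>"
    and D: "D \<in> intermediate_algebras (Y.cp (C0_via Y \<pi> X)) (Y.cp (C0 Y))"
  shows "\<exists>A\<in>inv_algs. Y.cp A = D"
proof -
  note C = C0_algebra[of Y] and 1 = X.one_closed
  have alg: "op_cstar_algebra D" and sub: "Y.cp (C0_via Y \<pi> X) \<subseteq> D"
    and le: "D \<subseteq> Y.cp (C0 Y)"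
    using D unfolding intermediate_algebras_def by blast+
  have viaC: "u \<in> C0 Y" if "u \<in> C0_via Y \<pi> X" for u using that C0_fibresD1 by (simp only: C0_via_\<pi>)
  have viaD: "Y.cop u s \<in> D" if "u \<in> C0_via Y \<pi> X" "s \<in> carrier G" for u s
    using subsetD[OF sub Y.cop_in_crossed_product[OF that(2,1)]] .
  have limit: "Y.cop f s \<in> D"
    if f: "f \<in> C0 Y" and s: "s \<in> carrier G"
      and approx: "\<And>e. 0 < e \<Longrightarrow> \<exists>g\<in>C0 Y. Y.cop g s \<in> D \<and> (\<forall>y\<in>topspace Y. cmod (f y - g y) \<le> e)" for f s
  proof -
    have "Y.cop f s \<in> closure D"
      unfolding closure_approachable
    proof (intro allI impI)
      fix e :: real assume e: "0 < e"
      then obtain g where g: "g \<in> C0 Y" "Y.cop g s \<in> D" "\<forall>y\<in>topspace Y. cmod (f y - g y) \<le> e/2"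
        using approx[of "e/2"] by auto
      have "norm (Y.cop f s - Y.cop g s) \<le> e/2"
        unfolding Y.cop_diff[OF s f g(1), symmetric] by (rule Y.norm_cop_le[OF s]) (use g(3) e in auto)
      then have "dist (Y.cop g s) (Y.cop f s) < e" using e by (simp add: dist_norm norm_minus_commute)
      then show "\<exists>U\<in>D. dist U (Y.cop f s) < e" using g(2) by blast
    qed
    then show ?thesis using closure_closed[OF oca_closed[OF alg]] by simp
  qed
  \<comment> \<open>Membership of f\<lambda>(s) can be tested after multiplying f by functions from
    \<open>C0 X\<close>, because \<open>D\<close> is closed and these contain an approximate unit
    for f.\<close>
  have limit_unit: "Y.cop f s \<in> D" if f: "f \<in> C0 Y" and s: "s \<in> carrier G"
    and u: "\<And>u. u \<in> C0_via Y \<pi> X \<Longrightarrow> Y.cop (\<lambda>y. f y * u y) s \<in> D" for f s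
  proof (rule limit[OF f s])
    fix e :: real assume "0 < e"
    then obtain v where v: "v \<in> C0_via Y \<pi> X" "\<And>y. y \<in> topspace Y \<Longrightarrow> cmod (f y - f y * v y) \<le> e"
      by (rule approximate_unit[OF f]) (rule that)
    then show "\<exists>g\<in>C0 Y. Y.cop g s \<in> D \<and> (\<forall>y\<in>topspace Y. cmod (f y - g y) \<le> e)"
      using fca_mult[OF C f viaC[OF v(1)]] u[OF v(1)] by (intro bexI[of _ "\<lambda>y. f y * v y"]) auto
  qed
  define A where "A = {f \<in> C0 Y. Y.cop f \<one> \<in> D}"
  have A_C0: "f \<in> C0 Y" and A_D: "Y.cop f \<one> \<in> D" if "f \<in> A" for f using that by (auto simp: A_def)
  have fca: "fun_cstar_algebra Y A"
    unfolding fun_cstar_algebra_def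
  proof (intro conjI ballI allI impI)
    show "A \<subseteq> C0 Y" by (auto simp: A_def)
    show "(\<lambda>_. 0) \<in> A" unfolding A_def using fca_zero[OF C] Y.cop_zero[OF 1] oca_zero[OF alg] by simp
    fix f g assume f: "f \<in> A" and g: "g \<in> A"
    show "(\<lambda>y. f y + g y) \<in> A"
      unfolding A_def using fca_add[OF C A_C0[OF f] A_C0[OF g]] oca_add[OF alg A_D[OF f] A_D[OF g]]
        Y.cop_add[OF 1 A_C0[OF f] A_C0[OF g]] by simp
    have "Y.cop f \<one> o\<^sub>L Y.cop g \<one> = Y.cop (\<lambda>y. f y * g y) \<one>"
      using Y.cop_compose[OF 1 1 A_C0[OF f] A_C0[OF g]] Y.translate_one[OF A_C0[OF g]] by simp
    then show "(\<lambda>y. f y * g y) \<in> A"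
      unfolding A_def using fca_mult[OF C A_C0[OF f] A_C0[OF g]] oca_compose[OF alg A_D[OF f] A_D[OF g]] by simp
  next
    fix c f assume f: "f \<in> A"
    show "(\<lambda>y. c * f y) \<in> A"
      unfolding A_def using fca_scale[OF C A_C0[OF f], of c] oca_cscale[OF alg A_D[OF f], of c] Y.cop_cscale[OF 1 A_C0[OF f], of c]
      by simp
  next
    fix f assume f: "f \<in> A"
    have cC: "(\<lambda>y. cnj (f y)) \<in> C0 Y" by (rule fca_cnj[OF C A_C0[OF f]])
    obtain S where S: "S \<in> D" "is_adjoint S (Y.cop f \<one>)" using oca_adjoint[OF alg A_D[OF f]] by blast
    have "is_adjoint (Y.cop (\<lambda>y. cnj (f y)) \<one>) (Y.cop f \<one>)"
      using Y.cop_adjoint[OF 1 A_C0[OF f]] Y.translate_one[OF cC] by simp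
    \<comment> \<open>\<open>D\<close> contains some adjoint; uniqueness identifies it with the
      operator of the conjugate function.\<close>
    then have "S = Y.cop (\<lambda>y. cnj (f y)) \<one>" by (rule adjoint_unique[OF S(2)])
    then show "(\<lambda>y. cnj (f y)) \<in> A" unfolding A_def using S(1) cC by simp
  next
    fix f assume f: "f \<in> C0 Y" and lim: "\<forall>e>0. \<exists>g\<in>A. \<forall>y\<in>topspace Y. cmod (f y - g y) \<le> e"
    have "Y.cop f \<one> \<in> D"
    proof (rule limit[OF f 1])
      fix e :: real assume e: "0 < e"
      from lim[THEN spec, THEN mp, OF e] obtain g where "g \<in> A" "\<forall>y\<in>topspace Y. cmod (f y - g y) \<le> e"
        by (rule bexE)
      then show "\<exists>g\<in>C0 Y. Y.cop g \<one> \<in> D \<and> (\<forall>y\<in>topspace Y. cmod (f y - g y) \<le> e)" using A_C0 A_D by blast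
    qed
    then show "f \<in> A" using f by (simp add: A_def)
  qed
  have cop_iff: "Y.cop f s \<in> D \<longleftrightarrow> f \<in> A" if f: "f \<in> C0 Y" and s: "s \<in> carrier G" for f s
  proof
    assume fD: "Y.cop f s \<in> D"
    have "Y.cop f \<one> \<in> D"
    proof (rule limit_unit[OF f 1])
      fix u assume u: "u \<in> C0_via Y \<pi> X"
      \<comment> \<open>Chosen so that \<open>?v\<close> becomes \<open>u\<close> again after being
        moved past \<lambda>(s).\<close>
      let ?v = "translate Y \<beta> s u"
      have v: "?v \<in> C0_via Y \<pi> X" by (rule translate_C0_via[OF s u])
      have "translate Y \<beta> (inv s) ?v = u"
        using s C0_outside[OF viaC[OF u]] by (auto simp: translate_def fun_eq_iff)
      then have "Y.cop f s o\<^sub>L Y.cop ?v (inv s) = Y.cop (\<lambda>y. f y * u y) \<one>"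
        using Y.cop_compose[OF s X.inv_closed[OF s] f viaC[OF v]] s by simp
      then show "Y.cop (\<lambda>y. f y * u y) \<one> \<in> D"
        using oca_compose[OF alg fD viaD[OF v X.inv_closed[OF s]]] by simp
    qed
    then show "f \<in> A" using f by (simp add: A_def)
  next
    assume fA: "f \<in> A"
    show "Y.cop f s \<in> D"
    proof (rule limit_unit[OF f s])
      fix u assume u: "u \<in> C0_via Y \<pi> X"
      have "Y.cop f \<one> o\<^sub>L Y.cop u s = Y.cop (\<lambda>y. f y * u y) s"
        using Y.cop_compose[OF 1 s f viaC[OF u]] Y.translate_one[OF viaC[OF u]] s by simp
      then show "Y.cop (\<lambda>y. f y * u y) s \<in> D"
        using oca_compose[OF alg A_D[OF fA] viaD[OF u s]] by simp
    qed
  qed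
  have inv: "translate Y \<beta> s f \<in> A" if s: "s \<in> carrier G" and f: "f \<in> A" for s f
  proof -
    have fC: "f \<in> C0 Y" by (rule A_C0[OF f])
    have tC: "translate Y \<beta> s f \<in> C0 Y" by (rule Y.translate_C0[OF s fC])
    \<comment> \<open>Multiplying f\<lambda>(e) on the left by u\<lambda>(s^(-1)) translates f but
      leaves the group element s^(-1) behind; \<open>cop_iff\<close> then removes it.\<close>
    have "Y.cop (translate Y \<beta> s f) (inv s) \<in> D"
    proof (rule limit_unit[OF tC X.inv_closed[OF s]])
      fix u assume u: "u \<in> C0_via Y \<pi> X"
      have "Y.cop u (inv s) o\<^sub>L Y.cop f \<one> = Y.cop (\<lambda>y. translate Y \<beta> s f y * u y) (inv s)"
        using Y.cop_compose[OF X.inv_closed[OF s] 1 viaC[OF u] fC] s by (simp add: mult.commute)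
      then show "Y.cop (\<lambda>y. translate Y \<beta> s f y * u y) (inv s) \<in> D"
        using oca_compose[OF alg viaD[OF u X.inv_closed[OF s]] A_D[OF f]] by simp
    qed
    then show ?thesis using cop_iff[OF tC X.inv_closed[OF s]] by blast
  qed
  have "C0_via Y \<pi> X \<subseteq> A" using viaC viaD[OF _ 1] by (auto simp: A_def)
  then have A: "A \<in> inv_algs" unfolding invariant_algebras_def using fca inv by blast
  have "Y.cp A = D"
  proof
    have "{Y.cop f s | f s. f \<in> A \<and> s \<in> carrier G} \<subseteq> D" using cop_iff A_C0 by blast
    then have "span {Y.cop f s | f s. f \<in> A \<and> s \<in> carrier G} \<subseteq> D"
      by (rule span_minimal[OF _ oca_subspace[OF alg]])
    then show "Y.cp A \<subseteq> D"
      unfolding crossed_product_def by (rule closure_minimal[OF _ oca_closed[OF alg]])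
  next
    show "D \<subseteq> Y.cp A"
    proof
      fix T assume T: "T \<in> D"
      then have TC: "T \<in> Y.cp (C0 Y)" using le by blast
      show "T \<in> Y.cp A"
      proof (rule Y.approximation_property_Fourier[OF AP TC Y.crossed_product_op_cstar_algebra[OF fca inv]])
        fix s assume s: "s \<in> carrier G"
        have "Y.cop (Y.coefficient s T) s \<in> D"
          by (rule coefficient_in_intermediate_algebra[OF alg sub free T TC s])
        then have "Y.coefficient s T \<in> A" using cop_iff[OF Y.coefficient_limit[OF C TC s] s] by blast
        then show "Y.cop (Y.coefficient s T) s \<in> Y.cp A" by (rule Y.cop_in_crossed_product[OF s])
      qed
    qed
  qed
  then show ?thesis using A by blast
qed

text \<open>The coefficient at the unit recovers an algebra from its crossed product. This order
  statement yields both injectivity and compatibility with the lattice operations.\<close>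

lemma crossed_product_subset_iff:
  assumes A: "A \<in> inv_algs" and B: "B \<in> inv_algs"
  shows "Y.cp A \<subseteq> Y.cp B \<longleftrightarrow> A \<subseteq> B"
proof
  note DA = invariant_algebraD[OF A] and DB = invariant_algebraD[OF B]
  assume le: "Y.cp A \<subseteq> Y.cp B"
  show "A \<subseteq> B"
  proof
    fix f assume f: "f \<in> A"
    have "Y.cop f \<one> \<in> Y.cp B"
      using le Y.cop_in_crossed_product[OF X.one_closed f] by blast
    then show "f \<in> B" using Y.cop_in_crossed_product_iff[OF DB(1) fca_C0[OF DA(1) f] X.one_closed] by blast
  qed
qed (rule Y.crossed_product_mono)

lemma bij_betw_crossed_product:
  assumes AP: "approximation_property G" and free: "free_action G X \<alpha>"
  shows "bij_betw (Y.cp) (inv_algs)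
    (intermediate_algebras (Y.cp (C0_via Y \<pi> X)) (Y.cp (C0 Y)))"
proof (rule bij_betwI')
  fix A B assume A: "A \<in> inv_algs" and B: "B \<in> inv_algs"
  show "Y.cp A = Y.cp B \<longleftrightarrow> A = B"
    using crossed_product_subset_iff[OF A B] crossed_product_subset_iff[OF B A] by blast
next
  fix A assume "A \<in> inv_algs"
  note D = invariant_algebraD[OF this]
  have "op_cstar_algebra (Y.cp A)" by (rule Y.crossed_product_op_cstar_algebra[OF D(1,3)])
  moreover have "Y.cp A \<subseteq> Y.cp (C0 Y)"
    using fca_C0[OF D(1)] by (intro Y.crossed_product_mono) blast
  ultimately show "Y.cp A \<in> intermediate_algebras (Y.cp (C0_via Y \<pi> X)) (Y.cp (C0 Y))"
    unfolding intermediate_algebras_def using Y.crossed_product_mono[OF D(2)] by blast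
next
  fix D assume "D \<in> intermediate_algebras (Y.cp (C0_via Y \<pi> X)) (Y.cp (C0 Y))"
  from intermediate_algebra_is_crossed_product[OF AP free this]
  show "\<exists>A\<in>inv_algs. D = Y.cp A" by blast
qed

end

theorem theorem2p3:
  fixes G :: "('g, 'm) monoid_scheme"
    and X :: "'x topology" and Y :: "'y topology"
    and \<alpha> :: "'g \<Rightarrow> 'x \<Rightarrow> 'x" and \<beta> :: "'g \<Rightarrow> 'y \<Rightarrow> 'y" and \<pi> :: "'y \<Rightarrow> 'x"
    and L :: "('g, 'x, 'y, 'z) extension set set"
  assumes "group G" and "approximation_property G"
    and "locally_compact_space X" and "Hausdorff_space X"
    and "locally_compact_space Y" and "Hausdorff_space Y"
    and "top_action G X \<alpha>" and "free_action G X \<alpha>"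
    and "top_action G Y \<beta>" and "free_action G Y \<beta>"
    and "factor_map G Y \<beta> X \<alpha> \<pi>" and "preimages_compact Y X \<pi>"
    and universe: "topspace Y \<lesssim> (UNIV :: 'z set)"
    and L: "L = extension_classes G X \<alpha> Y \<beta> \<pi>"
  shows "lattice_isomorphism
           L (extension_join Y L) (extension_meet Y L)
           (intermediate_algebras (crossed_product G Y \<beta> (C0_via Y \<pi> X))
                                  (crossed_product G Y \<beta> (C0 Y)))
           (\<lambda>C D. op_cstar_gen (C \<union> D)) (\<inter>)
           (\<lambda>c. crossed_product G Y \<beta> (class_C0 Y c))"
proof -
  interpret proper_factor G X \<alpha> Y \<beta> \<pi>
    using assms by (intro proper_factor.intro G_space.intro proper_factor_axioms.intro)
  have "extension_join Y L = (\<lambda>c d. the_inv_into L (class_C0 Y) (fun_cstar_gen Y (class_C0 Y c \<union> class_C0 Y d)))"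
    "extension_meet Y L = (\<lambda>c d. the_inv_into L (class_C0 Y) (class_C0 Y c \<inter> class_C0 Y d))"
    by (intro ext, simp add: extension_join_def extension_meet_def)+
  then show ?thesis
    using lattice_isomorphism_of_order_isomorphism[OF bij_betw_class_C0[OF L universe]
        closed_under_lub_invariant_algebras closed_under_lub_intermediate_algebras
        bij_betw_crossed_product[OF assms(2,8)] crossed_product_subset_iff]
    by simp
qed

end
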